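(* Fix any $h_{\min}\leq 1/2$ and any constant $\epsilon>0$. Consider the throughput maximization problem on line-networks with windows and arbitrary heights in which every demand $a$ satisfies $h(a)\geq h_{\min}$. There is a distributed algorithm for this problem with approximation ratio $(23+\epsilon)$, i.e. it outputs a feasible solution $S$ with $p(S)\ge p(\mathrm{Opt})/(23+\epsilon)$. Its number of communication rounds is $O\!\left(\frac{T_{MIS}}{h_{\min}}\log n\,\log\frac{1}{\epsilon}\,\log\frac{p_{\max}}{p_{\min}}\right)$.
   Context: Line-networks with windows and heights: the timeline consists of timeslots $1,\dots,n$. There is a set $\mathcal{T}$ of $r$ resources, each offering bandwidth $1$ at every timeslot. There are $m$ processors. Each processor $P$ owns one demand $a$ with release time $\mathrm{rt}(a)$, deadline $\mathrm{dl}(a)$, processing time $\rho(a)$, profit $p(a)>0$ and height $h(a)\in(0,1]$, and has a set $\mathrm{Acc}(P)\subseteq\mathcal{T}$ of accessible resources. A demand instance of $a$ is a resource $T\in\mathrm{Acc}(P)$ together with an interval of $\rho(a)$ consecutive timeslots inside $[\mathrm{rt}(a),\mathrm{dl}(a)]$; it has the height and profit of $a$. A feasible solution selects at most one instance per demand such that, for every resource and every timeslot, the total height of selected instances on that resource containing that timeslot is at most $1$. Its profit is the sum of profits. $\mathrm{Opt}$ is an optimal solution, and $p_{\max},p_{\min}$ are the maximum and minimum profits. $h_{\min}$ is known to all processors. Distributed model: synchronous message passing. Processors communicate directly iff they share an accessible resource. Local computation is polynomial. $T_{MIS}$ is the number of rounds needed to compute a maximal independent set in an arbitrary graph with $N=nmr$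 vertices. *)

theory Defs
  imports Complex_Main
begin

section \<open>Local computation\<close>

text \<open>
  Processors compute on finite trees over the reals.  A program is an expression of a small
  first-order language with bounded iteration; its running time is its number of elementary
  operations on a real RAM (arithmetic and comparisons of reals have unit cost), where producing
  a tree costs as many steps as it has nodes.  Bounded iteration (over lists, and over
  \<open>0, \<dots>, k - 1\<close> by \<open>Upto\<close>) loses nothing here, as only polynomial-time programs are considered.
  Numeric constants are natural numbers, so that a program cannot hide information in the
  digits of a real constant.
\<close>

datatype val = Empty | Num real | Node val val

primrec val_of_list :: "val list \<Rightarrow> val" where
  "val_of_list [] = Empty"
| "val_of_list (x # xs) = Node x (val_of_list xs)"

primrec elems :: "val \<Rightarrow> val list" where
  "elems Empty = []"
| "elems (Num x) = []"
| "elems (Node x y) = x # elems y"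

primrec num_of :: "val \<Rightarrow> real" where
  "num_of Empty = 0"
| "num_of (Num x) = x"
| "num_of (Node x y) = 0"

primrec vsize :: "val \<Rightarrow> nat" where
  "vsize Empty = 1"
| "vsize (Num x) = 1"
| "vsize (Node x y) = 1 + vsize x + vsize y"

datatype arith_op = Plus | Minus | Times | Divide

primrec arith :: "arith_op \<Rightarrow> real \<Rightarrow> real \<Rightarrow> real" where
  "arith Plus x y = x + y"
| "arith Minus x y = x - y"
| "arith Times x y = x * y"
| "arith Divide x y = x / y"

text \<open>
  Variables are de Bruijn indices into the environment.  The last branch of \<open>Case\<close> binds the two
  subtrees (indices 0 and 1); the body of \<open>Fold\<close> binds the current list element (index 0) and
  the accumulator (index 1).
\<close>

datatype expr =
    Var nat
  | Const nat
  | Nothing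
  | Join expr expr
  | Case expr expr expr expr
  | Arith arith_op expr expr
  | IfLess expr expr expr expr
  | Upto expr
  | Let expr expr
  | Fold expr expr expr

primrec eval :: "expr \<Rightarrow> val list \<Rightarrow> val" where
  "eval (Var i) env = (if i < length env then env ! i else Empty)"
| "eval (Const k) env = Num (real k)"
| "eval Nothing env = Empty"
| "eval (Join a b) env = Node (eval a env) (eval b env)"
| "eval (Case e a b c) env =
     (case eval e env of
        Empty \<Rightarrow> eval a env
      | Num _ \<Rightarrow> eval b env
      | Node x y \<Rightarrow> eval c (x # y # env))"
| "eval (Arith f a b) env = Num (arith f (num_of (eval a env)) (num_of (eval b env)))"
| "eval (IfLess a b c d) env =
     (if num_of (eval a env) < num_of (eval b env) then eval c env else eval d env)"
| "eval (Upto a) env =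
     val_of_list (map (\<lambda>k. Num (real k)) [0..<nat \<lfloor>num_of (eval a env)\<rfloor>])"
| "eval (Let a b) env = eval b (eval a env # env)"
| "eval (Fold l a b) env =
     fold (\<lambda>x s. eval b (x # s # env)) (elems (eval l env)) (eval a env)"

primrec cost :: "expr \<Rightarrow> val list \<Rightarrow> nat" where
  "cost (Var i) env = vsize (eval (Var i) env)"
| "cost (Const k) env = 1"
| "cost Nothing env = 1"
| "cost (Join a b) env = cost a env + cost b env + vsize (eval (Join a b) env)"
| "cost (Case e a b c) env =
     1 + cost e env +
     (case eval e env of
        Empty \<Rightarrow> cost a env
      | Num _ \<Rightarrow> cost b env
      | Node x y \<Rightarrow> cost c (x # y # env))"
| "cost (Arith f a b) env = 1 + cost a env + cost b env"
| "cost (IfLess a b c d) env =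
     1 + cost a env + cost b env +
     (if num_of (eval a env) < num_of (eval b env) then cost c env else cost d env)"
| "cost (Upto a) env = cost a env + vsize (eval (Upto a) env)"
| "cost (Let a b) env = 1 + cost a env + cost b (eval a env # env)"
| "cost (Fold l a b) env =
     1 + cost l env + cost a env +
     snd (fold (\<lambda>x (s, c). (eval b (x # s # env), c + 1 + cost b (x # s # env)))
       (elems (eval l env)) (eval a env, 0))"


section \<open>Synchronous message passing\<close>

text \<open>
  The nodes \<open>0, \<dots>, nodes G - 1\<close> are known by their numbers, and \<open>knowledge G v\<close> is what node \<open>v\<close>
  knows initially.  In every round each node sends a message to all its neighbours and then
  updates its state from the messages received, each tagged with its sender.  As messages may be
  arbitrarily long, sending the same message to all neighbours is no restriction.
\<close>

record network =
  nodes :: nat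
  link :: "nat \<Rightarrow> nat \<Rightarrow> bool"
  knowledge :: "nat \<Rightarrow> val"

text \<open>
  \<open>message\<close> and \<open>answer\<close> are evaluated on the current state; \<open>update\<close> on the state (index 0) and
  the received messages (index 1).  A node is undecided as long as its answer is \<open>Empty\<close>; its
  first other answer is its irrevocable output.  A decided node may still relay messages.
\<close>

record algorithm =
  message :: expr
  update :: expr
  answer :: expr

definition inbox :: "algorithm \<Rightarrow> network \<Rightarrow> (nat \<Rightarrow> val) \<Rightarrow> nat \<Rightarrow> val" where
  "inbox A G st v =
     val_of_list (map (\<lambda>u. Node (Num (real u)) (eval (message A) [st u]))
       (filter (\<lambda>u. link G v u) [0..<nodes G]))"

primrec state :: "algorithm \<Rightarrow> network \<Rightarrow> nat \<Rightarrow> nat \<Rightarrow> val" where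
  "state A G 0 = knowledge G"
| "state A G (Suc t) = (\<lambda>v. eval (update A) [state A G t v, inbox A G (state A G t) v])"

definition answer_at :: "algorithm \<Rightarrow> network \<Rightarrow> nat \<Rightarrow> nat \<Rightarrow> val" where
  "answer_at A G t v = eval (answer A) [state A G t v]"

definition outcome :: "algorithm \<Rightarrow> network \<Rightarrow> nat \<Rightarrow> val" where
  "outcome A G v = answer_at A G (LEAST t. answer_at A G t v \<noteq> Empty) v"

definition terminates_within :: "algorithm \<Rightarrow> network \<Rightarrow> nat \<Rightarrow> bool" where
  "terminates_within A G t \<longleftrightarrow> (\<forall>v<nodes G. \<exists>s\<le>t. answer_at A G s v \<noteq> Empty)"

definition local_cost :: "algorithm \<Rightarrow> network \<Rightarrow> nat \<Rightarrow> nat \<Rightarrow> nat" where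
  "local_cost A G t v =
     cost (answer A) [state A G t v] + cost (message A) [state A G t v] +
     cost (update A) [state A G t v, inbox A G (state A G t) v]"

text \<open>
  Polynomial local computation on the networks \<open>net x\<close>, \<open>x \<in> X\<close>, with size parameter \<open>sz x\<close>.
  The bound may also grow polynomially with the number of rounds that have passed, since the
  messages received so far are part of the input of a local step.
\<close>

definition poly_local_time :: "algorithm \<Rightarrow> 'x set \<Rightarrow> ('x \<Rightarrow> network) \<Rightarrow> ('x \<Rightarrow> nat) \<Rightarrow> bool" where
  "poly_local_time A X net sz \<longleftrightarrow>
     (\<exists>c d. \<forall>x\<in>X. \<forall>t. \<forall>v<nodes (net x). local_cost A (net x) t v \<le> c * (sz x + t + 1) ^ d)"


section \<open>Maximal independent sets\<close>

definition simple_graph :: "nat \<Rightarrow> (nat \<Rightarrow> nat \<Rightarrow> bool) \<Rightarrow> bool" where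
  "simple_graph N E \<longleftrightarrow> (\<forall>u<N. \<not> E u u) \<and> (\<forall>u<N. \<forall>v<N. E u v \<longrightarrow> E v u)"

definition maximal_independent :: "nat \<Rightarrow> (nat \<Rightarrow> nat \<Rightarrow> bool) \<Rightarrow> nat set \<Rightarrow> bool" where
  "maximal_independent N E W \<longleftrightarrow>
     W \<subseteq> {..<N} \<and> (\<forall>u\<in>W. \<forall>v\<in>W. \<not> E u v) \<and> (\<forall>v\<in>{..<N} - W. \<exists>u\<in>W. E v u)"

definition graph_network :: "nat \<times> (nat \<Rightarrow> nat \<Rightarrow> bool) \<Rightarrow> network" where
  "graph_network = (\<lambda>(N, E).
     \<lparr>nodes = N, link = E, knowledge = (\<lambda>v. val_of_list [Num (real N), Num (real v)])\<rparr>)"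

text \<open>
  \<open>M\<close> computes a maximal independent set of every graph with \<open>N\<close> vertices in at most \<open>T N\<close> rounds,
  the communication network being the graph itself; output \<open>1\<close> means membership.
\<close>

definition MIS_algorithm :: "algorithm \<Rightarrow> (nat \<Rightarrow> nat) \<Rightarrow> bool" where
  "MIS_algorithm M T \<longleftrightarrow>
     poly_local_time M {(N, E). simple_graph N E} graph_network fst \<and>
     (\<forall>N E. simple_graph N E \<longrightarrow>
        terminates_within M (graph_network (N, E)) (T N) \<and>
        maximal_independent N E {v. v < N \<and> outcome M (graph_network (N, E)) v = Num 1})"


section \<open>Throughput maximization on line-networks with windows\<close>

record demand =
  release :: nat
  deadline :: nat
  proc_time :: nat
  profit :: real
  height :: real

text \<open>
  Timeslots are \<open>1, \<dots>, slots I\<close>, resources \<open>0, \<dots>, resources I - 1\<close> and processors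
  \<open>0, \<dots>, processors I - 1\<close>; a demand is identified with the processor owning it.
\<close>

record line_network =
  slots :: nat
  resources :: nat
  processors :: nat
  demand_of :: "nat \<Rightarrow> demand"
  acc :: "nat \<Rightarrow> nat set"

definition valid_line_network :: "line_network \<Rightarrow> bool" where
  "valid_line_network I \<longleftrightarrow>
     (\<forall>i<processors I.
        1 \<le> release (demand_of I i) \<and> deadline (demand_of I i) \<le> slots I \<and>
        1 \<le> proc_time (demand_of I i) \<and> 0 < profit (demand_of I i) \<and>
        0 < height (demand_of I i) \<and> height (demand_of I i) \<le> 1 \<and>
        acc I i \<subseteq> {..<resources I})"

text \<open>
  The demand instance \<open>(i, T, s)\<close> schedules the demand of processor \<open>i\<close> on resource \<open>T\<close> during
  the timeslots \<open>s, \<dots>, s + proc_time - 1\<close>.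
\<close>

definition occupied :: "line_network \<Rightarrow> nat \<times> nat \<times> nat \<Rightarrow> nat set" where
  "occupied I = (\<lambda>(i, T, s). {s..<s + proc_time (demand_of I i)})"

definition demand_instances :: "line_network \<Rightarrow> (nat \<times> nat \<times> nat) set" where
  "demand_instances I =
     {(i, T, s). i < processors I \<and> T \<in> acc I i \<and>
        occupied I (i, T, s) \<subseteq> {release (demand_of I i)..deadline (demand_of I i)}}"

definition feasible :: "line_network \<Rightarrow> (nat \<times> nat \<times> nat) set \<Rightarrow> bool" where
  "feasible I S \<longleftrightarrow>
     S \<subseteq> demand_instances I \<and>
     (\<forall>d\<in>S. \<forall>e\<in>S. fst d = fst e \<longrightarrow> d = e) \<and>
     (\<forall>T<resources I. \<forall>t\<in>{1..slots I}.
        (\<Sum>d\<in>{d\<in>S. fst (snd d) = T \<and> t \<in> occupied I d}. height (demand_of I (fst d))) \<le> 1)"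

definition total_profit :: "line_network \<Rightarrow> (nat \<times> nat \<times> nat) set \<Rightarrow> real" where
  "total_profit I S = (\<Sum>d\<in>S. profit (demand_of I (fst d)))"

definition optimal :: "line_network \<Rightarrow> (nat \<times> nat \<times> nat) set \<Rightarrow> bool" where
  "optimal I S \<longleftrightarrow> feasible I S \<and> (\<forall>S'. feasible I S' \<longrightarrow> total_profit I S' \<le> total_profit I S)"

definition p_max :: "line_network \<Rightarrow> real" where
  "p_max I = Max ((\<lambda>i. profit (demand_of I i)) ` {..<processors I})"

definition p_min :: "line_network \<Rightarrow> real" where
  "p_min I = Min ((\<lambda>i. profit (demand_of I i)) ` {..<processors I})"

definition admissible :: "real \<Rightarrow> line_network set" where
  "admissible hmin =
     {I. valid_line_network I \<and> (\<forall>i<processors I. hmin \<le> height (demand_of I i))}"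

text \<open>
  Initially a processor knows the dimensions of the problem, \<open>hmin\<close>, \<open>\<epsilon>\<close>, its own number, its
  demand and its accessible resources; in particular it knows neither \<open>p_max\<close> and \<open>p_min\<close> nor
  the other processors' data.
\<close>

definition processor_network :: "real \<Rightarrow> real \<Rightarrow> line_network \<Rightarrow> network" where
  "processor_network hmin \<epsilon> I =
     \<lparr>nodes = processors I,
      link = (\<lambda>i j. i \<noteq> j \<and> acc I i \<inter> acc I j \<noteq> {}),
      knowledge = (\<lambda>i. val_of_list
        [Num (real (slots I)), Num (real (resources I)), Num (real (processors I)),
         Num hmin, Num \<epsilon>, Num (real i),
         Num (real (release (demand_of I i))), Num (real (deadline (demand_of I i))),
         Num (real (proc_time (demand_of I i))),
         Num (profit (demand_of I i)), Num (height (demand_of I i)),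
         val_of_list (map (\<lambda>T. Num (real T)) (sorted_list_of_set (acc I i)))])\<rparr>"

text \<open>
  A processor selects the instance on resource \<open>T\<close> starting at \<open>s\<close> by the output \<open>Node T s\<close>;
  any other output means that its demand is not selected.
\<close>

definition selected :: "algorithm \<Rightarrow> network \<Rightarrow> (nat \<times> nat \<times> nat) set" where
  "selected A G =
     {(i, T, s). i < nodes G \<and> outcome A G i = Node (Num (real T)) (Num (real s))}"

text \<open>
  Logarithm factors in an O-bound are read as being at least 1: all profits may coincide, the
  timeline may consist of one slot, and \<open>\<epsilon>\<close> may exceed 1.
\<close>

definition log1 :: "real \<Rightarrow> real" where
  "log1 x = max 1 (log 2 x)"

lemma optimal_exists: "valid_line_network I \<Longrightarrow> \<exists>S. optimal I S"
proof -
  assume v: "valid_line_network I"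
  have "demand_instances I \<subseteq> {..<processors I} \<times> {..<resources I} \<times> {..slots I}"
  proof
    fix d assume d: "d \<in> demand_instances I"
    obtain i T s where dd: "d = (i, T, s)" by (cases d) auto
    have "s \<in> occupied I (i, T, s)"
      using d v unfolding dd demand_instances_def valid_line_network_def occupied_def by force
    then have "s \<le> deadline (demand_of I i)"
      using d unfolding dd demand_instances_def by auto
    then show "d \<in> {..<processors I} \<times> {..<resources I} \<times> {..slots I}"
      using d v unfolding dd demand_instances_def valid_line_network_def by force
  qed
  then have "finite (demand_instances I)"
    by (rule finite_subset) auto
  then have fin: "finite {S. feasible I S}"
    by (rule finite_subset[rotated, OF finite_Pow_iff[THEN iffD2]]) (auto simp: feasible_def)
  have ne: "feasible I {}" by (simp add: feasible_def)
  define m where "m = Max (total_profit I ` {S. feasible I S})"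
  have "m \<in> total_profit I ` {S. feasible I S}"
    unfolding m_def using fin ne by (intro Max_in) auto
  then obtain S where "feasible I S" "total_profit I S = m" by auto
  moreover have "total_profit I S' \<le> m" if "feasible I S'" for S'
    unfolding m_def using fin that by (intro Max_ge) auto
  ultimately show ?thesis unfolding optimal_def by blast
qed

end

theory Submission
  imports Defs
begin

text \<open>
  The demand instances are processed by a two-phase (local ratio) algorithm that raises an
  instance by its residual profit.  Lengths are classified by powers of two; an unsatisfied
  instance waits for the conflicting unsatisfied ones in shorter classes, and then for those in its
  own class with at least twice its profit.  Hence an active instance which is not raised in a step
  is charged by a neighbour of comparable profit and becomes satisfied within \<open>O(1 / hmin)\<close> active
  steps, so that \<open>O(1 / hmin \<cdot> log n \<cdot> log (p_max / p_min))\<close> maximal independent sets suffice.  Wide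
  and narrow instances only compete for demands, not for slots, which loses a factor \<open>7 / (2 / 3)\<close>;
  keeping the better of the two on every resource loses another factor \<open>2\<close>.  This gives the ratio
  \<open>21\<close>, independently of \<open>\<epsilon>\<close>.

  Neither the number of steps nor the running time of the given algorithm for maximal independent
  sets is known to the processors.  Therefore every processor collects the data of its
  neighbourhood of radius \<open>t\<close> in \<open>t\<close> rounds and simulates the whole algorithm on it, counting the
  rounds.  If the count is below \<open>t\<close>, then nothing beyond the neighbourhood can have influenced the
  outcome at its centre, and the processor outputs it.
\<close>

section \<open>Polynomial-time programs\<close>

text \<open>The constants come from two opposite demands on \<open>weight\<close>. A raised vertex
  that is not chosen must be paid for by its blockers; these fill at least half a slot if it is
  narrow, and one wide blocker must do if it is wide, whence the factor 2 on heights. A feasible set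
  must not be charged too often: 1 for the shared demand and 2 for each of three critical slots,
  three being enough because a vertex is charged only by those less than twice as long. This is the
  7, and handling short lengths first reconciles both demands. The other obstacle is that the
  statement asks for expressions of a concrete language with a cost bound. None is written out:
  \<open>PT\<close> says that some polynomial-time expression computes a function, and closure rules
  assemble the simulation. The given algorithm enters only through its local cost, which also bounds
  the size of its states. In the locality argument a step with \<open>m\<close> solver rounds
  spreads information over \<open>m + 3\<close> hops but is counted as \<open>m + 4\<close> rounds;
  the hop saved pays for the same step in the second phase.\<close>

primrec lift_renaming :: "(nat \<Rightarrow> nat option) \<Rightarrow> nat \<Rightarrow> nat option" where
  "lift_renaming f 0 = Some 0"
| "lift_renaming f (Suc i) = map_option Suc (f i)"

primrec rename :: "expr \<Rightarrow> (nat \<Rightarrow> nat option) \<Rightarrow> expr" where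
  "rename (Var i) f = (case f i of None \<Rightarrow> Nothing | Some j \<Rightarrow> Var j)"
| "rename (Const k) f = Const k"
| "rename Nothing f = Nothing"
| "rename (Join a b) f = Join (rename a f) (rename b f)"
| "rename (Case e a b d) f =
     Case (rename e f) (rename a f) (rename b f) (rename d (lift_renaming (lift_renaming f)))"
| "rename (Arith q a b) f = Arith q (rename a f) (rename b f)"
| "rename (IfLess a b d e) f = IfLess (rename a f) (rename b f) (rename d f) (rename e f)"
| "rename (Upto a) f = Upto (rename a f)"
| "rename (Let a b) f = Let (rename a f) (rename b (lift_renaming f))"
| "rename (Fold l a b) f =
     Fold (rename l f) (rename a f) (rename b (lift_renaming (lift_renaming f)))"

text \<open>A variable beyond the environment evaluates to \<open>Empty\<close>, and so must a variable without image.\<close>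

definition renames :: "(nat \<Rightarrow> nat option) \<Rightarrow> val list \<Rightarrow> val list \<Rightarrow> bool" where
  "renames f \<rho> \<rho>' \<longleftrightarrow> (\<forall>i. eval (Var i) \<rho> = (case f i of None \<Rightarrow> Empty | Some j \<Rightarrow> eval (Var j) \<rho>'))"

lemma renames_Cons: "renames f \<rho> \<rho>' \<Longrightarrow> renames (lift_renaming f) (x # \<rho>) (x # \<rho>')"
  unfolding renames_def
proof (intro allI)
  fix i assume f: "\<forall>i. eval (Var i) \<rho> = (case f i of None \<Rightarrow> Empty | Some j \<Rightarrow> eval (Var j) \<rho>')"
  show "eval (Var i) (x # \<rho>) = (case lift_renaming f i of None \<Rightarrow> Empty | Some j \<Rightarrow> eval (Var j) (x # \<rho>'))"
    using spec[OF f, of "i - 1"] by (cases i) (auto split: option.splits)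
qed

text \<open>Costs agree exactly, not only values: a variable without image becomes
  \<open>Nothing\<close>, which costs 1, just like reading \<open>Empty\<close> beyond the
  environment. Under binders the lifted renaming fixes the new variables.\<close>

lemma eval_cost_rename:
  "renames f \<rho> \<rho>' \<Longrightarrow> eval (rename e f) \<rho>' = eval e \<rho> \<and> cost (rename e f) \<rho>' = cost e \<rho>"
proof (induction e arbitrary: f \<rho> \<rho>')
  case (Var i)
  then have "eval (Var i) \<rho> = (case f i of None \<Rightarrow> Empty | Some j \<Rightarrow> eval (Var j) \<rho>')"
    by (simp only: renames_def)
  then show ?case by (simp split: option.splits)
next
  case (Case e a b d)
  note [simp] = Case.IH(1-3)[OF Case.prems] Case.IH(4)[OF renames_Cons[OF renames_Cons[OF Case.prems]]]
  show ?case by (simp split: val.splits)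
next
  case (Let a b)
  note [simp] = Let.IH(1)[OF Let.prems] Let.IH(2)[OF renames_Cons[OF Let.prems]]
  show ?case by simp
next
  case (Fold l a b)
  note [simp] = Fold.IH(1,2)[OF Fold.prems] Fold.IH(3)[OF renames_Cons[OF renames_Cons[OF Fold.prems]]]
  show ?case by simp
next
  case (Join a b)
  note [simp] = Join.IH(1,2)[OF Join.prems]
  show ?case by simp
next
  case (Arith q a b)
  note [simp] = Arith.IH(1,2)[OF Arith.prems]
  show ?case by simp
next
  case (IfLess a b d e)
  note [simp] = IfLess.IH(1-4)[OF IfLess.prems]
  show ?case by simp
next
  case (Upto a)
  note [simp] = Upto.IH(1)[OF Upto.prems]
  show ?case by simp
qed simp_all

lemmas eval_rename = eval_cost_rename[THEN conjunct1] and cost_rename = eval_cost_rename[THEN conjunct2]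

lemma renames_weaken: "renames (\<lambda>i. Some (Suc i)) \<rho> (x # \<rho>)"
  by (simp add: renames_def)

lemma renames_weaken_second: "renames (\<lambda>i. Some (if i = 0 then 0 else Suc i)) (x # \<rho>) (x # y # \<rho>)"
  by (auto simp: renames_def nth_Cons split: nat.splits)

text \<open>The expressions of the given algorithm may contain indices beyond the one or two
  variables they are run on. In a longer environment these would read foreign values, so they are
  sent to \<open>None\<close>.\<close>

lemma renames_extend: "renames (\<lambda>i. if i < length \<rho> then Some i else None) \<rho> (\<rho> @ \<rho>')"
  by (auto simp: renames_def nth_append)

section \<open>Sizes of values and costs of expressions\<close>

lemma elems_val_of_list [simp]: "elems (val_of_list xs) = xs"
  by (induction xs) auto

lemma length_elems_less_vsize: "length (elems v) < vsize v"
  by (induction v) auto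

lemma vsize_val_of_list: "vsize (val_of_list xs) = 1 + length xs + (\<Sum>x\<leftarrow>xs. vsize x)"
  by (induction xs) auto

text \<open>Decouples the counter from the state, so that the cost of a loop becomes a sum along the
  sequence of its accumulators.\<close>

lemma fold_counting:
  "fold (\<lambda>x (s, c :: nat). (f x s, c + 1 + g x s)) xs (s, c) =
    (fold f xs s, c + (\<Sum>k<length xs. 1 + g (xs ! k) (fold f (take k xs) s)))"
  by (induction xs rule: rev_induct) (auto simp: nth_append)

lemma cost_Fold:
  "cost (Fold l a b) \<rho> = 1 + cost l \<rho> + cost a \<rho> +
    (let xs = elems (eval l \<rho>); st = (\<lambda>k. fold (\<lambda>x s. eval b (x # s # \<rho>)) (take k xs) (eval a \<rho>))
     in \<Sum>k<length xs. 1 + cost b (xs ! k # st k # \<rho>))"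
  using fold_counting[of "\<lambda>x s. eval b (x # s # \<rho>)" "\<lambda>x s. cost b (x # s # \<rho>)"]
  by (simp add: Let_def)

text \<open>Trees are paid for where they are produced or read, and the other constructs only hand
  on what a subexpression produced. A cost bound is therefore a size bound too, which is how the
  states and messages of the given algorithm are controlled.\<close>

lemma vsize_eval_le_cost: "vsize (eval e \<rho>) \<le> cost e \<rho>"
proof (induction e arbitrary: \<rho>)
  case (Case e a b c)
  show ?case
  proof (cases "eval e \<rho>")
    case Empty
    then show ?thesis using Case.IH(2)[of \<rho>] by simp
  next
    case (Num r)
    then show ?thesis using Case.IH(3)[of \<rho>] by simp
  next
    case (Node x y)
    then show ?thesis using Case.IH(4)[of "x # y # \<rho>"] by simp
  qed
next
  case (Let a b)
  show ?case using Let.IH(2)[of "eval a \<rho> # \<rho>"] by simp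
next
  case (Fold l a b)
  let ?st = "\<lambda>xs. fold (\<lambda>x s. eval b (x # s # \<rho>)) xs (eval a \<rho>)"
  \<comment> \<open>The accumulator was produced by the last execution of the body, or is the start
    value if there was none; a single summand bounds it.\<close>
  have "vsize (?st xs) \<le> cost a \<rho> + (\<Sum>k<length xs. 1 + cost b (xs ! k # ?st (take k xs) # \<rho>))" for xs
  proof (cases xs rule: rev_cases)
    case Nil
    then show ?thesis using Fold.IH(2)[of \<rho>] by simp
  next
    case (snoc ys y)
    have "vsize (eval b (y # ?st ys # \<rho>)) \<le> cost b (y # ?st ys # \<rho>)" by (rule Fold.IH)
    then show ?thesis using snoc by (simp add: nth_append)
  qed
  from this[of "elems (eval l \<rho>)"] show ?case
    unfolding cost_Fold Let_def by (simp add: comp_def)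
next
  case (IfLess a b c d)
  show ?case using IfLess.IH(3)[of \<rho>] IfLess.IH(4)[of \<rho>] by simp
qed auto

text \<open>A single program has to work for all inputs of a context; the bound is their size.\<close>

datatype 'x ctx = Ctx (inputs: "'x set") (bound: "'x \<Rightarrow> nat") (vars: "'x \<Rightarrow> val list")

definition poly_bounded :: "'x ctx \<Rightarrow> ('x \<Rightarrow> nat) \<Rightarrow> bool" where
  "poly_bounded G f \<longleftrightarrow> (\<exists>c d. \<forall>x\<in>inputs G. f x \<le> c * (bound G x + 1) ^ d)"

text \<open>One expression has to serve all inputs, and only the values on \<open>inputs G\<close>
  matter. As the expression is hidden by the quantifier, the rules below act as a compiler:
  \<open>intro\<close> builds a program along the structure of the function.\<close>

definition PT :: "'x ctx \<Rightarrow> ('x \<Rightarrow> val) \<Rightarrow> bool" where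
  "PT G F \<longleftrightarrow> (\<exists>e. (\<forall>x\<in>inputs G. eval e (vars G x) = F x) \<and> poly_bounded G (\<lambda>x. cost e (vars G x)))"

lemma poly_bounded_mono:
  "poly_bounded G g \<Longrightarrow> (\<And>x. x \<in> inputs G \<Longrightarrow> f x \<le> g x) \<Longrightarrow> poly_bounded G f"
  unfolding poly_bounded_def by (meson order_trans)

lemma poly_bounded_const: "poly_bounded G (\<lambda>_. k)"
  unfolding poly_bounded_def by (intro exI[of _ k] exI[of _ 0]) auto

lemma poly_bounded_bound: "poly_bounded G (bound G)"
  unfolding poly_bounded_def by (intro exI[of _ 1] exI[of _ 1]) auto

lemma poly_bounded_add:
  assumes "poly_bounded G f" "poly_bounded G g"
  shows "poly_bounded G (\<lambda>x. f x + g x)"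
proof -
  obtain c d c' d' where
    f: "\<And>x. x \<in> inputs G \<Longrightarrow> f x \<le> c * (bound G x + 1) ^ d" and
    g: "\<And>x. x \<in> inputs G \<Longrightarrow> g x \<le> c' * (bound G x + 1) ^ d'"
    using assms unfolding poly_bounded_def by metis
  have "f x + g x \<le> (c + c') * (bound G x + 1) ^ (d + d')" if "x \<in> inputs G" for x
  proof -
    have "(bound G x + 1) ^ d \<le> (bound G x + 1) ^ (d + d')"
         "(bound G x + 1) ^ d' \<le> (bound G x + 1) ^ (d + d')"
      by (rule power_increasing; simp)+
    then have "c * (bound G x + 1) ^ d \<le> c * (bound G x + 1) ^ (d + d')"
       "c' * (bound G x + 1) ^ d' \<le> c' * (bound G x + 1) ^ (d + d')"
      by (simp_all add: mult_le_mono2)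
    then show ?thesis using f[OF that] g[OF that] by (simp only: distrib_right)
  qed
  then show ?thesis unfolding poly_bounded_def by blast
qed

lemma poly_bounded_mult:
  assumes "poly_bounded G f" "poly_bounded G g"
  shows "poly_bounded G (\<lambda>x. f x * g x)"
proof -
  obtain c d c' d' where
    f: "\<And>x. x \<in> inputs G \<Longrightarrow> f x \<le> c * (bound G x + 1) ^ d" and
    g: "\<And>x. x \<in> inputs G \<Longrightarrow> g x \<le> c' * (bound G x + 1) ^ d'"
    using assms unfolding poly_bounded_def by metis
  have "f x * g x \<le> (c * c') * (bound G x + 1) ^ (d + d')" if "x \<in> inputs G" for x
    using mult_le_mono[OF f[OF that] g[OF that]] by (simp only: power_add mult_ac)
  then show ?thesis unfolding poly_bounded_def by blast
qed

lemmas poly_bounded_intros =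
  poly_bounded_const poly_bounded_bound poly_bounded_add poly_bounded_mult

lemma PT_vsize: "PT G F \<Longrightarrow> poly_bounded G (\<lambda>x. vsize (F x))"
  unfolding PT_def using vsize_eval_le_cost by (metis (no_types, lifting) poly_bounded_mono)

lemma PT_cong: "PT G F \<Longrightarrow> (\<And>x. x \<in> inputs G \<Longrightarrow> F x = F' x) \<Longrightarrow> PT G F'"
  unfolding PT_def by metis

lemma PT_I:
  assumes "\<And>x. x \<in> inputs G \<Longrightarrow> eval e (vars G x) = F x"
    and "poly_bounded G g" and "\<And>x. x \<in> inputs G \<Longrightarrow> cost e (vars G x) \<le> g x"
  shows "PT G F"
  unfolding PT_def using assms poly_bounded_mono by metis

lemma PT_var:
  assumes "\<And>x. x \<in> inputs G \<Longrightarrow> i < length (vars G x) \<and> vars G x ! i = F x"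
    and "poly_bounded G (\<lambda>x. vsize (F x))"
  shows "PT G F"
  by (rule PT_I[where e = "Var i", OF _ assms(2)]) (use assms(1) in auto)

lemma PT_nat_const: "PT G (\<lambda>_. Num (real k))"
  by (rule PT_I[where e = "Const k", OF _ poly_bounded_const[of _ 1]]) auto

lemma PT_Empty: "PT G (\<lambda>_. Empty)"
  by (rule PT_I[where e = "Nothing", OF _ poly_bounded_const[of _ 1]]) auto

lemma PT_Node:
  assumes "PT G A" "PT G B"
  shows "PT G (\<lambda>x. Node (A x) (B x))"
proof -
  obtain a where a: "\<And>x. x \<in> inputs G \<Longrightarrow> eval a (vars G x) = A x"
    "poly_bounded G (\<lambda>x. cost a (vars G x))" using assms(1) unfolding PT_def by blast
  obtain b where b: "\<And>x. x \<in> inputs G \<Longrightarrow> eval b (vars G x) = B x"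
    "poly_bounded G (\<lambda>x. cost b (vars G x))" using assms(2) unfolding PT_def by blast
  have "poly_bounded G (\<lambda>x. cost a (vars G x) + cost b (vars G x) + (1 + vsize (A x) + vsize (B x)))"
    by (intro poly_bounded_intros a b PT_vsize assms)
  then show ?thesis
    by (rule PT_I[where e = "Join a b", rotated]) (auto simp: a b)
qed

lemma PT_arith:
  assumes "PT G A" "PT G B"
  shows "PT G (\<lambda>x. Num (arith f (num_of (A x)) (num_of (B x))))"
proof -
  obtain a where a: "\<And>x. x \<in> inputs G \<Longrightarrow> eval a (vars G x) = A x"
    "poly_bounded G (\<lambda>x. cost a (vars G x))" using assms(1) unfolding PT_def by blast
  obtain b where b: "\<And>x. x \<in> inputs G \<Longrightarrow> eval b (vars G x) = B x"
    "poly_bounded G (\<lambda>x. cost b (vars G x))" using assms(2) unfolding PT_def by blast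
  have "poly_bounded G (\<lambda>x. 1 + cost a (vars G x) + cost b (vars G x))"
    by (intro poly_bounded_intros a b)
  then show ?thesis
    by (rule PT_I[where e = "Arith f a b", rotated]) (auto simp: a b)
qed

lemma PT_Let:
  assumes "PT G A" "PT (Ctx (inputs G) (bound G) (\<lambda>x. A x # vars G x)) B"
  shows "PT G B"
proof -
  obtain a where a: "\<And>x. x \<in> inputs G \<Longrightarrow> eval a (vars G x) = A x"
    "poly_bounded G (\<lambda>x. cost a (vars G x))" using assms(1) unfolding PT_def by blast
  obtain b where b: "\<And>x. x \<in> inputs G \<Longrightarrow> eval b (A x # vars G x) = B x"
    "poly_bounded G (\<lambda>x. cost b (A x # vars G x))"
    using assms(2) by (simp add: PT_def poly_bounded_def) blast
  have "poly_bounded G (\<lambda>x. 1 + cost a (vars G x) + cost b (A x # vars G x))"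
    by (intro poly_bounded_intros a b)
  then show ?thesis
    by (rule PT_I[where e = "Let a b", rotated]) (auto simp: a b)
qed

text \<open>A branch has to be correct and cheap only where its test succeeds. Preconditions, such
  as that the data of some processor is known, thus become restrictions of the inputs.\<close>

definition restrict_ctx :: "'x ctx \<Rightarrow> ('x \<Rightarrow> bool) \<Rightarrow> 'x ctx" where
  "restrict_ctx G P = Ctx {x \<in> inputs G. P x} (bound G) (vars G)"

lemma inputs_restrict_ctx [simp]: "inputs (restrict_ctx G P) = {x \<in> inputs G. P x}"
  by (simp add: restrict_ctx_def)

lemma PT_restrict: "PT G F \<Longrightarrow> PT (restrict_ctx G P) F"
  by (simp add: PT_def poly_bounded_def restrict_ctx_def) blast

lemma poly_bounded_if:
  assumes "poly_bounded (restrict_ctx G P) f" "poly_bounded (restrict_ctx G (\<lambda>x. \<not> P x)) g"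
  shows "poly_bounded G (\<lambda>x. if P x then f x else g x)"
proof -
  have "poly_bounded G (\<lambda>x. if P x then f x else 0)" "poly_bounded G (\<lambda>x. if P x then 0 else g x)"
    using assms unfolding poly_bounded_def restrict_ctx_def by auto
  from poly_bounded_add[OF this] show ?thesis by (rule poly_bounded_mono) auto
qed

lemma PT_if_less:
  assumes "PT G A" "PT G B" "\<And>x. x \<in> inputs G \<Longrightarrow> P x \<longleftrightarrow> num_of (A x) < num_of (B x)"
    and "PT (restrict_ctx G P) C" "PT (restrict_ctx G (\<lambda>x. \<not> P x)) D"
  shows "PT G (\<lambda>x. if P x then C x else D x)"
proof -
  obtain a where a: "\<And>x. x \<in> inputs G \<Longrightarrow> eval a (vars G x) = A x"
    "poly_bounded G (\<lambda>x. cost a (vars G x))" using assms(1) unfolding PT_def by blast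
  obtain b where b: "\<And>x. x \<in> inputs G \<Longrightarrow> eval b (vars G x) = B x"
    "poly_bounded G (\<lambda>x. cost b (vars G x))" using assms(2) unfolding PT_def by blast
  obtain c where c: "\<And>x. x \<in> inputs G \<Longrightarrow> P x \<Longrightarrow> eval c (vars G x) = C x"
    "poly_bounded (restrict_ctx G P) (\<lambda>x. cost c (vars G x))"
    using assms(4) by (simp add: PT_def restrict_ctx_def) blast
  obtain d where d: "\<And>x. x \<in> inputs G \<Longrightarrow> \<not> P x \<Longrightarrow> eval d (vars G x) = D x"
    "poly_bounded (restrict_ctx G (\<lambda>x. \<not> P x)) (\<lambda>x. cost d (vars G x))"
    using assms(5) by (simp add: PT_def restrict_ctx_def) blast
  have "poly_bounded G (\<lambda>x. 1 + cost a (vars G x) + cost b (vars G x) +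
    (if P x then cost c (vars G x) else cost d (vars G x)))"
    by (intro poly_bounded_intros poly_bounded_if a b c d)
  then show ?thesis
    by (rule PT_I[where e = "IfLess a b c d", rotated]) (auto simp: a b c d assms(3))
qed

lemma PT_case:
  assumes "PT G A"
    and "PT (restrict_ctx G (\<lambda>x. A x = Empty)) B"
    and "PT (restrict_ctx G (\<lambda>x. \<exists>r. A x = Num r)) C"
    and "PT (Ctx {x \<in> inputs G. \<exists>u w. A x = Node u w} (bound G)
      (\<lambda>x. (case A x of Node u w \<Rightarrow> u) # (case A x of Node u w \<Rightarrow> w) # vars G x)) D"
  shows "PT G (\<lambda>x. case A x of Empty \<Rightarrow> B x | Num _ \<Rightarrow> C x | Node _ _ \<Rightarrow> D x)"
proof -
  let ?env = "\<lambda>x. (case A x of Node u w \<Rightarrow> u) # (case A x of Node u w \<Rightarrow> w) # vars G x"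
  obtain a where a: "\<And>x. x \<in> inputs G \<Longrightarrow> eval a (vars G x) = A x"
    "poly_bounded G (\<lambda>x. cost a (vars G x))" using assms(1) unfolding PT_def by blast
  obtain b where b: "\<And>x. x \<in> inputs G \<Longrightarrow> A x = Empty \<Longrightarrow> eval b (vars G x) = B x"
    "poly_bounded (restrict_ctx G (\<lambda>x. A x = Empty)) (\<lambda>x. cost b (vars G x))"
    using assms(2) by (simp add: PT_def restrict_ctx_def) blast
  obtain c where c: "\<And>x. x \<in> inputs G \<Longrightarrow> \<exists>r. A x = Num r \<Longrightarrow> eval c (vars G x) = C x"
    "poly_bounded (restrict_ctx G (\<lambda>x. \<exists>r. A x = Num r)) (\<lambda>x. cost c (vars G x))"
    using assms(3) by (simp add: PT_def restrict_ctx_def) blast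
  obtain d where d: "\<And>x. x \<in> inputs G \<Longrightarrow> \<exists>u w. A x = Node u w \<Longrightarrow> eval d (?env x) = D x"
    "poly_bounded (restrict_ctx G (\<lambda>x. \<exists>u w. A x = Node u w)) (\<lambda>x. cost d (?env x))"
    using assms(4) by (simp add: PT_def restrict_ctx_def poly_bounded_def) blast
  have "poly_bounded G (\<lambda>x. 1 + cost a (vars G x) +
    ((if A x = Empty then cost b (vars G x) else 0) +
     (if \<exists>r. A x = Num r then cost c (vars G x) else 0) +
     (if \<exists>u w. A x = Node u w then cost d (?env x) else 0)))"
    by (intro poly_bounded_intros poly_bounded_if a b c d)
  then show ?thesis
    by (rule PT_I[where e = "Case a b c d", rotated])
      (auto simp: a b c split: val.splits dest: d(1))
qed

lemma poly_bounded_comp: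
  assumes "poly_bounded G f" "\<And>z. z \<in> inputs H \<Longrightarrow> \<pi> z \<in> inputs G"
    "\<And>z. z \<in> inputs H \<Longrightarrow> bound G (\<pi> z) = bound H z"
  shows "poly_bounded H (\<lambda>z. f (\<pi> z))"
  using assms unfolding poly_bounded_def by metis

lemma PT_comp:
  assumes "PT G F" "\<And>z. z \<in> inputs H \<Longrightarrow> \<pi> z \<in> inputs G \<and> bound G (\<pi> z) = bound H z \<and> vars G (\<pi> z) = vars H z"
  shows "PT H (\<lambda>z. F (\<pi> z))"
  using assms unfolding PT_def poly_bounded_def by metis

lemma PT_weaken:
  assumes "PT (Ctx X s E) F"
  shows "PT (Ctx X s (\<lambda>x. A x # E x)) F"
proof -
  obtain e where e: "\<And>x. x \<in> X \<Longrightarrow> eval e (E x) = F x" "poly_bounded (Ctx X s E) (\<lambda>x. cost e (E x))"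
    using assms unfolding PT_def by auto
  show ?thesis
    by (rule PT_I[where e = "rename e (\<lambda>i. Some (Suc i))" and g = "\<lambda>x. cost e (E x)"])
      (use e in \<open>auto simp: poly_bounded_def eval_rename[OF renames_weaken] cost_rename[OF renames_weaken]\<close>)
qed

lemma PT_weaken2:
  assumes "PT (Ctx X s E) F"
  shows "PT (Ctx X s (\<lambda>x. A x # B x # E x)) F"
  by (intro PT_weaken assms)

text \<open>Embeds a given one-variable program: \<open>Let\<close> puts the computed argument at
  index 0, and the renaming hides everything behind it. The cost bound is a premise, since nothing
  else is known about \<open>e\<close>.\<close>

lemma PT_run:
  assumes "PT G A" "poly_bounded G (\<lambda>x. cost e [A x])"
  shows "PT G (\<lambda>x. eval e [A x])"
proof (rule PT_Let[OF assms(1)], rule PT_I[where e = "rename e (\<lambda>i. if i < length [Empty] then Some i else None)"])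
  show "poly_bounded (Ctx (inputs G) (bound G) (\<lambda>x. A x # vars G x)) (\<lambda>x. cost e [A x])"
    using assms(2) by (simp add: poly_bounded_def)
qed (use eval_rename[OF renames_extend, of e "[_]"] cost_rename[OF renames_extend, of e "[_]"] in simp_all)

lemma PT_run2:
  assumes "PT G A" "PT G B" "poly_bounded G (\<lambda>x. cost e [A x, B x])"
  shows "PT G (\<lambda>x. eval e [A x, B x])"
proof (rule PT_Let[OF assms(2)], rule PT_Let)
  show "PT (Ctx (inputs G) (bound G) (\<lambda>x. B x # vars G x)) A"
    by (rule PT_weaken) (use assms(1) in simp)
  let ?H = "Ctx (inputs G) (bound G) (\<lambda>x. A x # B x # vars G x)"
  have "PT ?H (\<lambda>x. eval e [A x, B x])"
  proof (rule PT_I[where e = "rename e (\<lambda>i. if i < length [Empty, Empty] then Some i else None)"])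
    show "poly_bounded ?H (\<lambda>x. cost e [A x, B x])"
      using assms(3) by (simp add: poly_bounded_def)
  qed (use eval_rename[OF renames_extend, of e "[_, _]"] cost_rename[OF renames_extend, of e "[_, _]"] in simp_all)
  then show "PT (Ctx (inputs (Ctx (inputs G) (bound G) (\<lambda>x. B x # vars G x)))
     (bound (Ctx (inputs G) (bound G) (\<lambda>x. B x # vars G x)))
     (\<lambda>x. A x # vars (Ctx (inputs G) (bound G) (\<lambda>x. B x # vars G x)) x)) (\<lambda>x. eval e [A x, B x])"
    by simp
qed

subsection \<open>Loops\<close>

text \<open>Each iteration is an input of its own, with the environment that \<open>Fold\<close>
  gives to its body. The bound remains that of the outer input, so polynomial cost of the body is
  uniform over all iterations.\<close>

definition foreach_ctx :: "'x ctx \<Rightarrow> ('x \<Rightarrow> val list) \<Rightarrow> ('x \<Rightarrow> nat \<Rightarrow> val) \<Rightarrow> ('x \<times> nat) ctx" where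
  "foreach_ctx G l st = Ctx (SIGMA x:inputs G. {..<length (l x)}) (\<lambda>z. bound G (fst z))
     (\<lambda>z. l (fst z) ! snd z # st (fst z) (snd z) # vars G (fst z))"

lemma inputs_foreach_ctx [simp]:
  "inputs (foreach_ctx G l st) = (SIGMA x:inputs G. {..<length (l x)})"
  by (simp add: foreach_ctx_def)

text \<open>A loop is specified by the sequence \<open>st\<close> of its accumulators, and its body
  only has to compute \<open>st x (Suc k)\<close> from \<open>st x k\<close>. The uniform cost of an
  iteration times the length of the list bounds the total.\<close>

lemma PT_foreach:
  assumes L: "PT G (\<lambda>x. L x)" and A: "PT G (\<lambda>x. st x 0)"
    and B: "PT (foreach_ctx G (\<lambda>x. elems (L x)) st) (\<lambda>z. st (fst z) (Suc (snd z)))"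
  shows "PT G (\<lambda>x. st x (length (elems (L x))))"
proof -
  obtain l where l: "\<And>x. x \<in> inputs G \<Longrightarrow> eval l (vars G x) = L x"
    "poly_bounded G (\<lambda>x. cost l (vars G x))" using L unfolding PT_def by blast
  obtain a where a: "\<And>x. x \<in> inputs G \<Longrightarrow> eval a (vars G x) = st x 0"
    "poly_bounded G (\<lambda>x. cost a (vars G x))" using A unfolding PT_def by blast
  obtain b c d where b: "\<And>x k. x \<in> inputs G \<Longrightarrow> k < length (elems (L x)) \<Longrightarrow>
      eval b (elems (L x) ! k # st x k # vars G x) = st x (Suc k)"
    and cd: "\<And>x k. x \<in> inputs G \<Longrightarrow> k < length (elems (L x)) \<Longrightarrow>
      cost b (elems (L x) ! k # st x k # vars G x) \<le> c * (bound G x + 1) ^ d"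
    using B by (simp add: PT_def foreach_ctx_def poly_bounded_def) blast
  have st: "fold (\<lambda>y s. eval b (y # s # vars G x)) (take k (elems (L x))) (st x 0) = st x k"
    if "x \<in> inputs G" "k \<le> length (elems (L x))" for x k
    using that(2) by (induction k) (auto simp: take_Suc_conv_app_nth b[OF that(1)])
  have "poly_bounded G (\<lambda>x. (bound G x + 1) ^ d)"
    unfolding poly_bounded_def by (intro exI[of _ 1] exI[of _ d]) simp
  then have "poly_bounded G (\<lambda>x. 1 + cost l (vars G x) + cost a (vars G x) +
      vsize (L x) * (1 + c * (bound G x + 1) ^ d))"
    by (intro poly_bounded_intros l a PT_vsize L)
  then show ?thesis
  proof (rule PT_I[where e = "Fold l a b", rotated])
    fix x assume x: "x \<in> inputs G"
    show "eval (Fold l a b) (vars G x) = st x (length (elems (L x)))"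
      using st[OF x order_refl] by (simp add: l a x)
    have "(\<Sum>k<length (elems (L x)). 1 + cost b (elems (L x) ! k # st x k # vars G x)) \<le>
      length (elems (L x)) * (1 + c * (bound G x + 1) ^ d)"
      using sum_bounded_above[of "{..<length (elems (L x))}"
        "\<lambda>k. 1 + cost b (elems (L x) ! k # st x k # vars G x)" "1 + c * (bound G x + 1) ^ d"] cd[OF x]
      by simp
    also have "\<dots> \<le> vsize (L x) * (1 + c * (bound G x + 1) ^ d)"
      using length_elems_less_vsize[of "L x"] by (intro mult_le_mono1) simp
    finally show "cost (Fold l a b) (vars G x) \<le> 1 + cost l (vars G x) + cost a (vars G x) +
      vsize (L x) * (1 + c * (bound G x + 1) ^ d)"
      unfolding cost_Fold Let_def by (simp add: l a x st)
  qed
qed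

lemma PT_foreach_elem:
  assumes "PT G L"
  shows "PT (foreach_ctx G (\<lambda>x. elems (L x)) st) (\<lambda>z. elems (L (fst z)) ! snd z)"
proof (rule PT_var[where i = 0])
  have "poly_bounded (foreach_ctx G (\<lambda>x. elems (L x)) st) (\<lambda>z. vsize (L (fst z)))"
    using PT_vsize[OF assms] by (rule poly_bounded_comp) (auto simp: foreach_ctx_def)
  then show "poly_bounded (foreach_ctx G (\<lambda>x. elems (L x)) st) (\<lambda>z. vsize (elems (L (fst z)) ! snd z))"
  proof (rule poly_bounded_mono)
    have "vsize (elems v ! k) \<le> vsize v" if "k < length (elems v)" for v k
      using that
    proof (induction v arbitrary: k)
      case (Node x y)
      then show ?case by (cases k) (auto intro: le_SucI trans_le_add2)
    qed auto
    then show "vsize (elems (L (fst z)) ! snd z) \<le> vsize (L (fst z))"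
      if "z \<in> inputs (foreach_ctx G (\<lambda>x. elems (L x)) st)" for z
      using that by (auto simp: foreach_ctx_def)
  qed
qed (simp add: foreach_ctx_def)

text \<open>Reading a variable costs its size, so the accumulator is available only if it stays of
  polynomial size in all iterations. This side condition rules out repeated doubling of a
  tree.\<close>

lemma PT_foreach_acc:
  assumes "poly_bounded (foreach_ctx G l st) (\<lambda>z. vsize (st (fst z) (snd z)))"
  shows "PT (foreach_ctx G l st) (\<lambda>z. st (fst z) (snd z))"
  by (rule PT_var[where i = 1, OF _ assms]) (simp add: foreach_ctx_def)

lemma PT_foreach_outer:
  assumes "PT G F"
  shows "PT (foreach_ctx G l st) (\<lambda>z. F (fst z))"
  unfolding foreach_ctx_def
  by (rule PT_weaken2, rule PT_comp[OF assms]) auto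

lemma poly_bounded_foreach_outer:
  assumes "poly_bounded G f"
  shows "poly_bounded (foreach_ctx G l st) (\<lambda>z. f (fst z))"
  using assms by (rule poly_bounded_comp) (auto simp: foreach_ctx_def)

section \<open>Programs for reals, natural numbers and truth values\<close>

definition PTr :: "'x ctx \<Rightarrow> ('x \<Rightarrow> real) \<Rightarrow> bool" where
  "PTr G f \<longleftrightarrow> PT G (\<lambda>x. Num (f x))"

definition PTn :: "'x ctx \<Rightarrow> ('x \<Rightarrow> nat) \<Rightarrow> bool" where
  "PTn G f \<longleftrightarrow> PTr G (\<lambda>x. real (f x))"

definition PTb :: "'x ctx \<Rightarrow> ('x \<Rightarrow> bool) \<Rightarrow> bool" where
  "PTb G P \<longleftrightarrow> PTr G (\<lambda>x. if P x then 1 else 0)"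

lemma PTr_cong: "PTr G f \<Longrightarrow> (\<And>x. x \<in> inputs G \<Longrightarrow> f x = g x) \<Longrightarrow> PTr G g"
  unfolding PTr_def by (erule PT_cong) simp

lemma PTn_cong: "PTn G f \<Longrightarrow> (\<And>x. x \<in> inputs G \<Longrightarrow> f x = g x) \<Longrightarrow> PTn G g"
  unfolding PTn_def by (erule PTr_cong) simp

lemma PTb_cong: "PTb G P \<Longrightarrow> (\<And>x. x \<in> inputs G \<Longrightarrow> P x \<longleftrightarrow> Q x) \<Longrightarrow> PTb G Q"
  unfolding PTb_def by (erule PTr_cong) simp

lemma PTr_restrict: "PTr G f \<Longrightarrow> PTr (restrict_ctx G P) f"
  unfolding PTr_def by (rule PT_restrict)

lemma PTn_restrict: "PTn G f \<Longrightarrow> PTn (restrict_ctx G P) f"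
  unfolding PTn_def by (rule PTr_restrict)

lemma PTb_restrict: "PTb G Q \<Longrightarrow> PTb (restrict_ctx G P) Q"
  unfolding PTb_def by (rule PTr_restrict)

lemmas PT_restricts = PT_restrict PTr_restrict PTn_restrict PTb_restrict

lemma PT_Num: "PTr G f \<Longrightarrow> PT G (\<lambda>x. Num (f x))"
  by (simp add: PTr_def)

lemma PT_Num_nat: "PTn G f \<Longrightarrow> PT G (\<lambda>x. Num (real (f x)))"
  by (simp add: PTr_def PTn_def)

lemma PTr_of_nat: "PTn G f \<Longrightarrow> PTr G (\<lambda>x. real (f x))"
  by (simp add: PTn_def)

lemma PT_of_bool: "PTb G P \<Longrightarrow> PT G (\<lambda>x. Num (if P x then 1 else 0))"
  by (simp add: PTr_def PTb_def)

lemma PTn_const: "PTn G (\<lambda>_. k)"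
  unfolding PTn_def PTr_def by (rule PT_nat_const)

lemma PTr_0: "PTr G (\<lambda>_. 0)" and PTr_1: "PTr G (\<lambda>_. 1)"
  and PTr_numeral: "PTr G (\<lambda>_. numeral w)"
  using PTn_const[of G 0] PTn_const[of G 1] PTn_const[of G "numeral w"] unfolding PTn_def by simp_all

lemma PTr_num_of: "PT G F \<Longrightarrow> PTr G (\<lambda>x. num_of (F x))"
  unfolding PTr_def using PT_arith[OF _ PT_nat_const[of _ 0], of G F Plus] by simp

lemma PTr_arith: "PTr G f \<Longrightarrow> PTr G g \<Longrightarrow> PTr G (\<lambda>x. arith q (f x) (g x))"
  unfolding PTr_def using PT_arith[of G "\<lambda>x. Num (f x)" "\<lambda>x. Num (g x)" q] by simp

lemma PTr_add: "PTr G f \<Longrightarrow> PTr G g \<Longrightarrow> PTr G (\<lambda>x. f x + g x)"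
  using PTr_arith[of G f g Plus] by simp

lemma PTr_diff: "PTr G f \<Longrightarrow> PTr G g \<Longrightarrow> PTr G (\<lambda>x. f x - g x)"
  using PTr_arith[of G f g Minus] by simp

lemma PTr_mult: "PTr G f \<Longrightarrow> PTr G g \<Longrightarrow> PTr G (\<lambda>x. f x * g x)"
  using PTr_arith[of G f g Times] by simp

lemma PTr_divide: "PTr G f \<Longrightarrow> PTr G g \<Longrightarrow> PTr G (\<lambda>x. f x / g x)"
  using PTr_arith[of G f g Divide] by simp

lemma PTn_add: "PTn G f \<Longrightarrow> PTn G g \<Longrightarrow> PTn G (\<lambda>x. f x + g x)"
  unfolding PTn_def of_nat_add by (rule PTr_add)

lemma PTn_mult: "PTn G f \<Longrightarrow> PTn G g \<Longrightarrow> PTn G (\<lambda>x. f x * g x)"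
  unfolding PTn_def of_nat_mult by (rule PTr_mult)

lemma PT_if_less':
  assumes "PTr G f" "PTr G g" "PT (restrict_ctx G (\<lambda>x. f x < g x)) A"
    "PT (restrict_ctx G (\<lambda>x. \<not> f x < g x)) B"
  shows "PT G (\<lambda>x. if f x < g x then A x else B x)"
  using assms(1,2) unfolding PTr_def
  by (rule PT_if_less[where P = "\<lambda>x. f x < g x"]) (use assms(3,4) in auto)

lemma PTb_less:
  assumes "PTr G f" "PTr G g"
  shows "PTb G (\<lambda>x. f x < g x)"
proof -
  have "PT G (\<lambda>x. if f x < g x then Num 1 else Num 0)"
    by (intro PT_if_less' assms PT_Num PTr_0 PTr_1)
  then show ?thesis unfolding PTb_def PTr_def by (rule PT_cong) auto
qed

lemma PT_if:
  assumes "PTb G P" "PT (restrict_ctx G P) A" "PT (restrict_ctx G (\<lambda>x. \<not> P x)) B"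
  shows "PT G (\<lambda>x. if P x then A x else B x)"
  using PTr_0[unfolded PTr_def] assms(1)[unfolded PTb_def PTr_def]
  by (rule PT_if_less) (use assms(2,3) in auto)

lemma PTr_if:
  assumes "PTb G P" "PTr (restrict_ctx G P) f" "PTr (restrict_ctx G (\<lambda>x. \<not> P x)) g"
  shows "PTr G (\<lambda>x. if P x then f x else g x)"
  using PT_if[OF assms(1) assms(2,3)[unfolded PTr_def]]
  unfolding PTr_def by (rule PT_cong) auto

lemma PTn_if:
  assumes "PTb G P" "PTn (restrict_ctx G P) f" "PTn (restrict_ctx G (\<lambda>x. \<not> P x)) g"
  shows "PTn G (\<lambda>x. if P x then f x else g x)"
  using PTr_if[OF assms(1) assms(2,3)[unfolded PTn_def]]
  unfolding PTn_def by (rule PTr_cong) auto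

lemma PTb_if:
  assumes "PTb G P" "PTb (restrict_ctx G P) Q" "PTb (restrict_ctx G (\<lambda>x. \<not> P x)) R"
  shows "PTb G (\<lambda>x. if P x then Q x else R x)"
  using PTr_if[OF assms(1) assms(2,3)[unfolded PTb_def]]
  unfolding PTb_def by (rule PTr_cong) auto

lemma PTb_True: "PTb G (\<lambda>_. True)" and PTb_False: "PTb G (\<lambda>_. False)"
  using PTr_0[of G] PTr_1[of G] unfolding PTb_def by simp_all

lemma PTb_conj:
  assumes "PTb G P" "PTb (restrict_ctx G P) Q"
  shows "PTb G (\<lambda>x. P x \<and> Q x)"
  using PTb_if[OF assms PTb_False] by (rule PTb_cong) auto

lemma PTb_disj:
  assumes "PTb G P" "PTb (restrict_ctx G (\<lambda>x. \<not> P x)) Q"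
  shows "PTb G (\<lambda>x. P x \<or> Q x)"
  using PTb_if[OF assms(1) PTb_True assms(2)] by (rule PTb_cong) auto

lemma PTb_imp:
  assumes "PTb G P" "PTb (restrict_ctx G P) Q"
  shows "PTb G (\<lambda>x. P x \<longrightarrow> Q x)"
  using PTb_if[OF assms PTb_True] by (rule PTb_cong) auto

lemma PTb_not:
  assumes "PTb G P"
  shows "PTb G (\<lambda>x. \<not> P x)"
  using PTb_if[OF assms PTb_False PTb_True] by (rule PTb_cong) auto

lemma PTb_iff:
  assumes "PTb G P" "PTb G Q"
  shows "PTb G (\<lambda>x. P x \<longleftrightarrow> Q x)"
  using PTb_if[OF assms(1) PTb_restrict[OF assms(2)] PTb_restrict[OF PTb_not[OF assms(2)]]]
  by (rule PTb_cong) auto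

lemma PTb_le: "PTr G f \<Longrightarrow> PTr G g \<Longrightarrow> PTb G (\<lambda>x. f x \<le> g x)"
  using PTb_not[OF PTb_less[of G g f]] by (simp add: not_less)

lemma PTb_eq:
  assumes "PTr G f" "PTr G g"
  shows "PTb G (\<lambda>x. f x = g x)"
  using PTb_conj[OF PTb_le[OF assms] PTb_restrict[OF PTb_le[OF assms(2,1)]]]
  by (rule PTb_cong) auto

lemma PTb_nat_less: "PTn G f \<Longrightarrow> PTn G g \<Longrightarrow> PTb G (\<lambda>x. f x < g x)"
  unfolding PTn_def using PTb_less[of G "\<lambda>x. real (f x)" "\<lambda>x. real (g x)"] by simp

lemma PTb_nat_le: "PTn G f \<Longrightarrow> PTn G g \<Longrightarrow> PTb G (\<lambda>x. f x \<le> g x)"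
  unfolding PTn_def using PTb_le[of G "\<lambda>x. real (f x)" "\<lambda>x. real (g x)"] by simp

lemma PTb_nat_eq: "PTn G f \<Longrightarrow> PTn G g \<Longrightarrow> PTb G (\<lambda>x. f x = g x)"
  unfolding PTn_def using PTb_eq[of G "\<lambda>x. real (f x)" "\<lambda>x. real (g x)"] by simp

lemma PTn_Suc: "PTn G f \<Longrightarrow> PTn G (\<lambda>x. Suc (f x))"
  using PTn_add[OF _ PTn_const[of _ 1], of G f] by simp

lemma PTn_diff:
  assumes "PTn G f" "PTn G g"
  shows "PTn G (\<lambda>x. f x - g x)"
proof -
  have "PTr G (\<lambda>x. if f x < g x then 0 else real (f x) - real (g x))"
    by (intro PTr_if PTb_nat_less assms PTr_0 PTr_diff PTr_restrict PTr_of_nat)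
  then show ?thesis unfolding PTn_def by (rule PTr_cong) auto
qed

lemma PT_case_val:
  assumes "PT G A" "PT G B"
    and "PT (Ctx {x \<in> inputs G. \<exists>u w. A x = Node u w} (bound G)
      (\<lambda>x. (case A x of Node u w \<Rightarrow> u) # (case A x of Node u w \<Rightarrow> w) # vars G x)) D"
  shows "PT G (\<lambda>x. case A x of Node _ _ \<Rightarrow> D x | _ \<Rightarrow> B x)"
  using PT_case[OF assms(1) PT_restrict[OF assms(2)] PT_restrict[OF assms(2)] assms(3)]
  by (rule PT_cong) (auto split: val.splits)

lemma poly_bounded_inputs_mono:
  "poly_bounded G f \<Longrightarrow> inputs H \<subseteq> inputs G \<Longrightarrow> bound H = bound G \<Longrightarrow> poly_bounded H f"
  unfolding poly_bounded_def by fastforce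

lemma PT_fst_Node:
  assumes "PT G A"
  shows "PT G (\<lambda>x. case A x of Node u _ \<Rightarrow> u | _ \<Rightarrow> Empty)"
proof -
  let ?D = "\<lambda>x. case A x of Node u _ \<Rightarrow> u | _ \<Rightarrow> Empty"
  have "PT G (\<lambda>x. case A x of Node _ _ \<Rightarrow> ?D x | _ \<Rightarrow> Empty)"
  proof (rule PT_case_val[OF assms PT_Empty PT_var[where i = 0]])
    have "poly_bounded G (\<lambda>x. vsize (?D x))"
      by (rule poly_bounded_mono[OF PT_vsize[OF assms]]) (auto split: val.splits)
    then show "poly_bounded (Ctx {x \<in> inputs G. \<exists>u w. A x = Node u w} (bound G)
      (\<lambda>x. (case A x of Node u w \<Rightarrow> u) # (case A x of Node u w \<Rightarrow> w) # vars G x)) (\<lambda>x. vsize (?D x))"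
      by (rule poly_bounded_inputs_mono) auto
  qed auto
  then show ?thesis by (rule PT_cong) (auto split: val.splits)
qed

lemma PT_snd_Node:
  assumes "PT G A"
  shows "PT G (\<lambda>x. case A x of Node _ w \<Rightarrow> w | _ \<Rightarrow> Empty)"
proof -
  let ?D = "\<lambda>x. case A x of Node _ w \<Rightarrow> w | _ \<Rightarrow> Empty"
  have "PT G (\<lambda>x. case A x of Node _ _ \<Rightarrow> ?D x | _ \<Rightarrow> Empty)"
  proof (rule PT_case_val[OF assms PT_Empty PT_var[where i = 1]])
    have "poly_bounded G (\<lambda>x. vsize (?D x))"
      by (rule poly_bounded_mono[OF PT_vsize[OF assms]]) (auto split: val.splits)
    then show "poly_bounded (Ctx {x \<in> inputs G. \<exists>u w. A x = Node u w} (bound G)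
      (\<lambda>x. (case A x of Node u w \<Rightarrow> u) # (case A x of Node u w \<Rightarrow> w) # vars G x)) (\<lambda>x. vsize (?D x))"
      by (rule poly_bounded_inputs_mono) auto
  qed auto
  then show ?thesis by (rule PT_cong) (auto split: val.splits)
qed

lemma PT_Node_D:
  assumes "PT G (\<lambda>x. Node (A x) (B x))"
  shows "PT G A" "PT G B"
  using PT_fst_Node[OF assms] PT_snd_Node[OF assms] by simp_all

lemma PTb_is_Node:
  assumes "PT G F"
  shows "PTb G (\<lambda>x. \<exists>u w. F x = Node u w)"
proof -
  have "PT G (\<lambda>x. case F x of Node _ _ \<Rightarrow> Num (real 1) | _ \<Rightarrow> Num (real 0))"
    by (rule PT_case_val) (rule assms PT_nat_const)+
  then show ?thesis unfolding PTb_def PTr_def by (rule PT_cong) (auto split: val.splits)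
qed

lemma PTb_is_Empty:
  assumes "PT G F"
  shows "PTb G (\<lambda>x. F x = Empty)"
proof -
  have "PT G (\<lambda>x. case F x of Empty \<Rightarrow> Num (real 1) | Num _ \<Rightarrow> Num (real 0) | Node _ _ \<Rightarrow> Num (real 0))"
    by (rule PT_case) (rule assms PT_nat_const)+
  then show ?thesis unfolding PTb_def PTr_def by (rule PT_cong) (auto split: val.splits)
qed

lemma PTb_eq_Num:
  assumes "PT G F" "PTr G f"
  shows "PTb G (\<lambda>x. F x = Num (f x))"
proof -
  have "PTb G (\<lambda>x. F x \<noteq> Empty \<and> (\<not> (\<exists>u w. F x = Node u w)) \<and> num_of (F x) = f x)"
    by (intro PTb_conj PTb_not PTb_is_Empty PTb_is_Node PTb_eq PTr_num_of PT_restricts assms)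
  then show ?thesis
  proof (rule PTb_cong)
    show "(F x \<noteq> Empty \<and> (\<not> (\<exists>u w. F x = Node u w)) \<and> num_of (F x) = f x) = (F x = Num (f x))" for x
      by (cases "F x") auto
  qed
qed

subsection \<open>Tables\<close>

text \<open>The variant of \<open>foreach_ctx\<close> without accumulator. A body checked here can
  be used in any loop, as the accumulator is inserted afterwards as a dummy variable at index
  1.\<close>

definition each_ctx :: "'x ctx \<Rightarrow> ('x \<Rightarrow> val list) \<Rightarrow> ('x \<times> nat) ctx" where
  "each_ctx G l = Ctx (SIGMA x:inputs G. {..<length (l x)}) (\<lambda>z. bound G (fst z))
     (\<lambda>z. l (fst z) ! snd z # vars G (fst z))"

lemma inputs_each_ctx [simp]:
  "inputs (each_ctx G l) = (SIGMA x:inputs G. {..<length (l x)})"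
  by (simp add: each_ctx_def)

lemma PT_each_foreach:
  assumes "PT (each_ctx G l) F"
  shows "PT (foreach_ctx G l st) F"
proof -
  obtain e where e: "\<And>z. z \<in> inputs (each_ctx G l) \<Longrightarrow> eval e (vars (each_ctx G l) z) = F z"
    "poly_bounded (each_ctx G l) (\<lambda>z. cost e (vars (each_ctx G l) z))"
    using assms unfolding PT_def by blast
  show ?thesis
    by (rule PT_I[where e = "rename e (\<lambda>i. Some (if i = 0 then 0 else Suc i))" and g = "\<lambda>z. cost e (vars (each_ctx G l) z)"])
      (use e in \<open>auto simp: each_ctx_def foreach_ctx_def poly_bounded_def
        eval_rename[OF renames_weaken_second] cost_rename[OF renames_weaken_second]\<close>)
qed

lemma PT_each_outer:
  assumes "PT G F"
  shows "PT (each_ctx G l) (\<lambda>z. F (fst z))"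
  unfolding each_ctx_def by (rule PT_weaken, rule PT_comp[OF assms]) auto

lemma PT_each_elem:
  assumes "PT G (\<lambda>x. val_of_list (l x))"
  shows "PT (each_ctx G l) (\<lambda>z. l (fst z) ! snd z)"
proof (rule PT_var[where i = 0])
  have "poly_bounded (each_ctx G l) (\<lambda>z. vsize (val_of_list (l (fst z))))"
    using PT_vsize[OF assms] by (rule poly_bounded_comp) (auto simp: each_ctx_def)
  then show "poly_bounded (each_ctx G l) (\<lambda>z. vsize (l (fst z) ! snd z))"
  proof (rule poly_bounded_mono)
    fix z assume "z \<in> inputs (each_ctx G l)"
    then have "vsize (l (fst z) ! snd z) \<in> set (map vsize (l (fst z)))"
      by (auto simp: each_ctx_def)
    then show "vsize (l (fst z) ! snd z) \<le> vsize (val_of_list (l (fst z)))"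
      using member_le_sum_list[of "vsize (l (fst z) ! snd z)" "map vsize (l (fst z))"]
      by (simp add: vsize_val_of_list)
  qed
qed (simp add: each_ctx_def)

definition iter_ctx :: "'x ctx \<Rightarrow> ('x \<Rightarrow> nat) \<Rightarrow> ('x \<times> nat) ctx" where
  "iter_ctx G n = each_ctx G (\<lambda>x. map (\<lambda>k. Num (real k)) [0..<n x])"

definition loop_ctx :: "'x ctx \<Rightarrow> ('x \<Rightarrow> nat) \<Rightarrow> ('x \<Rightarrow> nat \<Rightarrow> val) \<Rightarrow> ('x \<times> nat) ctx" where
  "loop_ctx G n st = foreach_ctx G (\<lambda>x. map (\<lambda>k. Num (real k)) [0..<n x]) st"

lemma inputs_iter_ctx [simp]: "inputs (iter_ctx G n) = (SIGMA x:inputs G. {..<n x})"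
  by (simp add: iter_ctx_def)

lemma inputs_loop_ctx [simp]: "inputs (loop_ctx G n st) = (SIGMA x:inputs G. {..<n x})"
  by (simp add: loop_ctx_def)

lemma bound_iter_ctx [simp]: "bound (iter_ctx G n) z = bound G (fst z)"
  by (simp add: iter_ctx_def each_ctx_def)

lemma bound_loop_ctx [simp]: "bound (loop_ctx G n st) z = bound G (fst z)"
  by (simp add: loop_ctx_def foreach_ctx_def)

lemma PT_iter_loop: "PT (iter_ctx G n) F \<Longrightarrow> PT (loop_ctx G n st) F"
  unfolding iter_ctx_def loop_ctx_def by (rule PT_each_foreach)

lemma PTn_iter_index: "PTn (iter_ctx G n) snd"
  unfolding PTn_def PTr_def
  by (rule PT_var[where i = 0, OF _ poly_bounded_mono[OF poly_bounded_const[of _ 1]]])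
     (auto simp: iter_ctx_def each_ctx_def)

lemma PT_iter_outer: "PT G F \<Longrightarrow> PT (iter_ctx G n) (\<lambda>z. F (fst z))"
  unfolding iter_ctx_def by (rule PT_each_outer)

lemma PTr_iter_outer: "PTr G f \<Longrightarrow> PTr (iter_ctx G n) (\<lambda>z. f (fst z))"
  unfolding PTr_def by (rule PT_iter_outer)

lemma PTn_iter_outer: "PTn G f \<Longrightarrow> PTn (iter_ctx G n) (\<lambda>z. f (fst z))"
  unfolding PTn_def by (rule PTr_iter_outer)

lemma PTb_iter_outer: "PTb G P \<Longrightarrow> PTb (iter_ctx G n) (\<lambda>z. P (fst z))"
  unfolding PTb_def by (rule PTr_iter_outer)

lemmas PT_iter = PTn_iter_index PT_iter_outer PTr_iter_outer PTn_iter_outer PTb_iter_outer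

lemma PTn_loop_index: "PTn (loop_ctx G n st) snd"
  using PTn_iter_index unfolding PTn_def PTr_def by (rule PT_iter_loop)

lemma PT_loop_outer: "PT G F \<Longrightarrow> PT (loop_ctx G n st) (\<lambda>z. F (fst z))"
  by (intro PT_iter_loop PT_iter_outer)

lemma PTr_loop_outer: "PTr G f \<Longrightarrow> PTr (loop_ctx G n st) (\<lambda>z. f (fst z))"
  unfolding PTr_def by (rule PT_loop_outer)

lemma PTn_loop_outer: "PTn G f \<Longrightarrow> PTn (loop_ctx G n st) (\<lambda>z. f (fst z))"
  unfolding PTn_def by (rule PTr_loop_outer)

lemma PT_Upto: "PTn G n \<Longrightarrow> PT G (\<lambda>x. val_of_list (map (\<lambda>k. Num (real k)) [0..<n x]))"
  if "poly_bounded G n"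
proof -
  assume "PTn G n"
  then obtain e where e: "\<And>x. x \<in> inputs G \<Longrightarrow> eval e (vars G x) = Num (real (n x))"
    "poly_bounded G (\<lambda>x. cost e (vars G x))"
    unfolding PT_def PTn_def PTr_def by blast
  have "poly_bounded G (\<lambda>x. cost e (vars G x) + (1 + 2 * n x))"
    by (intro poly_bounded_intros e that)
  then show ?thesis
    by (rule PT_I[where e = "Upto e", rotated])
      (auto simp: e vsize_val_of_list sum_list_triv comp_def)
qed

text \<open>The number of iterations of a loop must be polynomial, unlike the numbers that are computed.\<close>

definition PTc :: "'x ctx \<Rightarrow> ('x \<Rightarrow> nat) \<Rightarrow> bool" where
  "PTc G n \<longleftrightarrow> PTn G n \<and> poly_bounded G n"

lemma PTc_PTn: "PTc G n \<Longrightarrow> PTn G n"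
  by (simp add: PTc_def)

lemma PTc_add: "PTc G m \<Longrightarrow> PTc G n \<Longrightarrow> PTc G (\<lambda>x. m x + n x)"
  by (simp add: PTc_def PTn_add poly_bounded_add)

lemma PTc_mult: "PTc G m \<Longrightarrow> PTc G n \<Longrightarrow> PTc G (\<lambda>x. m x * n x)"
  by (simp add: PTc_def PTn_mult poly_bounded_mult)

lemma PTc_const: "PTc G (\<lambda>_. n)"
  by (simp add: PTc_def PTn_const poly_bounded_const)

lemma PTc_le: "PTn G m \<Longrightarrow> PTc G n \<Longrightarrow> (\<And>x. x \<in> inputs G \<Longrightarrow> m x \<le> n x) \<Longrightarrow> PTc G m"
  unfolding PTc_def by (auto elim: poly_bounded_mono)

lemma poly_bounded_restrict: "poly_bounded G f \<Longrightarrow> poly_bounded (restrict_ctx G P) f"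
  unfolding poly_bounded_def restrict_ctx_def by fastforce

lemma PTc_restrict: "PTc G n \<Longrightarrow> PTc (restrict_ctx G P) n"
  by (simp add: PTc_def PTn_restrict poly_bounded_restrict)

lemma PTc_iter_outer: "PTc G f \<Longrightarrow> PTc (iter_ctx G n) (\<lambda>z. f (fst z))"
  unfolding PTc_def by (auto intro: PTn_iter_outer elim: poly_bounded_comp)

lemma PTc_loop_outer: "PTc G f \<Longrightarrow> PTc (loop_ctx G n st) (\<lambda>z. f (fst z))"
  unfolding PTc_def by (auto intro: PTn_loop_outer elim: poly_bounded_comp)

lemma PTc_iter_index: "PTc G n \<Longrightarrow> PTc (iter_ctx G n) snd"
  by (rule PTc_le[OF PTn_iter_index PTc_iter_outer]) auto

lemma PT_loop:
  assumes "PTc G n" "PT G (\<lambda>x. st x 0)" "PT (loop_ctx G n st) (\<lambda>z. st (fst z) (Suc (snd z)))"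
  shows "PT G (\<lambda>x. st x (n x))"
proof -
  have "PT G (\<lambda>x. st x (length (elems (val_of_list (map (\<lambda>k. Num (real k)) [0..<n x])))))"
    by (rule PT_foreach) (use assms PT_Upto in \<open>auto simp: loop_ctx_def PTc_def\<close>)
  then show ?thesis by simp
qed

lemma PT_loop_acc:
  assumes "poly_bounded (iter_ctx G n) (\<lambda>z. vsize (st (fst z) (snd z)))"
  shows "PT (loop_ctx G n st) (\<lambda>z. st (fst z) (snd z))"
  unfolding loop_ctx_def
  by (rule PT_foreach_acc) (use assms in \<open>auto simp: poly_bounded_def foreach_ctx_def iter_ctx_def each_ctx_def\<close>)

lemma PTr_sum:
  assumes "PTc G n" "PTr (iter_ctx G n) (\<lambda>z. f (fst z) (snd z))"
  shows "PTr G (\<lambda>x. \<Sum>k<n x. f x k)"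
proof -
  define st where "st = (\<lambda>x k. Num (\<Sum>j<k. f x j))"
  have "PTr (loop_ctx G n st) (\<lambda>z. num_of (st (fst z) (snd z)))"
    by (intro PTr_num_of PT_loop_acc poly_bounded_mono[OF poly_bounded_const[of _ 1]])
      (simp add: st_def)
  then have "PTr (loop_ctx G n st) (\<lambda>z. num_of (st (fst z) (snd z)) + f (fst z) (snd z))"
    by (rule PTr_add) (use assms(2) in \<open>unfold PTr_def, intro PT_iter_loop\<close>)
  then have "PT (loop_ctx G n st) (\<lambda>z. st (fst z) (Suc (snd z)))"
    by (simp add: st_def PTr_def)
  then have "PT G (\<lambda>x. st x (n x))"
    by (rule PT_loop[OF assms(1), rotated]) (use PTr_0 in \<open>simp add: st_def PTr_def\<close>)
  then show ?thesis by (simp add: st_def PTr_def)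
qed

lemma PTn_sum:
  assumes "PTc G n" "PTn (iter_ctx G n) (\<lambda>z. f (fst z) (snd z))"
  shows "PTn G (\<lambda>x. \<Sum>k<n x. f x k)"
  using PTr_sum[OF assms(1), of "\<lambda>x k. real (f x k)"] assms(2) by (simp add: PTn_def)

text \<open>A bounded search is done by summing truth values and comparing the sum with 0.\<close>

lemma PTb_ex:
  assumes "PTc G n" "PTb (iter_ctx G n) (\<lambda>z. P (fst z) (snd z))"
  shows "PTb G (\<lambda>x. \<exists>k<n x. P x k)"
proof -
  have "PTr G (\<lambda>x. \<Sum>k<n x. if P x k then 1 else 0)"
    by (rule PTr_sum[OF assms(1)]) (use assms(2) in \<open>simp add: PTb_def\<close>)
  then have "PTb G (\<lambda>x. 0 < (\<Sum>k<n x. if P x k then 1 else 0 :: real))"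
    by (rule PTb_less[OF PTr_0])
  then show ?thesis
  proof (rule PTb_cong)
    fix x
    have "(0 < (\<Sum>k<n x. if P x k then 1 else 0 :: real)) \<longleftrightarrow> (\<Sum>k<n x. if P x k then 1 else 0 :: real) \<noteq> 0"
      using sum_nonneg[of "{..<n x}" "\<lambda>k. if P x k then 1 else 0 :: real"]
      by (simp add: less_le)
    also have "\<dots> \<longleftrightarrow> (\<exists>k<n x. P x k)"
      by (subst sum_nonneg_eq_0_iff) auto
    finally show "(0 < (\<Sum>k<n x. if P x k then 1 else 0 :: real)) \<longleftrightarrow> (\<exists>k<n x. P x k)" .
  qed
qed

lemma PTb_all:
  assumes "PTc G n" "PTb (iter_ctx G n) (\<lambda>z. P (fst z) (snd z))"
  shows "PTb G (\<lambda>x. \<forall>k<n x. P x k)"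
  using PTb_not[OF PTb_ex[OF assms(1) PTb_not[OF assms(2)]]] by (rule PTb_cong) auto

text \<open>A \<open>Fold\<close> builds a list by prepending, so whatever it collects comes out in
  reverse order.\<close>

lemma PT_rev:
  assumes "PT G (\<lambda>x. val_of_list (l x))"
  shows "PT G (\<lambda>x. val_of_list (rev (l x)))"
proof -
  define st where "st = (\<lambda>x k. val_of_list (rev (take k (l x))))"
  have "poly_bounded (foreach_ctx G l st) (\<lambda>z. vsize (val_of_list (l (fst z))))"
    by (rule poly_bounded_foreach_outer[OF PT_vsize[OF assms]])
  then have "poly_bounded (foreach_ctx G l st) (\<lambda>z. vsize (st (fst z) (snd z)))"
  proof (rule poly_bounded_mono)
    fix z :: "'a \<times> nat"
    have "length (take (snd z) (l (fst z))) + sum_list (map vsize (take (snd z) (l (fst z)))) \<le>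
      length (l (fst z)) + sum_list (map vsize (l (fst z)))"
      by (subst (3 4) append_take_drop_id[of "snd z", symmetric]) (simp del: append_take_drop_id)
    then show "vsize (st (fst z) (snd z)) \<le> vsize (val_of_list (l (fst z)))"
      by (simp add: st_def vsize_val_of_list rev_map[symmetric])
  qed
  then have "PT (foreach_ctx G l st) (\<lambda>z. Node (l (fst z) ! snd z) (st (fst z) (snd z)))"
    by (intro PT_Node PT_foreach_acc PT_each_foreach PT_each_elem assms)
  then have "PT (foreach_ctx G l st) (\<lambda>z. st (fst z) (Suc (snd z)))"
    by (rule PT_cong) (auto simp: st_def take_Suc_conv_app_nth)
  then have "PT G (\<lambda>x. st x (length (elems (val_of_list (l x)))))"
    by (intro PT_foreach[OF assms, of st]) (simp_all add: st_def PT_Empty)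
  then show ?thesis by (simp add: st_def)
qed

lemma PT_collect:
  assumes n: "PTc G n" and P: "PTb (iter_ctx G n) (\<lambda>z. P (fst z) (snd z))"
    and F: "PT (restrict_ctx (iter_ctx G n) (\<lambda>z. P (fst z) (snd z))) (\<lambda>z. F (fst z) (snd z))"
  shows "PT G (\<lambda>x. val_of_list (map (F x) (filter (P x) [0..<n x])))"
proof -
  define st where "st = (\<lambda>x k. val_of_list (rev (map (F x) (filter (P x) [0..<k]))))"
  obtain c d where cd: "\<And>x k. x \<in> inputs G \<Longrightarrow> k < n x \<Longrightarrow> P x k \<Longrightarrow> vsize (F x k) \<le> c * (bound G x + 1) ^ d"
    using PT_vsize[OF F] by (auto simp: poly_bounded_def restrict_ctx_def)
  have "poly_bounded (iter_ctx G n) (\<lambda>z. (bound G (fst z) + 1) ^ d)"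
    unfolding poly_bounded_def by (intro exI[of _ 1] exI[of _ d]) simp
  then have "poly_bounded (iter_ctx G n) (\<lambda>z. 1 + n (fst z) + n (fst z) * (c * (bound G (fst z) + 1) ^ d))"
    using PTc_iter_outer[OF n, of n] unfolding PTc_def by (intro poly_bounded_intros) auto
  then have "poly_bounded (iter_ctx G n) (\<lambda>z. vsize (st (fst z) (snd z)))"
  proof (rule poly_bounded_mono)
    fix z assume "z \<in> inputs (iter_ctx G n)"
    then obtain x k where z: "z = (x, k)" "x \<in> inputs G" "k < n x" by auto
    let ?l = "filter (P x) [0..<k]"
    have len: "length ?l \<le> n x"
      using z(3) length_filter_le[of "P x" "[0..<k]"] by simp
    have "sum_list (map (\<lambda>j. vsize (F x j)) ?l) \<le> sum_list (map (\<lambda>_. c * (bound G x + 1) ^ d) ?l)"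
      by (rule sum_list_mono) (use cd z in auto)
    also have "\<dots> = length ?l * (c * (bound G x + 1) ^ d)"
      by (simp add: sum_list_triv)
    also have "\<dots> \<le> n x * (c * (bound G x + 1) ^ d)"
      by (rule mult_le_mono1[OF len])
    finally show "vsize (st (fst z) (snd z)) \<le> 1 + n (fst z) + n (fst z) * (c * (bound G (fst z) + 1) ^ d)"
      using len by (simp add: z st_def vsize_val_of_list rev_map[symmetric] comp_def)
  qed
  then have acc: "PT (loop_ctx G n st) (\<lambda>z. st (fst z) (snd z))"
    by (rule PT_loop_acc)
  \<comment> \<open>\<open>F\<close> is computable only where \<open>P\<close> holds. The default
    \<open>Empty\<close> makes it total on \<open>iter_ctx\<close>, from where it can be moved into
    the loop; this explains the doubled test below.\<close>
  have PF: "PT (iter_ctx G n) (\<lambda>z. if P (fst z) (snd z) then F (fst z) (snd z) else Empty)"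
    by (intro PT_if P F PT_Empty)
  have "PTb (loop_ctx G n st) (\<lambda>z. P (fst z) (snd z))"
    using P unfolding PTb_def PTr_def by (rule PT_iter_loop)
  then have "PT (loop_ctx G n st) (\<lambda>z. if P (fst z) (snd z) then
      Node (if P (fst z) (snd z) then F (fst z) (snd z) else Empty) (st (fst z) (snd z))
      else st (fst z) (snd z))"
    by (rule PT_if) (intro PT_Node PT_restrict PT_iter_loop[OF PF] acc)+
  then have "PT (loop_ctx G n st) (\<lambda>z. st (fst z) (Suc (snd z)))"
    by (rule PT_cong) (auto simp: st_def)
  then have "PT G (\<lambda>x. st x (n x))"
    by (rule PT_loop[OF n, rotated]) (simp add: st_def PT_Empty)
  from PT_rev[OF this[unfolded st_def]] show ?thesis by simp
qed

definition table :: "nat \<Rightarrow> (nat \<Rightarrow> val) \<Rightarrow> val" where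
  "table n f = val_of_list (map f [0..<n])"

lemma table_cong: "(\<And>k. k < n \<Longrightarrow> f k = g k) \<Longrightarrow> table n f = table n g"
  unfolding table_def by (intro arg_cong[of _ _ val_of_list] map_cong) auto

lemma PT_table:
  assumes "PTc G n" "PT (iter_ctx G n) (\<lambda>z. F (fst z) (snd z))"
  shows "PT G (\<lambda>x. table (n x) (F x))"
  using PT_collect[OF assms(1) PTb_True PT_restrict[OF assms(2)]] by (simp add: table_def)

text \<open>The tail is taken \<open>k x\<close> times and then the head. As the index lies below
  the length of the list, it is a legitimate number of iterations.\<close>

lemma PT_nth:
  assumes l: "PT G F" and k: "PTn G k" and len: "\<And>x. x \<in> inputs G \<Longrightarrow> k x < length (elems (F x))"
  shows "PT G (\<lambda>x. elems (F x) ! k x)"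
proof -
  define tl' where "tl' v = (case v of Node _ w \<Rightarrow> w | _ \<Rightarrow> Empty)" for v
  define st where "st = (\<lambda>x j. (tl' ^^ j) (F x))"
  have "vsize ((tl' ^^ j) v) \<le> vsize v" for j v
    by (induction j) (auto simp: tl'_def split: val.splits)
  then have size: "poly_bounded (iter_ctx G k) (\<lambda>z. vsize (st (fst z) (snd z)))"
    by (intro poly_bounded_mono[OF PT_vsize[OF PT_iter_outer[OF l]]]) (simp add: st_def)
  have kc: "PTc G k"
    unfolding PTc_def using len length_elems_less_vsize
    by (intro conjI k poly_bounded_mono[OF PT_vsize[OF l]]) (meson less_trans order_less_imp_le)
  have "PT G (\<lambda>x. st x (k x))"
  proof (rule PT_loop[OF kc])
    show "PT (loop_ctx G k st) (\<lambda>z. st (fst z) (Suc (snd z)))"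
      using PT_snd_Node[OF PT_loop_acc[OF size]] by (simp add: st_def tl'_def)
  qed (simp add: st_def l)
  then have "PT G (\<lambda>x. case st x (k x) of Node u _ \<Rightarrow> u | _ \<Rightarrow> Empty)"
    by (rule PT_fst_Node)
  moreover have "(case (tl' ^^ j) v of Node u _ \<Rightarrow> u | _ \<Rightarrow> Empty) = elems v ! j"
    if "j < length (elems v)" for v j
    using that
  proof (induction v arbitrary: j)
    case (Node a b)
    then show ?case by (cases j) (auto simp: tl'_def funpow_swap1 simp del: funpow.simps(2) simp: funpow_Suc_right)
  qed auto
  ultimately show ?thesis
    by (auto elim!: PT_cong simp: st_def len)
qed

lemma PT_table_nth:
  assumes "PT G (\<lambda>x. table (n x) (F x))" "PTn G k" "\<And>x. x \<in> inputs G \<Longrightarrow> k x < n x"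
  shows "PT G (\<lambda>x. F x (k x))"
  using PT_nth[OF assms(1,2)] assms(3) by (auto elim!: PT_cong simp: table_def)

lemma PTr_table_nth:
  assumes "PT G (\<lambda>x. table (n x) (\<lambda>k. Num (f x k)))" "PTn G k" "\<And>x. x \<in> inputs G \<Longrightarrow> k x < n x"
  shows "PTr G (\<lambda>x. f x (k x))"
  unfolding PTr_def by (rule PT_table_nth[OF assms])

lemma PTb_table_nth:
  assumes "PT G (\<lambda>x. table (n x) (\<lambda>k. Num (if P x k then 1 else 0)))" "PTn G k"
    "\<And>x. x \<in> inputs G \<Longrightarrow> k x < n x"
  shows "PTb G (\<lambda>x. P x (k x))"
  unfolding PTb_def PTr_def using PT_table_nth[OF assms] by simp

text \<open>The language divides only reals, so the quotient is obtained by counting the positive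
  multiples of \<open>g x\<close> up to \<open>f x\<close>. The dividend must hence be a loop count.
  The test \<open>0 < g x\<close> reproduces the convention that division by 0 gives 0.\<close>

lemma PTn_div:
  assumes "PTc G f" "PTn G g"
  shows "PTn G (\<lambda>x. f x div g x)"
proof -
  have "PTn G (\<lambda>x. \<Sum>k<f x. if Suc k * g x \<le> f x \<and> 0 < g x then 1 else 0)"
    by (intro PTn_sum assms PTn_if PTn_const PTb_conj PTb_nat_le PTb_nat_less PTn_mult PTn_Suc PT_iter PT_restricts
        PTc_PTn[OF assms(1)])
  then show ?thesis
  proof (rule PTn_cong)
    fix x
    have "(\<Sum>k<f x. if Suc k * g x \<le> f x \<and> 0 < g x then 1 else 0) =
      card {k \<in> {..<f x}. Suc k * g x \<le> f x \<and> 0 < g x}"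
      by (simp add: sum.If_cases Int_def)
    also have "{k \<in> {..<f x}. Suc k * g x \<le> f x \<and> 0 < g x} = {..<f x div g x}"
    proof (cases "g x = 0")
      case False
      then have "Suc k * g x \<le> f x \<longleftrightarrow> k < f x div g x" for k
        using less_eq_div_iff_mult_less_eq[of "g x" "Suc k" "f x"] by (simp add: Suc_le_eq)
      moreover have "k < f x" if "k < f x div g x" for k
        using that div_le_dividend[of "f x" "g x"] by linarith
      ultimately show ?thesis using False by auto
    qed auto
    finally show "(\<Sum>k<f x. if Suc k * g x \<le> f x \<and> 0 < g x then 1 else 0) = f x div g x"
      by simp
  qed
qed

lemma PTn_mod:
  assumes "PTc G f" "PTn G g"
  shows "PTn G (\<lambda>x. f x mod g x)"
proof -
  have "PTn G (\<lambda>x. f x - (f x div g x) * g x)"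
    by (intro PTn_diff PTn_mult PTn_div assms PTc_PTn[OF assms(1)])
  then show ?thesis by (simp add: minus_div_mult_eq_mod)
qed

section \<open>The two-phase algorithm\<close>

text \<open>The vertex \<open>((i r + T) n + (s - 1))\<close> is the instance \<open>(i, T, s)\<close>, where \<open>n\<close> is the number of
  timeslots and \<open>r\<close> the number of resources.  Not every vertex is a demand instance.\<close>

definition vertices :: "line_network \<Rightarrow> nat" where
  "vertices I = slots I * processors I * resources I"

definition proc_of :: "line_network \<Rightarrow> nat \<Rightarrow> nat" where
  "proc_of I v = v div (resources I * slots I)"

definition res_of :: "line_network \<Rightarrow> nat \<Rightarrow> nat" where
  "res_of I v = v div slots I mod resources I"

definition start_of :: "line_network \<Rightarrow> nat \<Rightarrow> nat" where
  "start_of I v = Suc (v mod slots I)"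

definition len_of :: "line_network \<Rightarrow> nat \<Rightarrow> nat" where
  "len_of I v = proc_time (demand_of I (proc_of I v))"

definition profit_of :: "line_network \<Rightarrow> nat \<Rightarrow> real" where
  "profit_of I v = profit (demand_of I (proc_of I v))"

definition height_of :: "line_network \<Rightarrow> nat \<Rightarrow> real" where
  "height_of I v = height (demand_of I (proc_of I v))"

definition covers :: "line_network \<Rightarrow> nat \<Rightarrow> nat \<Rightarrow> bool" where
  "covers I v e \<longleftrightarrow> start_of I v \<le> e \<and> e < start_of I v + len_of I v"

text \<open>Everything is relative to a set \<open>B\<close> of processors: the simulation by a processor only
  involves the processors that it knows.\<close>

definition valid :: "line_network \<Rightarrow> nat set \<Rightarrow> nat \<Rightarrow> bool" where
  "valid I B v \<longleftrightarrow> v < vertices I \<and> proc_of I v \<in> B \<and> res_of I v \<in> acc I (proc_of I v) \<and>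
     release (demand_of I (proc_of I v)) \<le> start_of I v \<and>
     start_of I v + len_of I v \<le> Suc (deadline (demand_of I (proc_of I v)))"

definition wide :: "line_network \<Rightarrow> nat \<Rightarrow> bool" where
  "wide I v \<longleftrightarrow> 1 / 2 < height_of I v"

definition overlap :: "line_network \<Rightarrow> nat \<Rightarrow> nat \<Rightarrow> bool" where
  "overlap I u v \<longleftrightarrow> res_of I u = res_of I v \<and> (wide I u \<longleftrightarrow> wide I v) \<and>
     start_of I u < start_of I v + len_of I v \<and> start_of I v < start_of I u + len_of I u"

definition conflict :: "line_network \<Rightarrow> nat \<Rightarrow> nat \<Rightarrow> bool" where
  "conflict I u v \<longleftrightarrow> u \<noteq> v \<and> (proc_of I u = proc_of I v \<or> overlap I u v)"

text \<open>The largest power of two that does not exceed the length.\<close>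

definition len_scale :: "line_network \<Rightarrow> nat \<Rightarrow> nat" where
  "len_scale I v = ((\<lambda>x. if 2 * x \<le> len_of I v then 2 * x else x) ^^ slots I) 1"

text \<open>The share of the residual of a raised \<open>u\<close> that is charged to
  \<open>v\<close>. It is asymmetric: the height is that of the charged vertex, and an overlapping
  vertex of another processor pays only if its length class is not shorter than that of
  \<open>u\<close>.\<close>

definition weight :: "line_network \<Rightarrow> nat \<Rightarrow> nat \<Rightarrow> real" where
  "weight I u v =
     (if proc_of I u = proc_of I v then 1
      else if overlap I u v \<and> len_scale I u \<le> len_scale I v then 2 * height_of I v else 0)"

definition blocks :: "line_network \<Rightarrow> nat \<Rightarrow> nat \<Rightarrow> bool" where
  "blocks I u v \<longleftrightarrow> len_scale I u < len_scale I v \<or>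
     len_scale I u = len_scale I v \<and> 2 * profit_of I v \<le> profit_of I u"

text \<open>In the first phase, \<open>l v\<close> is the part of the profit of \<open>v\<close> that has been charged so far.
  The argument \<open>mis\<close> yields a maximal independent set and the number of rounds to compute it.\<close>

type_synonym mis_solver = "(nat \<Rightarrow> nat \<Rightarrow> bool) \<Rightarrow> nat set \<times> nat"

text \<open>A threshold \<open>c\<close> in place of \<open>2 / 3\<close> would give the ratio
  \<open>14 / c\<close>. With \<open>2 / 3\<close> the ratio stays below 23, while every raised
  vertex still has more than a third of its profit left to charge.\<close>

definition unsat :: "line_network \<Rightarrow> nat set \<Rightarrow> (nat \<Rightarrow> real) \<Rightarrow> nat \<Rightarrow> bool" where
  "unsat I B l v \<longleftrightarrow> valid I B v \<and> l v < 2 / 3 * profit_of I v"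

definition active :: "line_network \<Rightarrow> nat set \<Rightarrow> (nat \<Rightarrow> real) \<Rightarrow> nat \<Rightarrow> bool" where
  "active I B l v \<longleftrightarrow> unsat I B l v \<and>
     (\<forall>u<vertices I. unsat I B l u \<and> conflict I u v \<longrightarrow> \<not> blocks I u v)"

text \<open>Inactive vertices remain as isolated vertices, so all these graphs have the same number
  of vertices, the one for which the running time of the solver is bounded. \<open>raise\<close>
  removes them from the independent set again.\<close>

definition conflict_graph :: "line_network \<Rightarrow> nat set \<Rightarrow> (nat \<Rightarrow> real) \<Rightarrow> nat \<Rightarrow> nat \<Rightarrow> bool" where
  "conflict_graph I B l u v \<longleftrightarrow> active I B l u \<and> active I B l v \<and> conflict I u v"

definition raise :: "mis_solver \<Rightarrow> line_network \<Rightarrow> nat set \<Rightarrow> (nat \<Rightarrow> real) \<Rightarrow> nat set" where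
  "raise mis I B l = {v. active I B l v \<and> v \<in> fst (mis (conflict_graph I B l))}"

definition charge_step :: "mis_solver \<Rightarrow> line_network \<Rightarrow> nat set \<Rightarrow> (nat \<Rightarrow> real) \<Rightarrow> nat \<Rightarrow> real" where
  "charge_step mis I B l v =
     (if valid I B v
      then l v + (\<Sum>u<vertices I. if u \<in> raise mis I B l then (profit_of I u - l u) * weight I u v else 0)
      else 0)"

definition charge :: "mis_solver \<Rightarrow> line_network \<Rightarrow> nat set \<Rightarrow> nat \<Rightarrow> nat \<Rightarrow> real" where
  "charge mis I B k = (charge_step mis I B ^^ k) (\<lambda>_. 0)"

definition raised :: "mis_solver \<Rightarrow> line_network \<Rightarrow> nat set \<Rightarrow> nat \<Rightarrow> nat set" where
  "raised mis I B k = raise mis I B (charge mis I B k)"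

text \<open>One hop is needed to see who is active, one for the edges of the conflict graph and one
  to apply the charges; the fourth is kept for the second phase. Steps without unsatisfied vertices
  are free, so a run may be continued beyond its end without changing the count.\<close>

definition step_rounds :: "mis_solver \<Rightarrow> line_network \<Rightarrow> nat set \<Rightarrow> (nat \<Rightarrow> real) \<Rightarrow> nat" where
  "step_rounds mis I B l =
     (if \<exists>v<vertices I. unsat I B l v then snd (mis (conflict_graph I B l)) + 4 else 0)"

definition rounds :: "mis_solver \<Rightarrow> line_network \<Rightarrow> nat set \<Rightarrow> nat \<Rightarrow> nat" where
  "rounds mis I B k = (\<Sum>j<k. step_rounds mis I B (charge mis I B j))"

definition load :: "line_network \<Rightarrow> nat set \<Rightarrow> nat \<Rightarrow> bool \<Rightarrow> nat \<Rightarrow> real" where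
  "load I S T w e = (\<Sum>u<vertices I.
     if u \<in> S \<and> res_of I u = T \<and> (wide I u \<longleftrightarrow> w) \<and> covers I u e then height_of I u else 0)"

definition compatible :: "line_network \<Rightarrow> nat set \<Rightarrow> nat \<Rightarrow> bool" where
  "compatible I S v \<longleftrightarrow> (\<forall>u<vertices I. u \<in> S \<longrightarrow> proc_of I u \<noteq> proc_of I v) \<and>
     (\<forall>e<Suc (slots I). covers I v e \<longrightarrow> load I S (res_of I v) (wide I v) e + height_of I v \<le> 1)"

text \<open>The second phase goes through the last \<open>j\<close> of \<open>K\<close> steps in reverse order.\<close>

primrec chosen :: "mis_solver \<Rightarrow> line_network \<Rightarrow> nat set \<Rightarrow> nat \<Rightarrow> nat \<Rightarrow> nat set" where
  "chosen mis I B K 0 = {}"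
| "chosen mis I B K (Suc j) = chosen mis I B K j \<union>
     {v \<in> raised mis I B (K - Suc j). compatible I (chosen mis I B K j) v}"

definition class_profit :: "line_network \<Rightarrow> nat set \<Rightarrow> nat \<Rightarrow> bool \<Rightarrow> real" where
  "class_profit I S T w = (\<Sum>u<vertices I.
     if u \<in> S \<and> res_of I u = T \<and> (wide I u \<longleftrightarrow> w) then profit_of I u else 0)"

definition better_class :: "line_network \<Rightarrow> nat set \<Rightarrow> nat set" where
  "better_class I S = {v \<in> S. wide I v \<longleftrightarrow>
     class_profit I S (res_of I v) False \<le> class_profit I S (res_of I v) True}"

lemma conflict_sym: "conflict I u v \<Longrightarrow> conflict I v u"
  by (auto simp: conflict_def overlap_def)

lemma valid_less: "valid I B v \<Longrightarrow> v < vertices I"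
  by (simp add: valid_def)

lemma active_valid: "active I B l v \<Longrightarrow> valid I B v"
  by (simp add: active_def unsat_def)

lemma raised_valid: "v \<in> raised mis I B k \<Longrightarrow> valid I B v"
  by (auto simp: raised_def raise_def dest: active_valid)

lemma chosen_valid: "v \<in> chosen mis I B K j \<Longrightarrow> valid I B v"
  by (induction j) (auto dest: raised_valid)

lemma simple_graph_conflict_graph: "simple_graph (vertices I) (conflict_graph I B l)"
  by (auto simp: simple_graph_def conflict_graph_def conflict_sym) (simp add: conflict_def)

lemma vertices_proc_of: "v < vertices I \<Longrightarrow> proc_of I v < processors I"
  unfolding proc_of_def vertices_def
  by (rule less_mult_imp_div_less) (simp add: mult_ac)

text \<open>Either the doubling has stopped, or the scale has been doubled \<open>slots I\<close>
  times; then it would be \<open>2 ^ slots I\<close>, which exceeds every possible length.\<close>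

lemma len_scale_power:
  assumes "1 \<le> len_of I v" "len_of I v \<le> slots I"
  obtains c where "len_scale I v = 2 ^ c" "len_scale I v \<le> len_of I v" "len_of I v < 2 * len_scale I v"
proof -
  let ?f = "\<lambda>x. if 2 * x \<le> len_of I v then 2 * x else x"
  have "\<exists>c. (?f ^^ k) 1 = 2 ^ c \<and> (?f ^^ k) 1 \<le> len_of I v \<and>
    (len_of I v < 2 * (?f ^^ k) 1 \<or> c = k)" for k
  proof (induction k)
    case 0
    then show ?case using assms by (intro exI[of _ 0]) auto
  next
    case (Suc k)
    then obtain c where c: "(?f ^^ k) 1 = 2 ^ c" "(?f ^^ k) 1 \<le> len_of I v"
      "len_of I v < 2 * (?f ^^ k) 1 \<or> c = k" by blast
    show ?case
    proof (cases "2 * (?f ^^ k) 1 \<le> len_of I v")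
      case True
      then show ?thesis using c by (intro exI[of _ "Suc c"]) auto
    next
      case False
      then show ?thesis using c by (intro exI[of _ c]) auto
    qed
  qed
  from this[of "slots I"] obtain c where c: "len_scale I v = 2 ^ c" "len_scale I v \<le> len_of I v"
    "len_of I v < 2 * len_scale I v \<or> c = slots I"
    unfolding len_scale_def by blast
  have "c \<noteq> slots I"
  proof
    assume "c = slots I"
    then have "2 ^ slots I \<le> slots I" using c(1,2) assms(2) by simp
    then show False using less_exp[of "slots I"] by simp
  qed
  then have "len_of I v < 2 * len_scale I v" using c(3) by simp
  then show thesis using that c by blast
qed

section \<open>Properties of a run of the first phase\<close>

locale line_run =
  fixes I :: line_network and B :: "nat set" and mis :: mis_solver and hmin :: real
  assumes adm: "I \<in> admissible hmin"
    and hmin: "0 < hmin" "hmin \<le> 1 / 2"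
    and mis: "\<And>E. simple_graph (vertices I) E \<Longrightarrow> maximal_independent (vertices I) E (fst (mis E))"
begin

abbreviation "ch \<equiv> charge mis I B"
abbreviation "ra \<equiv> raised mis I B"

lemma validD:
  assumes "valid I B v"
  shows "v < vertices I" "proc_of I v < processors I" "0 < profit_of I v"
    "hmin \<le> height_of I v" "height_of I v \<le> 1" "1 \<le> len_of I v" "len_of I v \<le> slots I"
    "res_of I v < resources I" "start_of I v + len_of I v \<le> Suc (slots I)"
proof -
  show v: "v < vertices I" using assms by (rule valid_less)
  then show i: "proc_of I v < processors I" by (rule vertices_proc_of)
  have *: "1 \<le> release (demand_of I (proc_of I v))" "deadline (demand_of I (proc_of I v)) \<le> slots I"
    "1 \<le> len_of I v" "0 < profit_of I v" "hmin \<le> height_of I v" "height_of I v \<le> 1"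
    "acc I (proc_of I v) \<subseteq> {..<resources I}"
    using adm i unfolding admissible_def valid_line_network_def len_of_def profit_of_def height_of_def
    by auto
  then show "0 < profit_of I v" "hmin \<le> height_of I v" "height_of I v \<le> 1" "1 \<le> len_of I v" by auto
  show "res_of I v < resources I" "start_of I v + len_of I v \<le> Suc (slots I)"
    using * assms unfolding valid_def by auto
  then show "len_of I v \<le> slots I" unfolding start_of_def by simp
qed

lemma raised_active: "v \<in> ra k \<Longrightarrow> active I B (ch k) v"
  by (simp add: raised_def raise_def)

lemma raised_unsat: "v \<in> ra k \<Longrightarrow> unsat I B (ch k) v"
  using raised_active by (simp add: active_def)

lemma raised_subset: "ra k \<subseteq> {..<vertices I}"
  using raised_valid valid_less by blast

lemma finite_raised: "finite (ra k)"
  using raised_subset finite_subset by blast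

lemma raised_independent:
  assumes "u \<in> ra k" "v \<in> ra k"
  shows "\<not> conflict I u v"
  using assms mis[OF simple_graph_conflict_graph, of B "ch k"]
  unfolding raised_def raise_def maximal_independent_def conflict_graph_def by blast

lemma raised_maximal:
  assumes "active I B (ch k) v" "v \<notin> ra k"
  obtains u where "u \<in> ra k" "conflict I u v"
proof -
  have "v < vertices I" using assms(1) by (auto dest: active_valid valid_less)
  then obtain u where "u \<in> fst (mis (conflict_graph I B (ch k)))" "conflict_graph I B (ch k) v u"
    using assms mis[OF simple_graph_conflict_graph, of B "ch k"]
    unfolding raised_def raise_def maximal_independent_def by blast
  then show thesis
    using that[of u] unfolding raised_def raise_def conflict_graph_def by (auto dest: conflict_sym)
qed

lemma charge_Suc:
  assumes "valid I B v"
  shows "ch (Suc k) v = ch k v + (\<Sum>u\<in>ra k. (profit_of I u - ch k u) * weight I u v)"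
proof -
  have "(\<Sum>u<vertices I. if u \<in> ra k then (profit_of I u - ch k u) * weight I u v else 0) =
    (\<Sum>u\<in>ra k. (profit_of I u - ch k u) * weight I u v)"
    using raised_subset by (subst sum.inter_restrict[symmetric]) (auto simp: Int_absorb1 intro!: sum.cong)
  moreover have "ch (Suc k) = charge_step mis I B (ch k)" by (simp add: charge_def)
  ultimately show ?thesis using assms by (simp add: charge_step_def raised_def)
qed

lemma residual_pos:
  assumes "u \<in> ra k"
  shows "profit_of I u / 3 < profit_of I u - ch k u" "0 < profit_of I u - ch k u"
proof -
  have "ch k u < 2 / 3 * profit_of I u" "0 < profit_of I u"
    using raised_unsat[OF assms] validD(3) by (auto simp: unsat_def)
  then show "profit_of I u / 3 < profit_of I u - ch k u" "0 < profit_of I u - ch k u"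
    by auto
qed

lemma weight_nonneg: "valid I B v \<Longrightarrow> 0 \<le> weight I u v"
  using validD(4)[of v] hmin by (simp add: weight_def)

lemma weight_self [simp]: "weight I u u = 1"
  by (simp add: weight_def)

lemma weight_zero: "u \<noteq> v \<Longrightarrow> \<not> conflict I u v \<Longrightarrow> weight I u v = 0"
  by (simp add: weight_def conflict_def)

lemma charge_term_nonneg:
  "valid I B v \<Longrightarrow> u \<in> ra k \<Longrightarrow> 0 \<le> (profit_of I u - ch k u) * weight I u v"
  using residual_pos(2)[of u k] weight_nonneg[of v u] by simp

lemma charge_mono_Suc: "valid I B v \<Longrightarrow> ch k v \<le> ch (Suc k) v"
  by (simp add: charge_Suc charge_term_nonneg sum_nonneg)

lemma charge_mono: "valid I B v \<Longrightarrow> k \<le> k' \<Longrightarrow> ch k v \<le> ch k' v"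
  using charge_mono_Suc by (auto intro: lift_Suc_mono_le[of "\<lambda>k. ch k v"])

text \<open>The vertices raised together are free of conflicts, and weights vanish without conflict.
  So only the vertex itself contributes, namely its residual with weight 1.\<close>

lemma charge_raised:
  assumes "v \<in> ra k"
  shows "ch (Suc k) v = profit_of I v"
proof -
  have "(\<Sum>u\<in>ra k. (profit_of I u - ch k u) * weight I u v) =
    (\<Sum>u\<in>{v}. (profit_of I u - ch k u) * weight I u v)"
    using assms raised_independent[OF _ assms] weight_zero
    by (intro sum.mono_neutral_right finite_raised) auto
  then show ?thesis using raised_valid[OF assms] by (simp add: charge_Suc)
qed

lemma unsat_antimono: "unsat I B (ch k') v \<Longrightarrow> k \<le> k' \<Longrightarrow> unsat I B (ch k) v"
  using charge_mono[of v k k'] by (auto simp: unsat_def)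

lemma raised_once:
  assumes "v \<in> ra k" "k < k'"
  shows "\<not> unsat I B (ch k') v"
proof -
  have "profit_of I v \<le> ch k' v"
    using charge_raised[OF assms(1)] charge_mono[OF raised_valid[OF assms(1)], of "Suc k" k'] assms(2)
    by simp
  then show ?thesis using validD(3)[OF raised_valid[OF assms(1)]] by (auto simp: unsat_def)
qed

text \<open>As charges only grow, \<open>v\<close> was already unsatisfied when \<open>u\<close> was
  raised; in a shorter class it would have blocked \<open>u\<close>. This supplies the length
  condition in \<open>weight\<close> for vertices chosen before \<open>u\<close> in the second
  phase.\<close>

lemma raised_later_scale:
  assumes "u \<in> ra k" "v \<in> ra k'" "k < k'" "conflict I u v"
  shows "len_scale I u \<le> len_scale I v"
proof (rule ccontr)
  assume "\<not> ?thesis"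
  then have "blocks I v u" by (simp add: blocks_def)
  moreover have "unsat I B (ch k) v"
    using raised_unsat[OF assms(2)] unsat_antimono assms(3) by simp
  moreover have "v < vertices I" using raised_valid[OF assms(2)] by (rule valid_less)
  ultimately show False
    using raised_active[OF assms(1)] assms(4) conflict_sym unfolding active_def by blast
qed

subsection \<open>The number of steps\<close>

definition levels :: nat where
  "levels = Suc (nat \<lfloor>log 2 (p_max I / p_min I)\<rfloor>)"

text \<open>A lexicographic code: the length class counts first, then the number of halvings from
  \<open>p_max\<close> down to the profit. It serves the analysis only, since the processors do not
  know \<open>p_max\<close>.\<close>

definition rank :: "nat \<Rightarrow> nat" where
  "rank v = nat \<lfloor>log 2 (len_scale I v)\<rfloor> * levels + nat \<lfloor>log 2 (p_max I / profit_of I v)\<rfloor>"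

lemma profit_bounds:
  assumes "valid I B v"
  shows "profit_of I v \<le> p_max I" "p_min I \<le> profit_of I v" "0 < p_min I"
proof -
  have i: "proc_of I v < processors I" using validD[OF assms] by simp
  then show "profit_of I v \<le> p_max I" "p_min I \<le> profit_of I v"
    unfolding p_max_def p_min_def profit_of_def by (auto intro!: Max_ge Min_le)
  have "p_min I \<in> (\<lambda>i. profit (demand_of I i)) ` {..<processors I}"
    unfolding p_min_def using i by (intro Min_in) auto
  then show "0 < p_min I"
    using adm by (auto simp: admissible_def valid_line_network_def)
qed

lemma profit_level_less:
  assumes "valid I B v"
  shows "nat \<lfloor>log 2 (p_max I / profit_of I v)\<rfloor> < levels"
proof -
  have "p_max I / profit_of I v \<le> p_max I / p_min I"
    using profit_bounds[OF assms] by (intro divide_left_mono mult_pos_pos) auto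
  moreover have "0 < p_max I / profit_of I v"
    using profit_bounds[OF assms] by (intro divide_pos_pos) auto
  ultimately have "log 2 (p_max I / profit_of I v) \<le> log 2 (p_max I / p_min I)"
    by simp
  then show ?thesis unfolding levels_def by (simp add: less_Suc_eq_le nat_mono floor_mono)
qed

lemma scale_power: 
  assumes "valid I B v"
  obtains c where "len_scale I v = 2 ^ c" "nat \<lfloor>log 2 (len_scale I v)\<rfloor> = c" "2 ^ c \<le> len_of I v"
    "len_of I v < 2 * len_scale I v"
proof -
  obtain c where "len_scale I v = 2 ^ c" "len_scale I v \<le> len_of I v" "len_of I v < 2 * len_scale I v"
    using len_scale_power[of I v] validD[OF assms] by blast
  then show thesis by (intro that[of c]) auto
qed

lemma rank_bound:
  assumes "valid I B v"
  shows "rank v < Suc (nat \<lfloor>log 2 (slots I)\<rfloor>) * levels"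
proof -
  obtain c where c: "nat \<lfloor>log 2 (len_scale I v)\<rfloor> = c" "2 ^ c \<le> len_of I v"
    using scale_power[OF assms] by blast
  then have "2 ^ c \<le> slots I" using validD(7)[OF assms] by linarith
  then have "real (2 ^ c) \<le> real (slots I)" by (simp only: of_nat_le_iff)
  then have "real c \<le> log 2 (slots I)"
    using le_log2_of_power[of c "slots I"] \<open>2 ^ c \<le> slots I\<close> by simp
  then have "c \<le> nat \<lfloor>log 2 (slots I)\<rfloor>" by (simp add: le_nat_floor)
  then have "c * levels \<le> nat \<lfloor>log 2 (slots I)\<rfloor> * levels" by (rule mult_le_mono1)
  then show ?thesis using profit_level_less[OF assms] unfolding rank_def c(1) mult_Suc by linarith
qed

text \<open>A shorter class lowers the leading part, which outweighs the fewer than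
  \<open>levels\<close> profit levels. Within a class, a profit at least twice as large lowers the
  logarithm by at least 1 and hence its floor.\<close>

lemma blocks_rank:
  assumes "valid I B u" "valid I B v" "blocks I u v"
  shows "rank u < rank v"
proof -
  obtain c where c: "len_scale I u = 2 ^ c" "nat \<lfloor>log 2 (len_scale I u)\<rfloor> = c"
    using scale_power[OF assms(1)] by blast
  obtain d where d: "len_scale I v = 2 ^ d" "nat \<lfloor>log 2 (len_scale I v)\<rfloor> = d"
    using scale_power[OF assms(2)] by blast
  show ?thesis
  proof (cases "len_scale I u < len_scale I v")
    case True
    then have "c < d" using c d by simp
    then have "Suc c * levels \<le> d * levels" by (intro mult_le_mono1) simp
    then show ?thesis using profit_level_less[OF assms(1)] c d unfolding rank_def by simp
  next
    case False
    then have eq: "len_scale I u = len_scale I v" and p: "2 * profit_of I v \<le> profit_of I u"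
      using assms(3) by (auto simp: blocks_def)
    have pos: "0 < p_max I" "0 < profit_of I u" "0 < profit_of I v"
      using profit_bounds[OF assms(1)] validD(3) assms by auto
    have "p_max I / profit_of I u * 2 \<le> p_max I / profit_of I v"
      using pos p by (simp add: field_simps)
    then have "log 2 (p_max I / profit_of I u * 2) \<le> log 2 (p_max I / profit_of I v)"
      using pos by simp
    then have "log 2 (p_max I / profit_of I u) + 1 \<le> log 2 (p_max I / profit_of I v)"
      using pos by (subst (asm) log_mult) auto
    moreover have "0 \<le> log 2 (p_max I / profit_of I u)"
      using pos profit_bounds(1)[OF assms(1)] by simp
    ultimately have "nat \<lfloor>log 2 (p_max I / profit_of I u)\<rfloor> < nat \<lfloor>log 2 (p_max I / profit_of I v)\<rfloor>"
      by linarith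
    then show ?thesis unfolding rank_def eq by simp
  qed
qed

text \<open>By maximality some conflicting \<open>u\<close> was raised. As neither vertex blocks the
  other, both are in the same length class and \<open>u\<close> has more than half the profit of
  \<open>v\<close>, so its residual exceeds a sixth of that profit. The weight is at least
  \<open>2 * hmin\<close>; for a shared demand it is 1, which uses \<open>hmin <= 1 / 2\<close>. The
  product is \<open>hmin / 3\<close> of the profit.\<close>

lemma active_progress:
  assumes "active I B (ch k) v" "v \<notin> ra k"
  shows "ch k v + hmin / 3 * profit_of I v \<le> ch (Suc k) v"
proof -
  obtain u where u: "u \<in> ra k" "conflict I u v" using raised_maximal[OF assms] .
  have uv: "valid I B u" "valid I B v" "unsat I B (ch k) u" "unsat I B (ch k) v" "active I B (ch k) u"
    using u assms raised_valid raised_unsat raised_active by (auto simp: active_def unsat_def)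
  have nb: "\<not> blocks I u v" "\<not> blocks I v u"
    using u assms(1) uv conflict_sym[OF u(2)] validD(1) unfolding active_def by blast+
  then have eq: "len_scale I u = len_scale I v" and p: "profit_of I v / 2 < profit_of I u"
    by (auto simp: blocks_def)
  have "2 * hmin \<le> weight I u v"
    using u(2) eq validD(4)[OF uv(2)] hmin unfolding weight_def conflict_def by auto
  moreover have "profit_of I v / 6 \<le> profit_of I u - ch k u"
    using residual_pos(1)[OF u(1)] p by simp
  ultimately have "profit_of I v / 6 * (2 * hmin) \<le> (profit_of I u - ch k u) * weight I u v"
    using validD(3)[OF uv(2)] hmin residual_pos(2)[OF u(1)] by (intro mult_mono) auto
  also have "\<dots> \<le> (\<Sum>u\<in>ra k. (profit_of I u - ch k u) * weight I u v)"
    using u(1) uv(2) by (intro member_le_sum finite_raised charge_term_nonneg) auto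
  finally show ?thesis using uv(2) by (simp add: charge_Suc field_simps)
qed

text \<open>Blockers have smaller rank, so once all smaller ranks are satisfied, a vertex of the
  least rank stays active until it is satisfied. Being raised would satisfy it; otherwise each step
  adds \<open>hmin / 3\<close> of its profit, and \<open>2 / hmin\<close> steps reach the
  threshold.\<close>

lemma rank_progress:
  assumes below: "\<And>v. unsat I B (ch k) v \<Longrightarrow> \<rho> \<le> rank v"
    and v: "unsat I B (ch (k + nat \<lceil>2 / hmin\<rceil>)) v"
  shows "Suc \<rho> \<le> rank v"
proof (rule ccontr)
  define J where "J = nat \<lceil>2 / hmin\<rceil>"
  assume "\<not> ?thesis"
  then have rank: "rank v = \<rho>" using below[of v] unsat_antimono[OF v, of k] by simp
  have val: "valid I B v" using v by (simp add: unsat_def)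
  have unsat: "unsat I B (ch (k + j)) v" if "j \<le> J" for j
    using unsat_antimono[OF v] that by (simp add: J_def)
  have "real j * (hmin / 3 * profit_of I v) \<le> ch (k + j) v" if "j \<le> J" for j
    using that
  proof (induction j)
    case 0
    have "ch 0 v \<le> ch k v" using val by (intro charge_mono) auto
    then show ?case by (simp add: charge_def)
  next
    case (Suc j)
    have "active I B (ch (k + j)) v"
      unfolding active_def
    proof (intro conjI allI impI)
      fix u assume u: "unsat I B (ch (k + j)) u \<and> conflict I u v"
      then have "\<rho> \<le> rank u" using below unsat_antimono[of "k + j" u k] by simp
      then show "\<not> blocks I u v"
        using blocks_rank[of u v] rank u val by (auto simp: unsat_def)
    qed (use unsat Suc in simp)
    moreover have "v \<notin> ra (k + j)"
      using raised_once[of v "k + j" "k + Suc j"] unsat[of "Suc j"] Suc by auto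
    ultimately have "ch (k + j) v + hmin / 3 * profit_of I v \<le> ch (k + Suc j) v"
      using active_progress by simp
    then show ?case using Suc by (simp add: algebra_simps)
  qed
  from this[of J] have "real J * (hmin / 3 * profit_of I v) \<le> ch (k + J) v" by simp
  moreover have "2 / hmin \<le> real J" unfolding J_def by (simp add: of_nat_ceiling)
  then have "2 / hmin * (hmin / 3 * profit_of I v) \<le> real J * (hmin / 3 * profit_of I v)"
    using hmin validD(3)[OF val] by (intro mult_right_mono) auto
  moreover have "2 / hmin * (hmin / 3 * profit_of I v) = 2 / 3 * profit_of I v"
    using hmin by simp
  ultimately show False using unsat[of J] by (simp add: unsat_def)
qed

definition step_bound :: nat where
  "step_bound = Suc (nat \<lfloor>log 2 (slots I)\<rfloor>) * levels * nat \<lceil>2 / hmin\<rceil>"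

lemma all_satisfied:
  assumes "step_bound \<le> k"
  shows "\<not> unsat I B (ch k) v"
proof
  assume v: "unsat I B (ch k) v"
  have "\<And>v. unsat I B (ch (\<rho> * nat \<lceil>2 / hmin\<rceil>)) v \<Longrightarrow> \<rho> \<le> rank v" for \<rho>
  proof (induction \<rho>)
    case (Suc \<rho>)
    then show ?case
      using rank_progress[of "\<rho> * nat \<lceil>2 / hmin\<rceil>" \<rho> v] by (simp add: add.commute)
  qed simp
  from this[of "Suc (nat \<lfloor>log 2 (slots I)\<rfloor>) * levels"] have "Suc (nat \<lfloor>log 2 (slots I)\<rfloor>) * levels \<le> rank v"
    using unsat_antimono[OF v assms] by (simp add: step_bound_def)
  then show False using rank_bound[of v] v by (auto simp: unsat_def)
qed

end

context line_run
begin

subsection \<open>The approximation ratio\<close>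

text \<open>The load is bounded for each width class separately, so a slot may carry up to 2 in
  total until \<open>better_class\<close> discards one of the classes.\<close>

definition packed :: "nat set \<Rightarrow> bool" where
  "packed S \<longleftrightarrow> (\<forall>u\<in>S. valid I B u) \<and> (\<forall>u\<in>S. \<forall>v\<in>S. proc_of I u = proc_of I v \<longrightarrow> u = v) \<and>
     (\<forall>T w e. load I S T w e \<le> 1)"

lemma overlapI:
  assumes "res_of I u = res_of I v" "wide I u \<longleftrightarrow> wide I v" "covers I u e" "covers I v e"
  shows "overlap I u v"
  using assms by (auto simp: overlap_def covers_def)

text \<open>Vertices raised in the same step are free of conflicts, so at most one of them is new at
  a given slot and width class. Testing each one against \<open>S\<close> alone is therefore
  enough.\<close>

lemma packed_extend:
  assumes S: "packed S" and C: "C \<subseteq> {v \<in> ra k. compatible I S v}"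
  shows "packed (S \<union> C)"
  unfolding packed_def
proof (intro conjI ballI allI impI)
  show "valid I B u" if "u \<in> S \<union> C" for u
    using that S C raised_valid by (auto simp: packed_def)
  show "u = v" if "u \<in> S \<union> C" "v \<in> S \<union> C" "proc_of I u = proc_of I v" for u v
  proof -
    have "proc_of I x \<noteq> proc_of I y" if "x \<in> S" "y \<in> C" for x y
      using that C S valid_less unfolding compatible_def packed_def by blast
    moreover have "x = y" if "x \<in> C" "y \<in> C" "proc_of I x = proc_of I y" for x y
      using that C raised_independent[of x k y] by (auto simp: conflict_def)
    moreover have "x = y" if "x \<in> S" "y \<in> S" "proc_of I x = proc_of I y" for x y
      using that S by (auto simp: packed_def)
    ultimately show ?thesis using that by (metis Un_iff)
  qed
next
  fix T w e
  show "load I (S \<union> C) T w e \<le> 1"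
  proof (cases "\<exists>v\<in>C. res_of I v = T \<and> (wide I v \<longleftrightarrow> w) \<and> covers I v e")
    case False
    then have "load I (S \<union> C) T w e = load I S T w e"
      unfolding load_def by (intro sum.cong) auto
    then show ?thesis using S by (simp add: packed_def)
  next
    case True
    then obtain v where v: "v \<in> C" "res_of I v = T" "wide I v \<longleftrightarrow> w" "covers I v e" by blast
    have comp: "compatible I S v" and val: "valid I B v" "v \<in> ra k"
      using v C raised_valid by auto
    then have vS: "v \<notin> S" using valid_less[OF val(1)] unfolding compatible_def by blast
    have uniq: "u = v" if "u \<in> C" "res_of I u = T" "wide I u \<longleftrightarrow> w" "covers I u e" for u
    proof (rule ccontr)
      assume "u \<noteq> v"
      moreover have "overlap I u v" by (rule overlapI[of _ _ e]) (use that v in auto)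
      ultimately have "conflict I u v" by (simp add: conflict_def)
      then show False using raised_independent[of u k v] that(1) C val(2) by blast
    qed
    have "load I (S \<union> C) T w e = (\<Sum>u<vertices I.
        (if u \<in> S \<and> res_of I u = T \<and> (wide I u \<longleftrightarrow> w) \<and> covers I u e then height_of I u else 0) +
        (if u = v then height_of I v else 0))"
      unfolding load_def
    proof (rule sum.cong[OF refl])
      fix x
      show "(if x \<in> S \<union> C \<and> res_of I x = T \<and> (wide I x \<longleftrightarrow> w) \<and> covers I x e then height_of I x else 0) =
        (if x \<in> S \<and> res_of I x = T \<and> (wide I x \<longleftrightarrow> w) \<and> covers I x e then height_of I x else 0) +
        (if x = v then height_of I v else 0)"
      proof (cases "x = v")
        case True
        then show ?thesis using v vS by simp
      next
        case False
        then have "\<not> (x \<in> C \<and> res_of I x = T \<and> (wide I x \<longleftrightarrow> w) \<and> covers I x e)"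
          using uniq[of x] by blast
        then show ?thesis using False by auto
      qed
    qed
    also have "\<dots> = load I S T w e + height_of I v"
      unfolding load_def sum.distrib using valid_less[OF val(1)] by (simp add: sum.delta)
    also have "\<dots> \<le> 1"
    proof -
      have "e < Suc (slots I)" using validD(9)[OF val(1)] v(4) by (simp add: covers_def)
      then show ?thesis using comp v unfolding compatible_def by blast
    qed
    finally show ?thesis .
  qed
qed

lemma packed_chosen: "packed (chosen mis I B K j)"
proof (induction j)
  case 0
  show ?case by (simp add: packed_def load_def)
next
  case (Suc j)
  then show ?case unfolding chosen.simps by (rule packed_extend) blast
qed

lemma finite_chosen: "finite (chosen mis I B K j)"
  by (rule finite_subset[of _ "{..<vertices I}"]) (auto dest: chosen_valid valid_less)

lemma chosen_raised:
  assumes "v \<in> chosen mis I B K j" "j \<le> K"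
  shows "\<exists>k. K - j \<le> k \<and> k < K \<and> v \<in> ra k"
  using assms
proof (induction j)
  case (Suc j)
  show ?case
  proof (cases "v \<in> chosen mis I B K j")
    case True
    then obtain k where "K - j \<le> k" "k < K" "v \<in> ra k" using Suc by auto
    then show ?thesis by (intro exI[of _ k]) auto
  next
    case False
    then show ?thesis using Suc.prems by (intro exI[of _ "K - Suc j"]) auto
  qed
qed simp

text \<open>A raised vertex that is not chosen is blocked by vertices raised later, and those pay for it:
  for a narrow vertex they have a total height of at least \<open>1 / 2\<close>, a wide one is blocked by
  wide ones.\<close>

lemma weight_chosen:
  assumes u: "u \<in> ra (K - Suc j)" and j: "Suc j \<le> K"
  shows "1 \<le> (\<Sum>v\<in>chosen mis I B K (Suc j). weight I u v)"
proof -
  let ?S = "chosen mis I B K j" and ?S' = "chosen mis I B K (Suc j)"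
  have nonneg: "0 \<le> weight I u v" if "v \<in> ?S'" for v
    using that chosen_valid[of v mis I B K "Suc j"] by (intro weight_nonneg) auto
  have single: "1 \<le> (\<Sum>v\<in>?S'. weight I u v)" if "v \<in> ?S'" "1 \<le> weight I u v" for v
    using member_le_sum[OF that(1), of "weight I u"] nonneg that(2) finite_chosen[of K "Suc j"] by force
  have uval: "valid I B u" using raised_valid[OF u] .
  consider "u \<in> ?S'" | v where "v \<in> ?S" "proc_of I v = proc_of I u"
    | e where "covers I u e" "1 < load I ?S (res_of I u) (wide I u) e + height_of I u"
        "\<And>v. v \<in> ?S \<Longrightarrow> proc_of I v \<noteq> proc_of I u"
  proof (cases "compatible I ?S u")
    case True
    then show ?thesis using u that(1) by simp
  next
    case False
    show ?thesis
    proof (cases "\<exists>v\<in>?S. proc_of I v = proc_of I u")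
      case True
      then show ?thesis using that(2) by blast
    next
      case no: False
      then obtain e where "covers I u e" "\<not> load I ?S (res_of I u) (wide I u) e + height_of I u \<le> 1"
        using False unfolding compatible_def by blast
      then show ?thesis using that(3)[of e] no by auto
    qed
  qed
  then show ?thesis
  proof cases
    case 1
    then show ?thesis by (rule single) simp
  next
    case (2 v)
    then show ?thesis by (intro single[of v]) (auto simp: weight_def)
  next
    case (3 e)
    let ?D = "{v \<in> ?S. res_of I v = res_of I u \<and> (wide I v \<longleftrightarrow> wide I u) \<and> covers I v e}"
    have wt: "weight I u v = 2 * height_of I v" if "v \<in> ?D" for v
    proof -
      have v: "v \<in> ?S" "res_of I v = res_of I u" "wide I v = wide I u" "covers I v e"
        using that by (simp_all only: mem_Collect_eq)
      obtain k where k: "K - j \<le> k" "v \<in> ra k"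
        using chosen_raised[OF v(1) Suc_leD[OF j]] by blast
      have "overlap I u v" by (rule overlapI[OF v(2,3)[symmetric] 3(1) v(4)])
      moreover have procs: "proc_of I v \<noteq> proc_of I u" by (rule 3(3)[OF v(1)])
      \<comment> \<open>Vertices chosen so far stem from the last \<open>j\<close> steps and hence
        were raised strictly after \<open>u\<close>.\<close>
      moreover have "len_scale I u \<le> len_scale I v"
      proof (rule raised_later_scale[OF u k(2)])
        show "K - Suc j < k" using k(1) j by linarith
        show "conflict I u v" using \<open>overlap I u v\<close> procs unfolding conflict_def by blast
      qed
      ultimately show ?thesis by (simp add: weight_def)
    qed
    have "load I ?S (res_of I u) (wide I u) e = (\<Sum>v\<in>?D. height_of I v)"
      unfolding load_def using chosen_valid[of _ mis I B K j]
      by (subst sum.inter_filter[symmetric]) (auto intro!: sum.cong dest: valid_less)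
    then have h: "1 - height_of I u < (\<Sum>v\<in>?D. height_of I v)" using 3(2) by simp
    have eq: "(\<Sum>v\<in>?D. weight I u v) = 2 * (\<Sum>v\<in>?D. height_of I v)"
      using wt by (simp add: sum_distrib_left)
    have "1 \<le> (\<Sum>v\<in>?D. weight I u v)"
    proof (cases "wide I u")
      case False
      then show ?thesis using h eq by (simp add: wide_def)
    next
      case True
      have "0 < (\<Sum>v\<in>?D. height_of I v)" using h validD(5)[OF uval] by simp
      then have "?D \<noteq> {}" by (intro notI) simp
      then obtain v where v: "v \<in> ?D" by blast
      have "weight I u v \<le> (\<Sum>v\<in>?D. weight I u v)"
        using v nonneg finite_chosen[of K j] by (intro member_le_sum) auto
      moreover have "1 \<le> weight I u v" using v wt[OF v] True by (simp add: wide_def)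
      ultimately show ?thesis by simp
    qed
    also have "\<dots> \<le> (\<Sum>v\<in>?S'. weight I u v)"
      using nonneg finite_chosen[of K "Suc j"] by (intro sum_mono2) auto
    finally show ?thesis .
  qed
qed

definition residual :: "nat \<Rightarrow> real" where
  "residual k = (\<Sum>u\<in>ra k. profit_of I u - ch k u)"

text \<open>The local ratio argument, read backwards: undoing a step releases on the chosen vertices
  the charge that they received in it, and by \<open>weight_chosen\<close> this is at least the
  total residual of the step. At \<open>j = K\<close> no charge is left and the right-hand side is
  the plain profit.\<close>

lemma profit_chosen_partial:
  "j \<le> K \<Longrightarrow> (\<Sum>k\<in>{K - j..<K}. residual k) \<le> (\<Sum>v\<in>chosen mis I B K j. profit_of I v - ch (K - j) v)"
proof (induction j)
  case (Suc j)
  let ?S = "chosen mis I B K j" and ?S' = "chosen mis I B K (Suc j)" and ?k = "K - Suc j"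
  have k: "Suc ?k = K - j" using Suc.prems by simp
  have "{?k..<K} = insert ?k {K - j..<K}" using Suc.prems by auto
  then have "(\<Sum>k\<in>{?k..<K}. residual k) = residual ?k + (\<Sum>k\<in>{K - j..<K}. residual k)"
    using Suc.prems by simp
  also have "\<dots> \<le> residual ?k + (\<Sum>v\<in>?S. profit_of I v - ch (Suc ?k) v)"
    using Suc by (simp add: k)
  \<comment> \<open>The vertices added in this step contribute nothing, because being raised made
    their charge equal to their profit.\<close>
  also have "(\<Sum>v\<in>?S. profit_of I v - ch (Suc ?k) v) = (\<Sum>v\<in>?S'. profit_of I v - ch (Suc ?k) v)"
    using finite_chosen[of K "Suc j"] charge_raised[of _ ?k] by (intro sum.mono_neutral_left) auto
  also have "residual ?k \<le> (\<Sum>u\<in>ra ?k. (profit_of I u - ch ?k u) * (\<Sum>v\<in>?S'. weight I u v))"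
    unfolding residual_def
  proof (rule sum_mono)
    fix u assume u: "u \<in> ra ?k"
    show "profit_of I u - ch ?k u \<le> (profit_of I u - ch ?k u) * (\<Sum>v\<in>?S'. weight I u v)"
      using weight_chosen[OF u Suc.prems] residual_pos(2)[OF u] by simp
  qed
  also have "\<dots> = (\<Sum>v\<in>?S'. \<Sum>u\<in>ra ?k. (profit_of I u - ch ?k u) * weight I u v)"
    unfolding sum_distrib_left by (rule sum.swap)
  also have "\<dots> + (\<Sum>v\<in>?S'. profit_of I v - ch (Suc ?k) v) = (\<Sum>v\<in>?S'. profit_of I v - ch ?k v)"
    unfolding sum.distrib[symmetric]
  proof (rule sum.cong[OF refl])
    fix v assume "v \<in> ?S'"
    then have "valid I B v" by (rule chosen_valid)
    then show "(\<Sum>u\<in>ra ?k. (profit_of I u - ch ?k u) * weight I u v) +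
      (profit_of I v - ch (Suc ?k) v) = profit_of I v - ch ?k v"
      by (simp only: charge_Suc)
  qed
  finally show ?case by simp
qed simp

lemma profit_chosen: "(\<Sum>k<K. residual k) \<le> (\<Sum>v\<in>chosen mis I B K K. profit_of I v)"
  using profit_chosen_partial[of K K] by (simp add: charge_def atLeast0LessThan)

text \<open>If \<open>v\<close> overlaps \<open>u\<close> but contains neither its first nor its
  last slot, it lies strictly inside; being longer than half of \<open>u\<close>, it cannot avoid
  the middle slot.\<close>

lemma covers_critical:
  assumes "overlap I u v" "len_of I u < 2 * len_of I v" "1 \<le> len_of I u"
  shows "covers I v (start_of I u) \<or> covers I v (start_of I u + len_of I u div 2) \<or>
    covers I v (start_of I u + len_of I u - 1)"
  using assms unfolding overlap_def covers_def by auto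

text \<open>A charged \<open>v\<close> of another processor satisfies
  \<open>len_of I u < 2 * len_of I v\<close>, since scales are within a factor 2 of lengths, and so
  covers one of three slots of \<open>u\<close>. Each slot carries height at most 1, entering with
  factor 2; at most one \<open>v\<close> shares the demand. This gives
  \<open>1 + 2 * 3\<close>.\<close>

lemma weight_packing:
  assumes u: "valid I B u" and val: "\<And>v. v \<in> A \<Longrightarrow> valid I B v"
    and procs: "\<And>v w. v \<in> A \<Longrightarrow> w \<in> A \<Longrightarrow> proc_of I v = proc_of I w \<Longrightarrow> v = w"
    and heights: "\<And>T e. (\<Sum>v\<in>{v \<in> A. res_of I v = T \<and> covers I v e}. height_of I v) \<le> 1"
  shows "(\<Sum>v\<in>A. weight I u v) \<le> 7"
proof -
  have fin: "finite A"
    by (rule finite_subset[of _ "{..<vertices I}"]) (use val valid_less in auto)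
  define c where "c e v = (if res_of I v = res_of I u \<and> covers I v e then height_of I v else 0)" for e v
  let ?e1 = "start_of I u" and ?e2 = "start_of I u + len_of I u div 2" and ?e3 = "start_of I u + len_of I u - 1"
  have c: "(\<Sum>v\<in>A. c e v) \<le> 1" for e
    using heights[of "res_of I u" e] fin unfolding c_def by (simp add: sum.inter_filter)
  have c0: "0 \<le> c e v" if "v \<in> A" for e v
    using validD(4)[OF val[OF that]] hmin by (simp add: c_def)
  have "weight I u v \<le> (if proc_of I v = proc_of I u then 1 else 0) + 2 * (c ?e1 v + c ?e2 v + c ?e3 v)"
    if v: "v \<in> A" for v
  proof (cases "proc_of I v = proc_of I u \<or> \<not> (overlap I u v \<and> len_scale I u \<le> len_scale I v)")
    case True
    then show ?thesis using c0[OF v, of ?e1] c0[OF v, of ?e2] c0[OF v, of ?e3] by (auto simp: weight_def)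
  next
    case False
    then have ov: "overlap I u v" "len_scale I u \<le> len_scale I v" by auto
    have "len_of I u < 2 * len_of I v"
    proof -
      have "len_of I u < 2 * len_scale I u" "len_scale I v \<le> len_of I v"
        using scale_power[OF u] scale_power[OF val[OF v]] by metis+
      then show ?thesis using ov(2) by linarith
    qed
    then have "covers I v ?e1 \<or> covers I v ?e2 \<or> covers I v ?e3"
      using covers_critical[OF ov(1)] validD(6)[OF u] by blast
    moreover have "res_of I v = res_of I u" using ov by (simp add: overlap_def)
    ultimately have "height_of I v \<le> c ?e1 v + c ?e2 v + c ?e3 v"
      using c0[OF v, of ?e1] c0[OF v, of ?e2] c0[OF v, of ?e3] unfolding c_def by auto
    then show ?thesis using False by (simp add: weight_def)
  qed
  then have "(\<Sum>v\<in>A. weight I u v) \<le>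
    (\<Sum>v\<in>A. (if proc_of I v = proc_of I u then 1 else 0) + 2 * (c ?e1 v + c ?e2 v + c ?e3 v))"
    by (rule sum_mono)
  also have "\<dots> = (\<Sum>v\<in>A. if proc_of I v = proc_of I u then 1 else 0) +
    2 * ((\<Sum>v\<in>A. c ?e1 v) + (\<Sum>v\<in>A. c ?e2 v) + (\<Sum>v\<in>A. c ?e3 v))"
    by (simp add: sum.distrib sum_distrib_left)
  also have "(\<Sum>v\<in>A. if proc_of I v = proc_of I u then 1 else 0 :: real) \<le> 1"
  proof -
    have "card {v \<in> A. proc_of I v = proc_of I u} \<le> Suc 0"
      using fin procs by (subst card_le_Suc0_iff_eq) auto
    then show ?thesis using fin by (simp add: sum.inter_filter[symmetric])
  qed
  finally show ?thesis using c[of ?e1] c[of ?e2] c[of ?e3] by simp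
qed

lemma charge_sum:
  "valid I B v \<Longrightarrow> ch K v = (\<Sum>k<K. \<Sum>u\<in>ra k. (profit_of I u - ch k u) * weight I u v)"
  by (induction K) (simp_all add: charge_Suc, simp add: charge_def)

text \<open>Every vertex of \<open>A\<close> has been charged at least \<open>2 / 3\<close> of its
  profit, and exchanging the summations bounds what a unit of residual contributes to
  \<open>A\<close> by 7.\<close>

lemma profit_upper:
  assumes K: "\<And>v. \<not> unsat I B (ch K) v" and val: "\<And>v. v \<in> A \<Longrightarrow> valid I B v"
    and procs: "\<And>v w. v \<in> A \<Longrightarrow> w \<in> A \<Longrightarrow> proc_of I v = proc_of I w \<Longrightarrow> v = w"
    and heights: "\<And>T e. (\<Sum>v\<in>{v \<in> A. res_of I v = T \<and> covers I v e}. height_of I v) \<le> 1"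
  shows "2 / 3 * (\<Sum>v\<in>A. profit_of I v) \<le> 7 * (\<Sum>k<K. residual k)"
proof -
  have "2 / 3 * (\<Sum>v\<in>A. profit_of I v) \<le> (\<Sum>v\<in>A. ch K v)"
    unfolding sum_distrib_left using K val by (intro sum_mono) (auto simp: unsat_def not_less)
  also have "\<dots> = (\<Sum>v\<in>A. \<Sum>k<K. \<Sum>u\<in>ra k. (profit_of I u - ch k u) * weight I u v)"
    using val by (intro sum.cong charge_sum) auto
  also have "\<dots> = (\<Sum>k<K. \<Sum>v\<in>A. \<Sum>u\<in>ra k. (profit_of I u - ch k u) * weight I u v)"
    by (rule sum.swap)
  also have "\<dots> = (\<Sum>k<K. \<Sum>u\<in>ra k. (profit_of I u - ch k u) * (\<Sum>v\<in>A. weight I u v))"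
    unfolding sum_distrib_left by (intro sum.cong refl sum.swap)
  also have "\<dots> \<le> (\<Sum>k<K. \<Sum>u\<in>ra k. (profit_of I u - ch k u) * 7)"
  proof (intro sum_mono mult_left_mono)
    fix k u assume u: "u \<in> ra k"
    show "(\<Sum>v\<in>A. weight I u v) \<le> 7"
      by (rule weight_packing[OF raised_valid[OF u] val procs heights])
    show "0 \<le> profit_of I u - ch k u" using residual_pos(2)[OF u] by simp
  qed
  also have "\<dots> = 7 * (\<Sum>k<K. residual k)"
    by (simp add: residual_def sum_distrib_left mult.commute)
  finally show ?thesis .
qed

text \<open>After grouping by resource, the class that is kept has at least half of the profit on
  that resource.\<close>

lemma profit_better_class:
  assumes "\<And>v. v \<in> S \<Longrightarrow> valid I B v"
  shows "(\<Sum>v\<in>S. profit_of I v) \<le> 2 * (\<Sum>v\<in>better_class I S. profit_of I v)"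
proof -
  have fin: "finite S"
    by (rule finite_subset[of _ "{..<vertices I}"]) (use assms valid_less in auto)
  have res: "res_of I ` S \<subseteq> {..<resources I}" using assms validD(8) by auto
  let ?c = "class_profit I S"
  have c: "?c T w = (\<Sum>v\<in>{v \<in> S. res_of I v = T \<and> (wide I v \<longleftrightarrow> w)}. profit_of I v)" for T w
    unfolding class_profit_def using assms
    by (subst sum.inter_filter[symmetric]) (auto intro!: sum.cong dest: valid_less)
  have "(\<Sum>v\<in>{v \<in> S. res_of I v = T}. profit_of I v) \<le>
    2 * (\<Sum>v\<in>{v \<in> better_class I S. res_of I v = T}. profit_of I v)" for T
  proof -
    have "{v \<in> S. res_of I v = T} = {v \<in> S. res_of I v = T \<and> (wide I v \<longleftrightarrow> True)} \<union>
      {v \<in> S. res_of I v = T \<and> (wide I v \<longleftrightarrow> False)}" by auto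
    then have "(\<Sum>v\<in>{v \<in> S. res_of I v = T}. profit_of I v) = ?c T True + ?c T False"
      unfolding c using fin by (simp only:) (intro sum.union_disjoint, auto)
    moreover have "(\<Sum>v\<in>{v \<in> better_class I S. res_of I v = T}. profit_of I v) = ?c T (?c T False \<le> ?c T True)"
      unfolding c[of T "?c T False \<le> ?c T True"] by (intro sum.cong) (auto simp: better_class_def)
    ultimately show ?thesis by (cases "?c T False \<le> ?c T True") auto
  qed
  then have "(\<Sum>T<resources I. \<Sum>v\<in>{v \<in> S. res_of I v = T}. profit_of I v) \<le>
    (\<Sum>T<resources I. 2 * (\<Sum>v\<in>{v \<in> better_class I S. res_of I v = T}. profit_of I v))"
    by (rule sum_mono)
  also have "\<dots> = 2 * (\<Sum>v\<in>better_class I S. profit_of I v)"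
    unfolding sum_distrib_left[symmetric] using fin res
    by (subst sum.group) (auto simp: better_class_def)
  finally show ?thesis using fin res by (simp add: sum.group)
qed

lemma better_class_packed:
  assumes "packed S"
  shows "(\<Sum>v\<in>{v \<in> better_class I S. res_of I v = T \<and> covers I v e}. height_of I v) \<le> 1"
proof -
  let ?w = "class_profit I S T False \<le> class_profit I S T True"
  have "{v \<in> better_class I S. res_of I v = T \<and> covers I v e} =
    {v \<in> S. res_of I v = T \<and> (wide I v \<longleftrightarrow> ?w) \<and> covers I v e}"
    by (auto simp: better_class_def)
  moreover have "(\<Sum>v\<in>{v \<in> S. res_of I v = T \<and> (wide I v \<longleftrightarrow> ?w) \<and> covers I v e}. height_of I v) = load I S T ?w e"
    unfolding load_def using assms
    by (subst sum.inter_filter[symmetric]) (auto simp: packed_def intro!: sum.cong dest: valid_less)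
  ultimately show ?thesis using assms by (simp add: packed_def)
qed

lemma profit_ratio:
  assumes K: "\<And>v. \<not> unsat I B (ch K) v" and val: "\<And>v. v \<in> A \<Longrightarrow> valid I B v"
    and procs: "\<And>v w. v \<in> A \<Longrightarrow> w \<in> A \<Longrightarrow> proc_of I v = proc_of I w \<Longrightarrow> v = w"
    and heights: "\<And>T e. (\<Sum>v\<in>{v \<in> A. res_of I v = T \<and> covers I v e}. height_of I v) \<le> 1"
  shows "(\<Sum>v\<in>A. profit_of I v) \<le> 21 * (\<Sum>v\<in>better_class I (chosen mis I B K K). profit_of I v)"
proof -
  have "2 / 3 * (\<Sum>v\<in>A. profit_of I v) \<le> 7 * (\<Sum>k<K. residual k)"
    by (rule profit_upper[OF assms])
  moreover have "(\<Sum>v\<in>chosen mis I B K K. profit_of I v) \<le>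
    2 * (\<Sum>v\<in>better_class I (chosen mis I B K K). profit_of I v)"
    by (rule profit_better_class[OF chosen_valid])
  ultimately show ?thesis using profit_chosen[of K] by linarith
qed

end

subsection \<open>Running the given algorithm for maximal independent sets\<close>

definition mis_time :: "algorithm \<Rightarrow> nat \<Rightarrow> (nat \<Rightarrow> nat \<Rightarrow> bool) \<Rightarrow> nat" where
  "mis_time M N E = (LEAST s. terminates_within M (graph_network (N, E)) s)"

definition mis_run :: "algorithm \<Rightarrow> nat \<Rightarrow> mis_solver" where
  "mis_run M N E = ({v. v < N \<and> outcome M (graph_network (N, E)) v = Num 1}, mis_time M N E)"

text \<open>A version of \<open>outcome\<close> that can be computed round by round: the first
  answer found in the rounds before \<open>s\<close>, without a search over all rounds.\<close>

primrec decision :: "algorithm \<Rightarrow> network \<Rightarrow> nat \<Rightarrow> nat \<Rightarrow> val" where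
  "decision A G v 0 = Empty"
| "decision A G v (Suc s) = (if decision A G v s = Empty then answer_at A G s v else decision A G v s)"

text \<open>The number of rounds is not known in advance.  If \<open>F\<close> rounds do not suffice, then the
  second component is \<open>F\<close> and the first one is meaningless.\<close>

definition mis_fuel :: "algorithm \<Rightarrow> nat \<Rightarrow> nat \<Rightarrow> mis_solver" where
  "mis_fuel M N F E = ({v. v < N \<and> decision M (graph_network (N, E)) v F = Num 1},
     \<Sum>s<F. if \<exists>v<N. decision M (graph_network (N, E)) v (Suc s) = Empty then 1 else 0)"

lemma nodes_graph_network [simp]: "nodes (graph_network (N, E)) = N"
  by (simp add: graph_network_def)

lemma decision_Empty: "decision A G v s = Empty \<longleftrightarrow> (\<forall>s'<s. answer_at A G s' v = Empty)"
  by (induction s) (auto simp: less_Suc_eq)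

lemma decision_first:
  assumes "answer_at A G s v \<noteq> Empty" "\<And>s'. s' < s \<Longrightarrow> answer_at A G s' v = Empty" "s < F"
  shows "decision A G v F = answer_at A G s v"
  using assms(3)
proof (induction F)
  case (Suc F)
  show ?case
  proof (cases "s = F")
    case True
    then have "decision A G v F = Empty" using assms(2) by (simp add: decision_Empty)
    then show ?thesis using True by simp
  next
    case False
    then have "decision A G v F = answer_at A G s v" using Suc by simp
    then show ?thesis using assms(1) by simp
  qed
qed simp

lemma decision_outcome:
  assumes "answer_at A G s v \<noteq> Empty" "s < F"
  shows "decision A G v F = outcome A G v"
proof -
  let ?l = "LEAST s. answer_at A G s v \<noteq> Empty"
  have l: "answer_at A G ?l v \<noteq> Empty" by (rule LeastI[of "\<lambda>s. answer_at A G s v \<noteq> Empty", OF assms(1)])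
  have ls: "?l \<le> s" by (rule Least_le[of "\<lambda>s. answer_at A G s v \<noteq> Empty", OF assms(1)])
  have "answer_at A G s' v = Empty" if "s' < ?l" for s'
    using not_less_Least[OF that] by blast
  then show ?thesis unfolding outcome_def
    by (rule decision_first[OF l _ le_less_trans[OF ls assms(2)]])
qed

lemma outcome_cong:
  assumes "\<And>s'. s' \<le> s \<Longrightarrow> answer_at A G s' v = answer_at A G' s' v" "answer_at A G s v \<noteq> Empty"
  shows "outcome A G v = outcome A G' v"
proof -
  have "decision A G v j = decision A G' v j" if "j \<le> Suc s" for j
    using that assms(1) by (induction j) auto
  from this[of "Suc s"] have "decision A G v (Suc s) = decision A G' v (Suc s)" by blast
  moreover have "answer_at A G' s v \<noteq> Empty" using assms(1)[of s] assms(2) by simp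
  ultimately show ?thesis
    using decision_outcome[of A G s v "Suc s"] decision_outcome[of A G' s v "Suc s"] assms(2) by simp
qed

lemma terminates_within_mono: "terminates_within A G s \<Longrightarrow> s \<le> t \<Longrightarrow> terminates_within A G t"
  unfolding terminates_within_def by (meson order_trans)

lemma terminates_within_mis_time:
  assumes "MIS_algorithm M T" "simple_graph N E"
  shows "terminates_within M (graph_network (N, E)) s \<longleftrightarrow> mis_time M N E \<le> s" "mis_time M N E \<le> T N"
proof -
  have T: "terminates_within M (graph_network (N, E)) (T N)"
    using assms unfolding MIS_algorithm_def by blast
  then show "mis_time M N E \<le> T N" unfolding mis_time_def by (rule Least_le)
  have "terminates_within M (graph_network (N, E)) (mis_time M N E)"
    unfolding mis_time_def using T by (rule LeastI)
  then show "terminates_within M (graph_network (N, E)) s \<longleftrightarrow> mis_time M N E \<le> s"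
    using terminates_within_mono[of M _ "mis_time M N E" s] unfolding mis_time_def by (auto intro: Least_le)
qed

text \<open>Some vertex is undecided after the answers of rounds \<open>0\<close> to
  \<open>s\<close> exactly if \<open>s\<close> lies below the termination time, so the sum counts
  the rounds up to that time as far as the fuel reaches.\<close>

lemma mis_fuel_rounds:
  assumes "MIS_algorithm M T" "simple_graph N E"
  shows "snd (mis_fuel M N F E) = min F (mis_time M N E)"
proof -
  let ?G = "graph_network (N, E)"
  have "(\<exists>v<N. decision M ?G v (Suc s) = Empty) \<longleftrightarrow> s < mis_time M N E" for s
    using terminates_within_mis_time(1)[OF assms, of s]
    unfolding decision_Empty terminates_within_def by (auto simp: less_Suc_eq_le not_le[symmetric])
  then have "snd (mis_fuel M N F E) = (\<Sum>s<F. if s < mis_time M N E then 1 else 0)"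
    by (simp add: mis_fuel_def)
  also have "\<dots> = card {s \<in> {..<F}. s < mis_time M N E}"
    by (simp add: sum.If_cases Int_def)
  also have "{s \<in> {..<F}. s < mis_time M N E} = {..<min F (mis_time M N E)}"
    by auto
  finally show ?thesis by simp
qed

text \<open>The inequality is strict because fuel \<open>F\<close> inspects only the answers of
  rounds \<open>0\<close> to \<open>F - 1\<close>, while the last vertex answers in round
  \<open>mis_time M N E\<close>.\<close>

lemma mis_fuel_eq_run:
  assumes "MIS_algorithm M T" "simple_graph N E" "mis_time M N E < F"
  shows "mis_fuel M N F E = mis_run M N E"
proof -
  let ?G = "graph_network (N, E)"
  have "decision M ?G v F = outcome M ?G v" if "v < N" for v
  proof -
    have "terminates_within M ?G (mis_time M N E)"
      by (rule terminates_within_mis_time(1)[OF assms(1,2), THEN iffD2, OF order_refl])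
    then have "\<exists>s\<le>mis_time M N E. answer_at M ?G s v \<noteq> Empty"
      using that by (simp add: terminates_within_def)
    then obtain s where s: "s \<le> mis_time M N E" "answer_at M ?G s v \<noteq> Empty" by (elim exE conjE)
    show ?thesis by (rule decision_outcome[OF s(2)]) (use s(1) assms(3) in linarith)
  qed
  then have "fst (mis_fuel M N F E) = fst (mis_run M N E)"
    by (auto simp: mis_fuel_def mis_run_def)
  moreover have "snd (mis_fuel M N F E) = snd (mis_run M N E)"
    using mis_fuel_rounds[OF assms(1,2), of F] assms(3) by (simp add: mis_run_def)
  ultimately show ?thesis by (rule prod_eqI)
qed

text \<open>With fuel \<open>Suc t\<close>, a count of at most \<open>t\<close> cannot be due to
  exhausted fuel, so it is the true running time.\<close>

lemma mis_fuel_agree: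
  assumes "MIS_algorithm M T" "simple_graph N E"
    and "snd (mis_fuel M N (Suc t) E) \<le> t \<or> snd (mis_run M N E) \<le> t"
  shows "mis_fuel M N (Suc t) E = mis_run M N E"
  using assms mis_fuel_rounds[OF assms(1,2), of "Suc t"]
  by (intro mis_fuel_eq_run[OF assms(1,2)]) (auto simp: mis_run_def min_def split: if_splits)

lemma maximal_independent_mis_run:
  assumes "MIS_algorithm M T" "simple_graph N E"
  shows "maximal_independent N E (fst (mis_run M N E))"
  using assms by (simp add: MIS_algorithm_def mis_run_def)

lemma raise_empty: "(\<And>v. v < vertices I \<Longrightarrow> \<not> unsat I B l v) \<Longrightarrow> raise mis I B l = {}"
  by (auto simp: raise_def active_def unsat_def dest: valid_less)

text \<open>As long as something is unsatisfied, the rounds of the solver are part of the total, so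
  each solver call is short enough for the two solvers to agree; later nothing is raised whatever
  the solver returns. The premise is a disjunction because a simulating processor sees only its own
  count, whereas the termination argument bounds the true one.\<close>

lemma run_agree:
  assumes agree: "\<And>E. simple_graph (vertices I) E \<Longrightarrow> snd (mis E) \<le> t \<or> snd (mis' E) \<le> t \<Longrightarrow> mis E = mis' E"
    and rounds: "rounds mis I B k \<le> t \<or> rounds mis' I B k \<le> t"
  shows "(\<forall>j\<le>k. charge mis I B j = charge mis' I B j) \<and> rounds mis I B k = rounds mis' I B k \<and>
    (\<forall>j<k. raised mis I B j = raised mis' I B j)"
  using rounds
proof (induction k)
  case 0
  then show ?case by (simp add: charge_def rounds_def)
next
  case (Suc k)
  let ?l = "charge mis I B k"
  have "rounds mis I B k \<le> t \<or> rounds mis' I B k \<le> t" using Suc.prems by (auto simp: rounds_def)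
  note IH = Suc.IH[OF this]
  then have l: "charge mis' I B k = ?l" by simp
  have raise: "raise mis I B ?l = raise mis' I B ?l" and st: "step_rounds mis I B ?l = step_rounds mis' I B ?l"
  proof -
    have "raise mis I B ?l = raise mis' I B ?l \<and> step_rounds mis I B ?l = step_rounds mis' I B ?l"
    proof (cases "\<exists>v<vertices I. unsat I B ?l v")
      case True
      then have "snd (mis (conflict_graph I B ?l)) \<le> t \<or> snd (mis' (conflict_graph I B ?l)) \<le> t"
        using Suc.prems l by (auto simp: rounds_def step_rounds_def)
      then have "mis (conflict_graph I B ?l) = mis' (conflict_graph I B ?l)"
        by (intro agree simple_graph_conflict_graph)
      then show ?thesis by (simp add: raise_def step_rounds_def)
    next
      case False
      then show ?thesis by (auto simp: raise_empty step_rounds_def)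
    qed
    then show "raise mis I B ?l = raise mis' I B ?l" "step_rounds mis I B ?l = step_rounds mis' I B ?l"
      by auto
  qed
  have "charge mis I B (Suc k) = charge mis' I B (Suc k)"
  proof -
    have "charge mis I B (Suc k) = charge_step mis I B ?l" by (simp add: charge_def)
    also have "\<dots> = charge_step mis' I B ?l" by (simp add: charge_step_def raise fun_eq_iff)
    also have "\<dots> = charge_step mis' I B (charge mis' I B k)" by (simp only: l)
    also have "\<dots> = charge mis' I B (Suc k)" by (simp add: charge_def)
    finally show ?thesis .
  qed
  moreover have "rounds mis I B (Suc k) = rounds mis' I B (Suc k)"
  proof -
    have "rounds mis I B (Suc k) = rounds mis I B k + step_rounds mis I B ?l"
      by (simp add: rounds_def)
    also have "\<dots> = rounds mis' I B k + step_rounds mis' I B (charge mis' I B k)"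
      unfolding l st using IH by simp
    also have "\<dots> = rounds mis' I B (Suc k)" by (simp add: rounds_def)
    finally show ?thesis .
  qed
  moreover have "raised mis I B k = raised mis' I B k"
    unfolding raised_def l by (rule raise)
  ultimately show ?case using IH unfolding le_Suc_eq less_Suc_eq by blast
qed

lemma chosen_agree:
  assumes "\<And>j. j < K \<Longrightarrow> raised mis I B j = raised mis' I B j"
  shows "j \<le> K \<Longrightarrow> chosen mis I B K j = chosen mis' I B K j"
  by (induction j) (simp_all add: assms)

subsection \<open>Locality\<close>

definition linked :: "line_network \<Rightarrow> nat \<Rightarrow> nat \<Rightarrow> bool" where
  "linked I i j \<longleftrightarrow> i \<noteq> j \<and> acc I i \<inter> acc I j \<noteq> {}"

primrec ball :: "line_network \<Rightarrow> nat \<Rightarrow> nat \<Rightarrow> nat set" where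
  "ball I 0 i = {i}"
| "ball I (Suc t) i = ball I t i \<union> (\<Union>j\<in>{j. j < processors I \<and> linked I i j}. ball I t j)"

lemma ball_mono: "s \<le> t \<Longrightarrow> ball I s i \<subseteq> ball I t i"
  by (rule lift_Suc_mono_le[of "\<lambda>t. ball I t i"]) auto

lemma ball_self: "i \<in> ball I t i"
  using ball_mono[of 0 t I i] by simp

text \<open>\<open>ball\<close> is defined by the exchange of messages and grows at the centre;
  conflicts extend a path at its far end.\<close>

lemma ball_linked:
  "j \<in> ball I t i \<Longrightarrow> linked I j j' \<Longrightarrow> j' < processors I \<Longrightarrow> j' \<in> ball I (Suc t) i"
proof (induction t arbitrary: i)
  case (Suc t)
  then consider "j \<in> ball I t i" | u where "u < processors I" "linked I i u" "j \<in> ball I t u" by auto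
  then show ?case
  proof cases
    case 1
    have "j' \<in> ball I (Suc t) i" by (rule Suc.IH[OF 1 Suc.prems(2,3)])
    then show ?thesis by (rule subsetD[OF ball_mono, rotated]) simp
  next
    case (2 u)
    then have "j' \<in> ball I (Suc t) u" using Suc by blast
    then show ?thesis using 2 unfolding ball.simps(2)[of I "Suc t" i] by blast
  qed
qed auto

text \<open>Overlapping vertices use the same resource, which both processors can access. A conflict
  thus spans at most one hop.\<close>

lemma conflict_linked:
  assumes "valid I B u" "valid I B' v" "conflict I u v"
  shows "proc_of I u = proc_of I v \<or> linked I (proc_of I u) (proc_of I v)"
  using assms unfolding conflict_def overlap_def linked_def valid_def by auto

locale local_run =
  fixes I :: line_network and M :: algorithm and T :: "nat \<Rightarrow> nat" and hmin :: real
    and i :: nat and t :: nat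
  assumes adm: "I \<in> admissible hmin" and hmin: "0 < hmin" "hmin \<le> 1 / 2"
    and M: "MIS_algorithm M T"
    and i: "i < processors I"
begin

abbreviation "N \<equiv> vertices I"
abbreviation "run \<equiv> mis_run M N"

sublocale full: line_run I UNIV "mis_run M (vertices I)" hmin
  by unfold_locales (use adm hmin maximal_independent_mis_run[OF M] in auto)

sublocale known: line_run I "ball I t i" "mis_run M (vertices I)" hmin
  by unfold_locales (use adm hmin maximal_independent_mis_run[OF M] in auto)

definition near :: "nat \<Rightarrow> nat \<Rightarrow> bool" where
  "near s v \<longleftrightarrow> proc_of I v \<in> ball I s i"

lemma near_mono: "near s v \<Longrightarrow> s \<le> s' \<Longrightarrow> near s' v"
  unfolding near_def using ball_mono by blast

lemma near_conflict:
  assumes "near s u" "valid I B u" "valid I B' v" "conflict I u v"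
  shows "near (Suc s) v"
proof -
  have "proc_of I v < processors I" using valid_less[OF assms(3)] by (rule vertices_proc_of)
  then show ?thesis
    using conflict_linked[OF assms(2-4)] assms(1) ball_linked[of "proc_of I u" I s i "proc_of I v"]
      near_mono[of s v "Suc s"] unfolding near_def by auto
qed

lemma valid_near: "near s v \<Longrightarrow> s \<le> t \<Longrightarrow> valid I (ball I t i) v \<longleftrightarrow> valid I UNIV v"
  unfolding valid_def near_def using ball_mono by blast

lemma valid_UNIV: "valid I B v \<Longrightarrow> valid I UNIV v"
  by (simp add: valid_def)

abbreviation "c \<equiv> charge run I UNIV"
abbreviation "c' \<equiv> charge run I (ball I t i)"

context
  fixes l l' :: "nat \<Rightarrow> real" and s :: nat
  assumes l: "\<And>v. near s v \<Longrightarrow> l v = l' v" and s: "s \<le> t" "4 \<le> s"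
begin

lemma unsat_near: "near s v \<Longrightarrow> unsat I UNIV l v \<longleftrightarrow> unsat I (ball I t i) l' v"
  using l valid_near s unfolding unsat_def by auto

text \<open>Activity depends on the satisfaction of the conflicting vertices, which costs one hop.
  An edge of the conflict graph then needs the activity of both ends and costs a second one.\<close>

lemma active_near:
  assumes "near (s - 1) v"
  shows "active I UNIV l v \<longleftrightarrow> active I (ball I t i) l' v"
proof -
  have "near s v" using assms near_mono by simp
  note v = unsat_near[OF this]
  show ?thesis
  proof (cases "unsat I UNIV l v")
    case True
    have "unsat I UNIV l u \<longleftrightarrow> unsat I (ball I t i) l' u" if "conflict I u v" for u
    proof -
      have "near s u" if "valid I UNIV u"
        using near_conflict[OF assms _ that conflict_sym[OF \<open>conflict I u v\<close>]] True s(2)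
        by (auto simp: unsat_def)
      then show ?thesis using unsat_near[of u] valid_UNIV[of "ball I t i" u] unfolding unsat_def by blast
    qed
    then show ?thesis using v unfolding active_def by blast
  next
    case False
    then show ?thesis using v by (simp add: active_def)
  qed
qed

abbreviation "E \<equiv> conflict_graph I UNIV l"
abbreviation "E' \<equiv> conflict_graph I (ball I t i) l'"

lemma graph_near:
  assumes "near (s - 2) u"
  shows "E u v \<longleftrightarrow> E' u v"
proof (cases "valid I UNIV u \<and> valid I UNIV v \<and> conflict I u v")
  case True
  then have "near (Suc (s - 2)) v" using near_conflict[OF assms] by blast
  then have "near (s - 1) v" using s by (auto elim: near_mono)
  moreover have "near (s - 1) u" using assms by (rule near_mono) simp
  ultimately show ?thesis unfolding conflict_graph_def using active_near by blast
next
  case False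
  then show ?thesis unfolding conflict_graph_def using active_valid valid_UNIV by blast
qed

lemma graph_near_step:
  assumes "near r u" "E u v"
  shows "near (Suc r) v"
  using assms near_conflict active_valid unfolding conflict_graph_def by blast

text \<open>Initial states depend only on \<open>N\<close> and on the vertex, and every round takes
  in the neighbours in the graph, hence processors one hop further away.\<close>

lemma mis_state_near:
  "\<tau> \<le> s - 2 \<Longrightarrow> near (s - 2 - \<tau>) u \<Longrightarrow>
    state M (graph_network (N, E)) \<tau> u = state M (graph_network (N, E')) \<tau> u"
proof (induction \<tau> arbitrary: u)
  case 0
  then show ?case by (simp add: graph_network_def)
next
  case (Suc \<tau>)
  have u: "near (s - 2 - \<tau>) u" "near (s - 2) u" using Suc.prems by (auto elim: near_mono)
  have "state M (graph_network (N, E)) \<tau> v = state M (graph_network (N, E')) \<tau> v" if "E u v" for v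
  proof (rule Suc.IH)
    have "near (Suc (s - 2 - Suc \<tau>)) v" using graph_near_step[OF Suc.prems(2) that] .
    then show "near (s - 2 - \<tau>) v" using Suc.prems(1) by (auto elim: near_mono)
  qed (use Suc.prems in simp)
  then have "inbox M (graph_network (N, E)) (state M (graph_network (N, E)) \<tau>) u =
    inbox M (graph_network (N, E')) (state M (graph_network (N, E')) \<tau>) u"
    unfolding inbox_def graph_network_def
    by (auto intro!: arg_cong[of _ _ val_of_list] map_cong filter_cong simp: graph_near[OF u(2)])
  then show ?case using Suc.IH[OF _ u(1)] Suc.prems by simp
qed

text \<open>The radius is measured by the running time on \<open>E'\<close>, the graph that the
  processor knows; the true graph may need longer elsewhere. By that time the vertex has answered in
  \<open>E'\<close>, and all answers up to then coincide.\<close>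

lemma mis_near:
  assumes "snd (run E') \<le> s - 2" "near (s - 2 - snd (run E')) u" "u < N"
  shows "u \<in> fst (run E) \<longleftrightarrow> u \<in> fst (run E')"
proof -
  let ?G = "graph_network (N, E)" and ?G' = "graph_network (N, E')"
  have ans: "answer_at M ?G \<tau> u = answer_at M ?G' \<tau> u" if "\<tau> \<le> snd (run E')" for \<tau>
  proof -
    have "near (s - 2 - \<tau>) u" using assms(2) that by (auto elim: near_mono)
    then show ?thesis unfolding answer_at_def using that assms(1) by (simp add: mis_state_near)
  qed
  have "terminates_within M ?G' (snd (run E'))"
    by (simp add: terminates_within_mis_time(1)[OF M simple_graph_conflict_graph] mis_run_def)
  then obtain \<tau> where \<tau>: "\<tau> \<le> snd (run E')" "answer_at M ?G' \<tau> u \<noteq> Empty"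
    unfolding terminates_within_def using assms(3) by auto
  have "outcome M ?G' u = outcome M ?G u"
    by (rule outcome_cong[OF _ \<tau>(2)]) (use ans \<tau>(1) in simp)
  then show ?thesis by (simp add: mis_run_def)
qed

lemma raise_near:
  assumes "snd (run E') + 3 \<le> s" "near (s - 2 - snd (run E')) u"
  shows "u \<in> raise run I UNIV l \<longleftrightarrow> u \<in> raise run I (ball I t i) l'"
proof (cases "u < N")
  case True
  moreover have "near (s - 1) u" using assms by (auto elim: near_mono)
  ultimately show ?thesis
    using assms mis_near active_near by (auto simp: raise_def)
next
  case False
  then show ?thesis by (auto simp: raise_def dest: active_valid valid_less)
qed

text \<open>Weights vanish except for the vertex itself and its conflicts, so applying the charges
  costs one more hop than knowing the raised vertices.\<close>

lemma charge_step_near: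
  assumes "snd (run E') + 3 \<le> s" "near (s - 3 - snd (run E')) v"
  shows "charge_step run I UNIV l v = charge_step run I (ball I t i) l' v"
proof (cases "valid I UNIV v")
  case True
  have v: "near s v" using assms by (auto elim: near_mono)
  then have val: "valid I (ball I t i) v" using valid_near s True by blast
  have "(if u \<in> raise run I UNIV l then (profit_of I u - l u) * weight I u v else 0) =
    (if u \<in> raise run I (ball I t i) l' then (profit_of I u - l' u) * weight I u v else 0)" for u
  proof (cases "u = v \<or> conflict I u v")
    case False
    then have "weight I u v = 0" by (auto simp: weight_def conflict_def)
    then show ?thesis by simp
  next
    case uv: True
    show ?thesis
    proof (cases "valid I UNIV u")
      case False
      then show ?thesis by (auto simp: raise_def dest: active_valid valid_UNIV)
    next
      case u: True
      have "near (Suc (s - 3 - snd (run E'))) u"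
        using uv near_conflict[OF assms(2) True u] near_mono[OF assms(2)] conflict_sym by auto
      then have "near (s - 2 - snd (run E')) u" using assms(1) by (auto elim: near_mono)
      then show ?thesis using raise_near[OF assms(1)] l near_mono[of _ u s] by auto
    qed
  qed
  then show ?thesis using True val l[OF v] by (simp add: charge_step_def)
next
  case False
  then show ?thesis using valid_UNIV by (auto simp: charge_step_def)
qed

end

section \<open>Comparing the run in a ball with the run on all processors\<close>

definition live :: "nat \<Rightarrow> bool" where
  "live k \<longleftrightarrow> (\<exists>v<N. unsat I (ball I t i) (c' k) v)"

abbreviation "D \<equiv> rounds run I (ball I t i)"

lemma live_antimono: "live k' \<Longrightarrow> k \<le> k' \<Longrightarrow> live k"
  unfolding live_def using known.unsat_antimono by blast

lemma rounds_Suc_live: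
  "live k \<Longrightarrow> D (Suc k) = D k + snd (run (conflict_graph I (ball I t i) (c' k))) + 4"
  by (simp add: rounds_def step_rounds_def live_def)

lemma rounds_ge: "(\<And>j. j < k \<Longrightarrow> live j) \<Longrightarrow> 4 * k \<le> D k"
proof (induction k)
  case (Suc k)
  then show ?case using rounds_Suc_live[of k] by simp
qed simp

text \<open>After \<open>k\<close> steps the information has travelled \<open>D k - k\<close> hops:
  each step uses one hop less than the rounds counted for it, leaving \<open>k\<close> hops in
  reserve.\<close>

lemma charge_near:
  assumes "\<And>j. j < k \<Longrightarrow> live j" "D k \<le> t" "near (t - (D k - k)) v"
  shows "c k v = c' k v"
  using assms
proof (induction k arbitrary: v)
  case 0
  then show ?case by (simp add: charge_def)
next
  case (Suc k)
  let ?m = "snd (run (conflict_graph I (ball I t i) (c' k)))"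
  have D: "D (Suc k) = D k + ?m + 4" using Suc.prems(1) by (intro rounds_Suc_live) simp
  have "4 * k \<le> D k" using Suc.prems(1) by (intro rounds_ge) simp
  then have arith: "t - (D (Suc k) - Suc k) = t - (D k - k) - 3 - ?m" "4 \<le> t - (D k - k)"
    "?m + 3 \<le> t - (D k - k)"
    using D Suc.prems(2) by auto
  have "charge_step run I UNIV (c k) v = charge_step run I (ball I t i) (c' k) v"
  proof (rule charge_step_near[where s = "t - (D k - k)"])
    show "c k v = c' k v" if "near (t - (D k - k)) v" for v
      using Suc.IH[OF _ _ that] Suc.prems D by simp
    show "near (t - (D k - k) - 3 - ?m) v" using Suc.prems(3) by (simp only: arith)
  qed (use arith in auto)
  then show ?case by (simp add: charge_def)
qed

lemma raised_near_live:
  assumes "\<And>j. j \<le> k \<Longrightarrow> live j" "D (Suc k) \<le> t" "near (t - (D (Suc k) - Suc k)) v"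
  shows "v \<in> raised run I UNIV k \<longleftrightarrow> v \<in> raised run I (ball I t i) k"
proof -
  let ?m = "snd (run (conflict_graph I (ball I t i) (c' k)))"
  have D: "D (Suc k) = D k + ?m + 4" using assms(1) by (intro rounds_Suc_live) simp
  have "4 * k \<le> D k" using assms(1) by (intro rounds_ge) simp
  then have arith: "t - (D (Suc k) - Suc k) \<le> t - (D k - k) - 2 - ?m" "4 \<le> t - (D k - k)"
    "?m + 3 \<le> t - (D k - k)"
    using D assms(2) by auto
  show ?thesis unfolding raised_def
  proof (rule raise_near[where s = "t - (D k - k)"])
    show "c k v = c' k v" if "near (t - (D k - k)) v" for v
      using charge_near[OF _ _ that] assms(1,2) D by simp
    show "near (t - (D k - k) - 2 - ?m) v" using assms(3) arith(1) by (rule near_mono)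
  qed (use arith in auto)
qed

lemma rounds_diff_mono:
  assumes "\<And>j. j < k \<Longrightarrow> live j" "j \<le> k"
  shows "D j - j \<le> D k - k" "D j \<le> D k"
proof -
  have "D j - j \<le> D k - k \<and> D j \<le> D k \<and> k \<le> D k"
    using assms
  proof (induction k)
    case (Suc k)
    show ?case
    proof (cases "j = Suc k")
      case True
      then show ?thesis using rounds_ge[of "Suc k"] Suc.prems(1) by simp
    next
      case False
      then have "D j - j \<le> D k - k" "D j \<le> D k" "k \<le> D k" using Suc by simp_all
      moreover have "D k + 4 \<le> D (Suc k)" using rounds_Suc_live[of k] Suc.prems(1) by simp
      ultimately show ?thesis by linarith
    qed
  qed simp
  then show "D j - j \<le> D k - k" "D j \<le> D k" by auto
qed

text \<open>Whether \<open>v\<close> fits depends only on chosen vertices that equal or conflict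
  with \<open>v\<close>, so each step of the second phase costs one hop.\<close>

lemma compatible_near:
  assumes v: "valid I B v" "near r v"
    and S: "\<And>u. u \<in> S \<Longrightarrow> valid I B' u" "\<And>u. u \<in> S' \<Longrightarrow> valid I B'' u"
    and eq: "\<And>u. near (Suc r) u \<Longrightarrow> u \<in> S \<longleftrightarrow> u \<in> S'"
  shows "compatible I S v \<longleftrightarrow> compatible I S' v"
proof -
  have iff: "u \<in> S \<longleftrightarrow> u \<in> S'" if "u = v \<or> conflict I v u" for u
  proof (cases "valid I B' u \<or> valid I B'' u")
    case True
    then have "near (Suc r) u"
      using that near_conflict[OF v(2) v(1)] near_mono[OF v(2)] by auto
    then show ?thesis by (rule eq)
  next
    case False
    then show ?thesis using S by blast
  qed
  have "load I S (res_of I v) (wide I v) e = load I S' (res_of I v) (wide I v) e" if e: "covers I v e" for e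
    unfolding load_def
  proof (rule sum.cong[OF refl])
    fix u
    have "u \<in> S \<longleftrightarrow> u \<in> S'" if "res_of I u = res_of I v" "wide I u = wide I v" "covers I u e"
    proof (rule iff)
      have "overlap I v u"
        using that e by (simp add: overlap_def covers_def)
      then show "u = v \<or> conflict I v u" by (auto simp: conflict_def)
    qed
    then show "(if u \<in> S \<and> res_of I u = res_of I v \<and> wide I u = wide I v \<and> covers I u e then height_of I u else 0) =
      (if u \<in> S' \<and> res_of I u = res_of I v \<and> wide I u = wide I v \<and> covers I u e then height_of I u else 0)"
      by auto
  qed
  moreover have "u \<in> S \<longleftrightarrow> u \<in> S'" if "proc_of I u = proc_of I v" for u
    by (rule iff) (use that in \<open>auto simp: conflict_def\<close>)
  ultimately have "(\<forall>u<N. u \<in> S \<longrightarrow> proc_of I u \<noteq> proc_of I v) \<longleftrightarrow> (\<forall>u<N. u \<in> S' \<longrightarrow> proc_of I u \<noteq> proc_of I v)"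
    "\<And>e. covers I v e \<longrightarrow> load I S (res_of I v) (wide I v) e + height_of I v \<le> 1 \<longleftrightarrow>
      covers I v e \<longrightarrow> load I S' (res_of I v) (wide I v) e + height_of I v \<le> 1"
    by auto
  then show ?thesis unfolding compatible_def by simp
qed

lemma chosen_rec:
  assumes "k < K"
  shows "chosen mis I B K (K - k) = chosen mis I B K (K - Suc k) \<union>
    {v \<in> raised mis I B k. compatible I (chosen mis I B K (K - Suc k)) v}"
proof -
  have "K - k = Suc (K - Suc k)" "K - Suc (K - Suc k) = k" using assms by auto
  then show ?thesis by simp
qed

context
  fixes d :: nat
  assumes dead: "\<not> live d" and alive: "\<And>j. j < d \<Longrightarrow> live j" and D: "D d < t"
begin

text \<open>From step \<open>d\<close> on the run in the ball raises nothing. A vertex raised later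
  in the full run would be unsatisfied there at step \<open>d\<close>; close to the centre both
  charges agree at that time, so it would be unsatisfied in the ball as well.\<close>

lemma raised_near:
  assumes "near (t - (D d - d)) v"
  shows "v \<in> raised run I UNIV k \<longleftrightarrow> v \<in> raised run I (ball I t i) k"
proof (cases "k < d")
  case True
  have "D (Suc k) - Suc k \<le> D d - d" "D (Suc k) \<le> D d"
    using rounds_diff_mono[of d "Suc k"] alive True by auto
  then have "near (t - (D (Suc k) - Suc k)) v" "D (Suc k) \<le> t"
    using near_mono[OF assms] D by auto
  then show ?thesis using raised_near_live[of k v] alive True by simp
next
  case False
  have "v \<notin> raised run I (ball I t i) k"
  proof
    assume "v \<in> raised run I (ball I t i) k"
    then have "live k"
      using known.raised_unsat unfolding live_def by (auto simp: unsat_def dest: valid_less)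
    then show False using dead live_antimono[of k d] False by simp
  qed
  moreover have "v \<notin> raised run I UNIV k"
  proof
    assume "v \<in> raised run I UNIV k"
    then have v: "unsat I UNIV (c d) v"
      using full.raised_unsat full.unsat_antimono False by (metis not_less)
    have "c d v = c' d v" by (rule charge_near) (use alive D assms in auto)
    moreover have "valid I (ball I t i) v" using valid_near[OF assms] v by (simp add: unsat_def)
    ultimately have "unsat I (ball I t i) (c' d) v" using v by (simp add: unsat_def)
    then show False using dead unfolding live_def by (auto simp: unsat_def dest: valid_less)
  qed
  ultimately show ?thesis by simp
qed

text \<open>The two runs may have different numbers \<open>K\<close> and \<open>K'\<close> of steps,
  so they are aligned by the index \<open>k\<close> of the step reached. Steps from \<open>d\<close>
  on choose nothing near the centre and are passed without loss; the first \<open>d\<close> steps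
  use up the \<open>d\<close> hops in reserve.\<close>

lemma chosen_near:
  assumes "d \<le> K" "d \<le> K'" "near (t - (D d - d) - (d - k)) v"
  shows "v \<in> chosen run I UNIV K (K - k) \<longleftrightarrow> v \<in> chosen run I (ball I t i) K' (K' - k)"
proof -
  define Z where "Z = t - (D d - d)"
  have "4 * d \<le> D d" using alive by (rule rounds_ge)
  then have Z: "d < Z" using D by (simp add: Z_def)
  \<comment> \<open>\<open>e\<close> is the distance from the later of the two ends, where both sets
    are still empty; the induction walks towards smaller \<open>k\<close>.\<close>
  have "near (Z - (d - k)) v \<Longrightarrow>
    v \<in> chosen run I UNIV K (K - k) \<longleftrightarrow> v \<in> chosen run I (ball I t i) K' (K' - k)"
    if "k + e = max K K'" for e k v
    using that
  proof (induction e arbitrary: k v)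
    case 0
    then have "K - k = 0" "K' - k = 0" by auto
    then show ?case by simp
  next
    case (Suc e)
    have IH: "u \<in> chosen run I UNIV K (K - Suc k) \<longleftrightarrow> u \<in> chosen run I (ball I t i) K' (K' - Suc k)"
      if "near (Z - (d - Suc k)) u" for u
      using Suc.IH[of "Suc k" u] Suc.prems(2) that by simp
    have v: "near (Z - (d - Suc k)) v" "near Z v"
      using Suc.prems(1) by (auto elim!: near_mono)
    have ra: "v \<in> raised run I UNIV k \<longleftrightarrow> v \<in> raised run I (ball I t i) k"
      using raised_near v(2) by (simp add: Z_def)
    show ?case
    proof (cases "k < d")
      case True
      have r: "Suc (Z - (d - k)) = Z - (d - Suc k)" using Z True by simp
      have "compatible I (chosen run I UNIV K (K - Suc k)) v \<longleftrightarrow>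
        compatible I (chosen run I (ball I t i) K' (K' - Suc k)) v" if "v \<in> raised run I UNIV k"
        by (rule compatible_near[OF raised_valid[OF that] Suc.prems(1) chosen_valid
          chosen_valid IH[folded r]])
      then show ?thesis
        using chosen_rec[of k K run UNIV] chosen_rec[of k K' run "ball I t i"] True assms(1,2) IH[OF v(1)] ra
        by auto
    next
      case False
      have "v \<notin> raised run I (ball I t i) k"
      proof
        assume "v \<in> raised run I (ball I t i) k"
        then have "live k"
          using known.raised_unsat unfolding live_def by (auto simp: unsat_def dest: valid_less)
        then show False using dead live_antimono[of k d] False by simp
      qed
      then have "v \<in> chosen run I UNIV K (K - k) \<longleftrightarrow> v \<in> chosen run I UNIV K (K - Suc k)"
        "v \<in> chosen run I (ball I t i) K' (K' - k) \<longleftrightarrow> v \<in> chosen run I (ball I t i) K' (K' - Suc k)"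
        using ra chosen_rec[of k K run UNIV] chosen_rec[of k K' run "ball I t i"]
        by (cases "k < K"; cases "k < K'"; auto)+
      then show ?thesis using IH[OF v(1)] by simp
    qed
  qed
  from this[of k "max K K' - k" v] show ?thesis
  proof (cases "k \<le> max K K'")
    case False
    then have "K - k = 0" "K' - k = 0" by auto
    then show ?thesis by simp
  qed (use assms(3) in \<open>simp add: Z_def\<close>)
qed

text \<open>The second phase leaves a radius of \<open>t - D d\<close>, which is at least 1. This
  last hop suffices for the class profits on a resource of \<open>i\<close>, since all processors
  that can use the resource are linked to \<open>i\<close>.\<close>

lemma better_class_near:
  assumes "d \<le> K" "d \<le> K'" "proc_of I v = i"
  shows "v \<in> better_class I (chosen run I UNIV K K) \<longleftrightarrow>
    v \<in> better_class I (chosen run I (ball I t i) K' K')"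
proof -
  let ?S = "chosen run I UNIV K K" and ?S' = "chosen run I (ball I t i) K' K'"
  have "4 * d \<le> D d" using alive by (rule rounds_ge)
  then have Z: "Suc 0 \<le> t - (D d - d) - d" using D by simp
  have eq: "u \<in> ?S \<longleftrightarrow> u \<in> ?S'" if "near (Suc 0) u" for u
    using chosen_near[OF assms(1,2), of 0 u] near_mono[OF that Z] by simp
  have v: "near 0 v" "near (Suc 0) v" by (simp_all add: near_def assms(3) ball_self)
  show ?thesis
  proof (cases "valid I UNIV v")
    case True
    have "class_profit I ?S (res_of I v) w = class_profit I ?S' (res_of I v) w" for w
      unfolding class_profit_def
    proof (rule sum.cong[OF refl])
      fix u
      have "u \<in> ?S \<longleftrightarrow> u \<in> ?S'" if r: "res_of I u = res_of I v"
      proof (cases "valid I UNIV u")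
        case u: True
        have "proc_of I u = i \<or> linked I i (proc_of I u)"
          using True u r assms(3) unfolding linked_def valid_def by auto
        then have "near (Suc 0) u"
          using ball_linked[of i I 0 i "proc_of I u"] vertices_proc_of[OF valid_less[OF u]]
          by (auto simp: near_def ball_self)
        then show ?thesis by (rule eq)
      next
        case False
        then show ?thesis using chosen_valid valid_UNIV by blast
      qed
      then show "(if u \<in> ?S \<and> res_of I u = res_of I v \<and> wide I u = w then profit_of I u else 0) =
        (if u \<in> ?S' \<and> res_of I u = res_of I v \<and> wide I u = w then profit_of I u else 0)"
        by auto
    qed
    then show ?thesis using eq[OF v(2)] by (simp add: better_class_def)
  next
    case False
    then have "v \<notin> ?S" "v \<notin> ?S'"
      using chosen_valid valid_UNIV by blast+
    then show ?thesis by (simp add: better_class_def)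
  qed
qed

end

text \<open>While some vertex is not satisfied, every step takes more than one round, so that a run of at
  least \<open>t\<close> steps in less than \<open>t\<close> rounds is complete.\<close>

lemma local_output:
  assumes "D t < t" "full.step_bound \<le> K" "proc_of I v = i"
  shows "v \<in> better_class I (chosen run I UNIV K K) \<longleftrightarrow>
    v \<in> better_class I (chosen run I (ball I t i) t t)"
proof -
  have "\<exists>k. \<not> live k"
    using known.all_satisfied[of known.step_bound] unfolding live_def by auto
  define d where "d = (LEAST k. \<not> live k)"
  have dead: "\<not> live d" unfolding d_def using \<open>\<exists>k. \<not> live k\<close> by (rule LeastI_ex)
  have alive: "live j" if "j < d" for j
    using not_less_Least[of j "\<lambda>k. \<not> live k"] that by (auto simp: d_def)
  have "d < t"
  proof (rule ccontr)
    assume "\<not> d < t"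
    then have "4 * t \<le> D t" using alive by (intro rounds_ge) auto
    then show False using assms(1) by simp
  qed
  moreover have "d \<le> K"
  proof -
    \<comment> \<open>\<open>step_bound\<close> depends only on \<open>I\<close> and
      \<open>hmin\<close>, so the bound of the full run also applies to the ball.\<close>
    have "\<not> live K"
      using known.all_satisfied[of K] assms(2)
      unfolding live_def known.step_bound_def full.step_bound_def known.levels_def full.levels_def by auto
    then show ?thesis unfolding d_def by (rule Least_le)
  qed
  moreover have "D d < t"
  proof -
    have "D d \<le> D t" unfolding rounds_def using \<open>d < t\<close> by (intro sum_mono2) auto
    then show ?thesis using assms(1) by simp
  qed
  ultimately show ?thesis
    using better_class_near[OF dead alive _ _ _ assms(3), of K t] by simp
qed

end

subsection \<open>The algorithm as a program\<close>

text \<open>The entry \<open>Empty\<close> marks an unknown processor; this is unambiguous because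
  initial knowledge is a nonempty list.\<close>

definition knowledge_table :: "real \<Rightarrow> real \<Rightarrow> line_network \<Rightarrow> nat set \<Rightarrow> val" where
  "knowledge_table hmin \<epsilon> I B = table (processors I)
     (\<lambda>j. if j \<in> B then knowledge (processor_network hmin \<epsilon> I) j else Empty)"

text \<open>What a program must have at hand to simulate the run in \<open>B\<close>: the
  dimensions, small enough to serve as loop counts, and the collected data.\<close>

definition inst_ctx :: "real \<Rightarrow> real \<Rightarrow> 'x ctx \<Rightarrow> ('x \<Rightarrow> line_network) \<Rightarrow> ('x \<Rightarrow> nat set) \<Rightarrow> bool" where
  "inst_ctx hmin \<epsilon> G I B \<longleftrightarrow> (\<forall>x\<in>inputs G. valid_line_network (I x)) \<and>
     PTc G (\<lambda>x. slots (I x)) \<and> PTc G (\<lambda>x. resources (I x)) \<and> PTc G (\<lambda>x. processors (I x)) \<and>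
     PT G (\<lambda>x. knowledge_table hmin \<epsilon> (I x) (B x))"

lemma inst_ctxD:
  assumes "inst_ctx hmin \<epsilon> G I B"
  shows "\<And>x. x \<in> inputs G \<Longrightarrow> valid_line_network (I x)"
    "PTc G (\<lambda>x. slots (I x))" "PTc G (\<lambda>x. resources (I x))" "PTc G (\<lambda>x. processors (I x))"
    "PT G (\<lambda>x. knowledge_table hmin \<epsilon> (I x) (B x))"
  using assms unfolding inst_ctx_def by auto

lemma inst_ctx_restrict: "inst_ctx hmin \<epsilon> G I B \<Longrightarrow> inst_ctx hmin \<epsilon> (restrict_ctx G P) I B"
  by (simp add: inst_ctx_def PT_restrict PTc_restrict)

lemma inst_ctx_iter:
  "inst_ctx hmin \<epsilon> G I B \<Longrightarrow> inst_ctx hmin \<epsilon> (iter_ctx G n) (\<lambda>z. I (fst z)) (\<lambda>z. B (fst z))"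
  unfolding inst_ctx_def
  by (auto intro: PT_iter_outer[where F = "\<lambda>x. knowledge_table hmin \<epsilon> (I x) (B x)"]
      PTc_iter_outer[where f = "\<lambda>x. slots (I x)"] PTc_iter_outer[where f = "\<lambda>x. resources (I x)"]
      PTc_iter_outer[where f = "\<lambda>x. processors (I x)"])

lemma inst_ctx_loop:
  "inst_ctx hmin \<epsilon> G I B \<Longrightarrow> inst_ctx hmin \<epsilon> (loop_ctx G n st) (\<lambda>z. I (fst z)) (\<lambda>z. B (fst z))"
  unfolding inst_ctx_def
  by (auto intro: PT_loop_outer[where F = "\<lambda>x. knowledge_table hmin \<epsilon> (I x) (B x)"]
      PTc_loop_outer[where f = "\<lambda>x. slots (I x)"] PTc_loop_outer[where f = "\<lambda>x. resources (I x)"]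
      PTc_loop_outer[where f = "\<lambda>x. processors (I x)"])

lemma PTc_length:
  assumes "PT G F"
  shows "PTc G (\<lambda>x. length (elems (F x)))"
proof -
  define st :: "'a \<Rightarrow> nat \<Rightarrow> val" where "st = (\<lambda>x k. Num (real k))"
  have "PT (foreach_ctx G (\<lambda>x. elems (F x)) st) (\<lambda>z. st (fst z) (snd z))"
    by (intro PT_foreach_acc poly_bounded_mono[OF poly_bounded_const[of _ 1]]) (simp add: st_def)
  then have "PTr (foreach_ctx G (\<lambda>x. elems (F x)) st) (\<lambda>z. num_of (st (fst z) (snd z)) + 1)"
    by (intro PTr_add PTr_num_of PTr_1)
  then have "PT (foreach_ctx G (\<lambda>x. elems (F x)) st) (\<lambda>z. st (fst z) (Suc (snd z)))"
    by (simp add: st_def PTr_def add.commute)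
  then have "PT G (\<lambda>x. st x (length (elems (F x))))"
    by (rule PT_foreach[OF assms, of st, rotated]) (use PT_nat_const[of G 0] in \<open>simp add: st_def\<close>)
  then have "PTn G (\<lambda>x. length (elems (F x)))" by (simp add: st_def PTn_def PTr_def)
  moreover have "poly_bounded G (\<lambda>x. length (elems (F x)))"
    using length_elems_less_vsize by (intro poly_bounded_mono[OF PT_vsize[OF assms]]) (simp add: less_imp_le)
  ultimately show ?thesis by (simp add: PTc_def)
qed

context
  fixes hmin \<epsilon> :: real and G :: "'x ctx" and I :: "'x \<Rightarrow> line_network" and B :: "'x \<Rightarrow> nat set"
  assumes ic: "inst_ctx hmin \<epsilon> G I B"
begin

lemma PTc_vertices: "PTc G (\<lambda>x. vertices (I x))"
  unfolding vertices_def by (intro PTc_mult inst_ctxD[OF ic])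

context
  fixes j :: "'x \<Rightarrow> nat"
  assumes j: "PTn G j" and j_less: "\<And>x. x \<in> inputs G \<Longrightarrow> j x < processors (I x)"
begin

lemma PT_entry: "PT G (\<lambda>x. if j x \<in> B x then knowledge (processor_network hmin \<epsilon> (I x)) (j x) else Empty)"
  by (rule PT_table_nth[OF _ j j_less]) (use inst_ctxD(5)[OF ic] in \<open>auto simp: knowledge_table_def\<close>)

lemma PTb_known: "PTb G (\<lambda>x. j x \<in> B x)"
  by (rule PTb_cong[OF PTb_not[OF PTb_is_Empty[OF PT_entry]]]) (auto simp: processor_network_def)

lemma PT_field:
  assumes "\<And>x. x \<in> inputs G \<Longrightarrow> j x \<in> B x" "k < 12"
  shows "PT G (\<lambda>x. elems (knowledge (processor_network hmin \<epsilon> (I x)) (j x)) ! k)"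
proof (rule PT_nth[OF _ PTn_const])
  show "PT G (\<lambda>x. knowledge (processor_network hmin \<epsilon> (I x)) (j x))"
    by (rule PT_cong[OF PT_entry]) (simp add: assms)
  have "length (elems (knowledge (processor_network hmin \<epsilon> (I x)) (j x))) = 12" for x
    by (simp add: processor_network_def)
  then show "k < length (elems (knowledge (processor_network hmin \<epsilon> (I x)) (j x)))" for x
    using assms(2) by simp
qed

lemma PT_fields:
  assumes "\<And>x. x \<in> inputs G \<Longrightarrow> j x \<in> B x"
  shows "PTn G (\<lambda>x. release (demand_of (I x) (j x)))" "PTn G (\<lambda>x. deadline (demand_of (I x) (j x)))"
    "PTn G (\<lambda>x. proc_time (demand_of (I x) (j x)))" "PTr G (\<lambda>x. profit (demand_of (I x) (j x)))"
    "PTr G (\<lambda>x. height (demand_of (I x) (j x)))"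
    "PT G (\<lambda>x. val_of_list (map (\<lambda>T. Num (real T)) (sorted_list_of_set (acc (I x) (j x)))))"
  using PT_field[OF assms, of 6] PT_field[OF assms, of 7] PT_field[OF assms, of 8] PT_field[OF assms, of 9]
    PT_field[OF assms, of 10] PT_field[OF assms, of 11]
  by (simp_all add: PTn_def PTr_def processor_network_def eval_nat_numeral)

lemma PTb_accessible:
  assumes "\<And>x. x \<in> inputs G \<Longrightarrow> j x \<in> B x" and T: "PTn G T"
  shows "PTb G (\<lambda>x. T x \<in> acc (I x) (j x))"
proof -
  let ?l = "\<lambda>x. map (\<lambda>T. Num (real T)) (sorted_list_of_set (acc (I x) (j x)))"
  note l = PT_fields(6)[OF assms(1)]
  have "PTb G (\<lambda>x. \<exists>k<length (elems (val_of_list (?l x))). num_of (elems (val_of_list (?l x)) ! k) = real (T x))"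
    by (intro PTb_ex PTc_length l PTb_eq PTr_num_of PT_nth PT_iter_outer PTn_iter_index PTr_iter_outer PTr_of_nat T)
      auto
  then show ?thesis
  proof (rule PTb_cong)
    fix x assume x: "x \<in> inputs G"
    have "acc (I x) (j x) \<subseteq> {..<resources (I x)}"
      using inst_ctxD(1)[OF ic x] j_less[OF x] by (auto simp: valid_line_network_def)
    then have fin: "finite (acc (I x) (j x))" by (rule finite_subset) simp
    have "(\<exists>k<length (?l x). num_of (?l x ! k) = real (T x)) \<longleftrightarrow> T x \<in> set (sorted_list_of_set (acc (I x) (j x)))"
      by (auto simp: in_set_conv_nth)
    then show "(\<exists>k<length (elems (val_of_list (?l x))). num_of (elems (val_of_list (?l x)) ! k) = real (T x)) =
      (T x \<in> acc (I x) (j x))"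
      using fin by simp
  qed
qed

end

context
  fixes u :: "'x \<Rightarrow> nat"
  assumes u: "PTc G u"
begin

lemma PTn_vertex:
  "PTn G (\<lambda>x. proc_of (I x) (u x))" "PTn G (\<lambda>x. res_of (I x) (u x))" "PTn G (\<lambda>x. start_of (I x) (u x))"
proof -
  have div: "PTc G (\<lambda>x. u x div slots (I x))"
    by (rule PTc_le[OF PTn_div[OF u PTc_PTn[OF inst_ctxD(2)[OF ic]]] u]) simp
  show "PTn G (\<lambda>x. proc_of (I x) (u x))"
    unfolding proc_of_def by (intro PTn_div[OF u] PTn_mult PTc_PTn inst_ctxD[OF ic])
  show "PTn G (\<lambda>x. res_of (I x) (u x))"
    unfolding res_of_def by (intro PTn_mod div PTc_PTn inst_ctxD[OF ic])
  show "PTn G (\<lambda>x. start_of (I x) (u x))"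
    unfolding start_of_def by (intro PTn_Suc PTn_mod u PTc_PTn inst_ctxD[OF ic])
qed

end

lemma PT_vertex_known:
  assumes u: "PTc G u" and val: "\<And>x. x \<in> inputs G \<Longrightarrow> u x < vertices (I x) \<and> proc_of (I x) (u x) \<in> B x"
  shows "PTn G (\<lambda>x. len_of (I x) (u x))" "PTr G (\<lambda>x. profit_of (I x) (u x))" "PTr G (\<lambda>x. height_of (I x) (u x))"
    "PTb G (\<lambda>x. wide (I x) (u x))"
proof -
  have less: "\<And>x. x \<in> inputs G \<Longrightarrow> proc_of (I x) (u x) < processors (I x)"
    using val vertices_proc_of by blast
  show "PTn G (\<lambda>x. len_of (I x) (u x))" "PTr G (\<lambda>x. profit_of (I x) (u x))" "PTr G (\<lambda>x. height_of (I x) (u x))"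
    unfolding len_of_def profit_of_def height_of_def
    by (intro PT_fields[OF PTn_vertex(1)[OF u] less]; use val in blast)+
  then show "PTb G (\<lambda>x. wide (I x) (u x))"
    unfolding wide_def by (intro PTb_less PTr_divide PTr_1 PTr_numeral)
qed

end

text \<open>The conjunction is evaluated from left to right: the range of the vertex is checked
  first, then that its processor is known, and only then are the fields of the demand read.\<close>

lemma PTb_valid:
  assumes ic: "inst_ctx hmin \<epsilon> G I B" and u: "PTc G u"
  shows "PTb G (\<lambda>x. valid (I x) (B x) (u x))"
  unfolding valid_def
proof (rule PTb_conj, goal_cases)
  case 1
  show ?case by (intro PTb_nat_less PTc_PTn u PTc_vertices[OF ic])
next
  case 2
  let ?P = "\<lambda>x. u x < vertices (I x)"
  let ?G = "restrict_ctx G ?P"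
  have ic1: "inst_ctx hmin \<epsilon> ?G I B" by (rule inst_ctx_restrict[OF ic])
  have u1: "PTc ?G u" by (rule PTc_restrict[OF u])
  show ?case
  proof (rule PTb_conj, goal_cases)
    case 1
    show ?case by (rule PTb_known[OF ic1 PTn_vertex(1)[OF ic1 u1]]) (simp add: vertices_proc_of)
  next
    case 2
    let ?Q = "\<lambda>x. proc_of (I x) (u x) \<in> B x"
    have ic2: "inst_ctx hmin \<epsilon> (restrict_ctx ?G ?Q) I B" by (rule inst_ctx_restrict[OF ic1])
    have u2: "PTc (restrict_ctx ?G ?Q) u" by (rule PTc_restrict[OF u1])
    show ?case
    proof (rule PTb_conj, goal_cases)
      case 1
      show ?case by (rule PTb_accessible[OF ic2 PTn_vertex(1)[OF ic2 u2] _ _ PTn_vertex(2)[OF ic2 u2]])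
        (auto simp: vertices_proc_of)
    next
      case 2
      show ?case
      proof (rule PTb_restrict, rule PTb_conj, goal_cases)
        case 1
        show ?case
          by (intro PTb_nat_le PTn_vertex[OF ic2 u2] PT_fields[OF ic2 PTn_vertex(1)[OF ic2 u2]])
            (auto simp: vertices_proc_of)
      next
        case 2
        show ?case
          by (intro PTb_restrict PTb_nat_le PTn_add PTn_Suc PTn_vertex[OF ic2 u2] PT_vertex_known[OF ic2 u2]
            PT_fields[OF ic2 PTn_vertex(1)[OF ic2 u2]]) (auto simp: vertices_proc_of)
      qed
    qed
  qed
qed

lemma valid_known: "valid I B v \<Longrightarrow> v < vertices I \<and> proc_of I v \<in> B"
  by (simp add: valid_def)

lemma PTn_len_scale:
  assumes ic: "inst_ctx hmin \<epsilon> G I B"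
    and u: "PTc G u" and u_val: "\<And>x. x \<in> inputs G \<Longrightarrow> valid (I x) (B x) (u x)"
  shows "PTn G (\<lambda>x. len_scale (I x) (u x))"
proof -
  have len: "PTn G (\<lambda>x. len_of (I x) (u x))"
    by (rule PT_vertex_known(1)[OF ic u valid_known[OF u_val]])
  let ?f = "\<lambda>x y. if 2 * y \<le> len_of (I x) (u x) then 2 * y else y"
  define st where "st = (\<lambda>x k. Num (real ((?f x ^^ k) 1)))"
  let ?H = "loop_ctx G (\<lambda>x. slots (I x)) st"
  have "PT ?H (\<lambda>z. st (fst z) (snd z))"
    by (intro PT_loop_acc poly_bounded_mono[OF poly_bounded_const[of _ 1]]) (simp add: st_def)
  then have acc: "PTn ?H (\<lambda>z. (?f (fst z) ^^ snd z) 1)"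
    by (simp add: st_def PTn_def PTr_def)
  have "PTn ?H (\<lambda>z. ?f (fst z) ((?f (fst z) ^^ snd z) 1))"
    by (intro PTn_if PTb_nat_le PTn_restrict PTn_mult PTn_const acc PTn_loop_outer[OF len])
  then have "PT ?H (\<lambda>z. st (fst z) (Suc (snd z)))"
    unfolding PTn_def PTr_def by (rule PT_cong) (simp add: st_def)
  then have "PT G (\<lambda>x. st x (slots (I x)))"
    by (rule PT_loop[OF inst_ctxD(2)[OF ic], rotated]) (use PT_nat_const[of G 1] in \<open>simp add: st_def\<close>)
  then show ?thesis by (simp add: st_def PTn_def PTr_def len_scale_def)
qed

context
  fixes hmin \<epsilon> :: real and G :: "'x ctx" and I :: "'x \<Rightarrow> line_network" and B :: "'x \<Rightarrow> nat set"
    and u v :: "'x \<Rightarrow> nat"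
  assumes ic: "inst_ctx hmin \<epsilon> G I B"
    and u: "PTc G u" and u_val: "\<And>x. x \<in> inputs G \<Longrightarrow> valid (I x) (B x) (u x)"
    and v: "PTc G v" and v_val: "\<And>x. x \<in> inputs G \<Longrightarrow> valid (I x) (B x) (v x)"
begin

lemmas PT_u = PTn_vertex[OF ic u] PT_vertex_known[OF ic u valid_known[OF u_val]]
lemmas PT_v = PTn_vertex[OF ic v] PT_vertex_known[OF ic v valid_known[OF v_val]]

lemma PTb_overlap: "PTb G (\<lambda>x. overlap (I x) (u x) (v x))"
  unfolding overlap_def
  by (intro PTb_conj PTb_restrict PTb_nat_eq PTb_nat_less PTb_iff PTn_add PT_u PT_v)

lemma PTb_conflict: "PTb G (\<lambda>x. conflict (I x) (u x) (v x))"
  unfolding conflict_def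
  by (intro PTb_conj PTb_disj PTb_restrict PTb_not PTb_nat_eq PTb_overlap PT_u PT_v PTc_PTn u v)

lemma PTr_weight: "PTr G (\<lambda>x. weight (I x) (u x) (v x))"
  unfolding weight_def
  by (intro PTr_if PTb_conj PTr_restrict PTb_restrict PTb_nat_eq PTb_nat_le PTr_0 PTr_1 PTr_numeral PTr_mult
      PTb_overlap PTn_len_scale[OF ic u u_val] PTn_len_scale[OF ic v v_val]
      PTn_vertex[OF ic u] PTn_vertex[OF ic v] PT_vertex_known[OF ic v valid_known[OF v_val]])

lemma PTb_blocks: "PTb G (\<lambda>x. blocks (I x) (u x) (v x))"
  unfolding blocks_def
  by (intro PTb_disj PTb_conj PTb_restrict PTb_nat_eq PTb_nat_less PTb_le PTr_mult PTr_numeral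
      PTn_len_scale[OF ic u u_val] PTn_len_scale[OF ic v v_val]
      PT_vertex_known[OF ic u valid_known[OF u_val]] PT_vertex_known[OF ic v valid_known[OF v_val]])

end

lemma PTb_unsat:
  assumes ic: "inst_ctx hmin \<epsilon> G I B" and l: "PT G (\<lambda>x. table (vertices (I x)) (\<lambda>v. Num (l x v)))"
    and v: "PTc G v"
  shows "PTb G (\<lambda>x. unsat (I x) (B x) (l x) (v x))"
  unfolding unsat_def
proof (rule PTb_conj)
  let ?G = "restrict_ctx G (\<lambda>x. valid (I x) (B x) (v x))"
  show "PTb ?G (\<lambda>x. l x (v x) < 2 / 3 * profit_of (I x) (v x))"
    by (intro PTb_less PTr_mult PTr_divide PTr_numeral PTr_table_nth[OF PT_restrict[OF l]] PTc_PTn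
      PTc_restrict[OF v] PT_vertex_known(2)[OF inst_ctx_restrict[OF ic] PTc_restrict[OF v]])
      (auto simp: valid_def)
qed (rule PTb_valid[OF ic v])

lemma PTb_active:
  assumes ic: "inst_ctx hmin \<epsilon> G I B" and l: "PT G (\<lambda>x. table (vertices (I x)) (\<lambda>v. Num (l x v)))"
    and v: "PTc G v"
  shows "PTb G (\<lambda>x. active (I x) (B x) (l x) (v x))"
  unfolding active_def
proof (rule PTb_conj)
  let ?G = "restrict_ctx G (\<lambda>x. unsat (I x) (B x) (l x) (v x))"
  let ?H = "iter_ctx ?G (\<lambda>x. vertices (I x))"
  have ic1: "inst_ctx hmin \<epsilon> ?G I B" by (rule inst_ctx_restrict[OF ic])
  have N: "PTc ?G (\<lambda>x. vertices (I x))" by (rule PTc_vertices[OF ic1])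
  have ic2: "inst_ctx hmin \<epsilon> ?H (\<lambda>z. I (fst z)) (\<lambda>z. B (fst z))"
    by (rule inst_ctx_iter[OF ic1])
  have us: "PTb ?H (\<lambda>z. unsat (I (fst z)) (B (fst z)) (l (fst z)) (snd z))"
    by (rule PTb_unsat[OF ic2 PT_iter_outer[OF PT_restrict[OF l]] PTc_iter_index[OF N]])
  let ?H1 = "restrict_ctx ?H (\<lambda>z. unsat (I (fst z)) (B (fst z)) (l (fst z)) (snd z))"
  have ic3: "inst_ctx hmin \<epsilon> ?H1 (\<lambda>z. I (fst z)) (\<lambda>z. B (fst z))"
    by (rule inst_ctx_restrict[OF ic2])
  have idx: "PTc ?H1 snd" "PTc ?H1 (\<lambda>z. v (fst z))"
    by (intro PTc_restrict PTc_iter_index N PTc_iter_outer v)+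
  have cb: "PTb ?H1 (\<lambda>z. conflict (I (fst z)) (snd z) (v (fst z)))"
    "PTb ?H1 (\<lambda>z. blocks (I (fst z)) (snd z) (v (fst z)))"
    by (rule PTb_conflict[OF ic3 idx(1) _ idx(2)] PTb_blocks[OF ic3 idx(1) _ idx(2)]; auto simp: unsat_def)+
  then have "PTb ?H1 (\<lambda>z. conflict (I (fst z)) (snd z) (v (fst z)) \<longrightarrow> \<not> blocks (I (fst z)) (snd z) (v (fst z)))"
    by (rule PTb_imp[OF _ PTb_restrict[OF PTb_not]])
  then have "PTb ?H (\<lambda>z. unsat (I (fst z)) (B (fst z)) (l (fst z)) (snd z) \<longrightarrow>
    conflict (I (fst z)) (snd z) (v (fst z)) \<longrightarrow> \<not> blocks (I (fst z)) (snd z) (v (fst z)))"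
    by (rule PTb_imp[OF us])
  from PTb_all[OF N, of "\<lambda>x u. unsat (I x) (B x) (l x) u \<longrightarrow> conflict (I x) u (v x) \<longrightarrow> \<not> blocks (I x) u (v x)", OF this]
  show "PTb ?G (\<lambda>x. \<forall>u<vertices (I x). unsat (I x) (B x) (l x) u \<and> conflict (I x) u (v x) \<longrightarrow> \<not> blocks (I x) u (v x))"
    by (rule PTb_cong) auto
qed (rule PTb_unsat[OF ic l v])

lemma PTb_conflict_graph:
  assumes ic: "inst_ctx hmin \<epsilon> G I B" and l: "PT G (\<lambda>x. table (vertices (I x)) (\<lambda>v. Num (l x v)))"
    and u: "PTc G u" and v: "PTc G v"
  shows "PTb G (\<lambda>x. conflict_graph (I x) (B x) (l x) (u x) (v x))"
  unfolding conflict_graph_def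
proof (intro PTb_conj PTb_active[OF ic l u] PTb_restrict[OF PTb_active[OF ic l v]], goal_cases)
  case 1
  show ?case
    by (rule PTb_conflict[OF inst_ctx_restrict[OF inst_ctx_restrict[OF ic]] PTc_restrict[OF PTc_restrict[OF u]] _
      PTc_restrict[OF PTc_restrict[OF v]]]) (auto intro: active_valid)
qed

section \<open>Programs for the given algorithm and for one step of the first phase\<close>

lemma poly_bounded_power: "poly_bounded G f \<Longrightarrow> poly_bounded G (\<lambda>x. f x ^ d)"
  by (induction d) (simp_all add: poly_bounded_const poly_bounded_mult)

text \<open>All vertices are advanced in lockstep by one program, whose accumulator holds their
  states, their decisions and the count of rounds. The local time bound of \<open>M\<close> depends
  on the number of vertices and the round only, so the whole simulation is polynomial for polynomial
  \<open>N\<close> and \<open>F\<close>.\<close>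

lemma PT_mis_fuel:
  fixes E :: "'x \<Rightarrow> nat \<Rightarrow> nat \<Rightarrow> bool"
  assumes M: "MIS_algorithm M T" and N: "PTc G N" and F: "PTc G F"
    and graph: "\<And>x. x \<in> inputs G \<Longrightarrow> simple_graph (N x) (E x)"
    and E: "PT G (\<lambda>x. table (N x) (\<lambda>u. table (N x) (\<lambda>v. Num (if E x u v then 1 else 0))))"
  shows "PT G (\<lambda>x. table (N x) (\<lambda>v. Num (if v \<in> fst (mis_fuel M (N x) (F x) (E x)) then 1 else 0)))"
    "PTn G (\<lambda>x. snd (mis_fuel M (N x) (F x) (E x)))"
proof -
  define net where "net x = graph_network (N x, E x)" for x
  have net: "nodes (net x) = N x" "link (net x) = E x"
    "knowledge (net x) = (\<lambda>v. val_of_list [Num (real (N x)), Num (real v)])" for x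
    by (simp_all add: net_def graph_network_def)
  obtain c d where cd: "\<And>x t v. x \<in> inputs G \<Longrightarrow> v < N x \<Longrightarrow> local_cost M (net x) t v \<le> c * (N x + t + 1) ^ d"
    using M graph unfolding MIS_algorithm_def poly_local_time_def net_def by fastforce
  have cost_M: "cost (answer M) [state M (net x) t v] \<le> c * (N x + t + 1) ^ d"
    "cost (message M) [state M (net x) t v] \<le> c * (N x + t + 1) ^ d"
    "cost (update M) [state M (net x) t v, inbox M (net x) (state M (net x) t) v] \<le> c * (N x + t + 1) ^ d"
    if "x \<in> inputs G" "v < N x" for x t v
    using cd[OF that, of t] unfolding local_cost_def by auto
  \<comment> \<open>One bound for costs and sizes in all simulated rounds. The summand 5 is the size
    of an initial state, a list of two numbers, which no expression of \<open>M\<close> has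
    produced.\<close>
  define b where "b x = 5 + c * (N x + F x + 1) ^ d" for x
  have b_mono: "c * (N x + t + 1) ^ d \<le> b x" if "t \<le> F x" for x t
    using power_mono[of "N x + t + 1" "N x + F x + 1" d] that
    unfolding b_def by (simp add: mult_le_mono2 trans_le_add2)
  have b: "poly_bounded G b"
    unfolding b_def using N F by (intro poly_bounded_intros poly_bounded_power) (auto simp: PTc_def)
  have size_state: "vsize (state M (net x) s v) \<le> b x" if "x \<in> inputs G" "v < N x" "s \<le> F x" for x s v
  proof (cases s)
    case 0
    then show ?thesis by (simp add: net b_def)
  next
    case (Suc t)
    have "vsize (state M (net x) s v) \<le> c * (N x + t + 1) ^ d"
      unfolding Suc state.simps using cost_M(3)[OF that(1,2)] vsize_eval_le_cost order_trans by blast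
    also have "\<dots> \<le> b x" using Suc that(3) by (intro b_mono) simp
    finally show ?thesis .
  qed
  have size_dec: "vsize (decision M (net x) v s) \<le> b x" if "x \<in> inputs G" "v < N x" "s \<le> F x" for x s v
    using that(3)
  proof (induction s)
    case 0
    then show ?case by (simp add: b_def)
  next
    case (Suc s)
    have "vsize (answer_at M (net x) s v) \<le> c * (N x + s + 1) ^ d"
      unfolding answer_at_def using cost_M(1)[OF that(1,2)] vsize_eval_le_cost order_trans by blast
    also have "\<dots> \<le> b x" using Suc.prems by (intro b_mono) simp
    finally show ?case using Suc by simp
  qed
  define rest where "rest x s = (\<Sum>s<s. if \<exists>v<N x. decision M (net x) v (Suc s) = Empty then 1 else 0 :: nat)" for x s
  define st where "st x s = Node (table (N x) (state M (net x) s))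
    (Node (table (N x) (\<lambda>v. decision M (net x) v s)) (Num (real (rest x s))))" for x s
  let ?H = "loop_ctx G F st"
  have size_table: "vsize (table n f) \<le> 1 + n + n * k" if "\<And>v. v < n \<Longrightarrow> vsize (f v) \<le> k" for n f k
  proof -
    have "sum_list (map (\<lambda>v. vsize (f v)) [0..<n]) \<le> sum_list (map (\<lambda>_. k) [0..<n])"
      using that by (intro sum_list_mono) auto
    then show ?thesis by (simp add: table_def vsize_val_of_list comp_def sum_list_triv)
  qed
  have "poly_bounded (iter_ctx G F) (\<lambda>z. 3 + 2 * (1 + N (fst z) + N (fst z) * b (fst z)))"
    using PTc_iter_outer[OF N] poly_bounded_comp[OF b, of "iter_ctx G F" fst]
    unfolding PTc_def by (intro poly_bounded_intros) auto
  then have "poly_bounded (iter_ctx G F) (\<lambda>z. vsize (st (fst z) (snd z)))"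
  proof (rule poly_bounded_mono)
    fix z assume "z \<in> inputs (iter_ctx G F)"
    then have "vsize (table (N (fst z)) (state M (net (fst z)) (snd z))) \<le> 1 + N (fst z) + N (fst z) * b (fst z)"
      "vsize (table (N (fst z)) (\<lambda>v. decision M (net (fst z)) v (snd z))) \<le> 1 + N (fst z) + N (fst z) * b (fst z)"
      by (intro size_table size_state size_dec; auto)+
    then show "vsize (st (fst z) (snd z)) \<le> 3 + 2 * (1 + N (fst z) + N (fst z) * b (fst z))"
      by (simp add: st_def)
  qed
  then have "PT ?H (\<lambda>z. st (fst z) (snd z))" by (rule PT_loop_acc)
  then have st: "PT ?H (\<lambda>z. Node (table (N (fst z)) (state M (net (fst z)) (snd z)))
    (Node (table (N (fst z)) (\<lambda>v. decision M (net (fst z)) v (snd z))) (Num (real (rest (fst z) (snd z))))))"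
    by (rule PT_cong) (simp add: st_def)
  have acc: "PT ?H (\<lambda>z. table (N (fst z)) (state M (net (fst z)) (snd z)))"
    "PT ?H (\<lambda>z. table (N (fst z)) (\<lambda>v. decision M (net (fst z)) v (snd z)))"
    "PTn ?H (\<lambda>z. rest (fst z) (snd z))"
    using PT_Node_D[OF st] PT_Node_D[OF PT_Node_D(2)[OF st]] by (simp_all add: PTn_def PTr_def)
  have NH: "PTc ?H (\<lambda>z. N (fst z))" by (rule PTc_loop_outer[OF N])
  let ?V = "iter_ctx ?H (\<lambda>z. N (fst z))"
  have bV: "poly_bounded ?V (\<lambda>z. b (fst (fst z)))"
    using b by (rule poly_bounded_comp) auto
  have state_V: "PT ?V (\<lambda>z. state M (net (fst (fst z))) (snd (fst z)) (snd z))"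
    by (rule PT_table_nth[OF PT_iter_outer[OF acc(1)] PTn_iter_index]) auto
  have answer_V: "PT ?V (\<lambda>z. answer_at M (net (fst (fst z))) (snd (fst z)) (snd z))"
    unfolding answer_at_def
  proof (rule PT_run[OF state_V poly_bounded_mono[OF bV]])
    fix z assume "z \<in> inputs ?V"
    then show "cost (answer M) [state M (net (fst (fst z))) (snd (fst z)) (snd z)] \<le> b (fst (fst z))"
      using cost_M(1)[of "fst (fst z)" "snd z" "snd (fst z)"] b_mono[of "snd (fst z)" "fst (fst z)"]
      by (auto intro: order_trans)
  qed
  have dec_V: "PT ?V (\<lambda>z. decision M (net (fst (fst z))) (snd z) (Suc (snd (fst z))))"
  proof -
    have "PT ?V (\<lambda>z. decision M (net (fst (fst z))) (snd z) (snd (fst z)))"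
      by (rule PT_table_nth[OF PT_iter_outer[OF acc(2)] PTn_iter_index]) auto
    then show ?thesis unfolding decision.simps
      by (intro PT_if PTb_is_Empty PT_restrict answer_V)
  qed
  have update_V: "PT ?V (\<lambda>z. state M (net (fst (fst z))) (Suc (snd (fst z))) (snd z))"
    unfolding state.simps
  proof (rule PT_run2[OF state_V _ poly_bounded_mono[OF bV]])
    fix z assume "z \<in> inputs ?V"
    then show "cost (update M) [state M (net (fst (fst z))) (snd (fst z)) (snd z),
        inbox M (net (fst (fst z))) (state M (net (fst (fst z))) (snd (fst z))) (snd z)] \<le> b (fst (fst z))"
      using cost_M(3)[of "fst (fst z)" "snd z" "snd (fst z)"] b_mono[of "snd (fst z)" "fst (fst z)"]
      by (auto intro: order_trans)
  next
    let ?W = "iter_ctx ?V (\<lambda>z. N (fst (fst z)))"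
    have state_W: "PT ?W (\<lambda>z. state M (net (fst (fst (fst z)))) (snd (fst (fst z))) (snd z))"
      by (rule PT_table_nth[OF PT_iter_outer[OF PT_iter_outer[OF acc(1)]] PTn_iter_index]) auto
    have "PT ?W (\<lambda>z. eval (message M) [state M (net (fst (fst (fst z)))) (snd (fst (fst z))) (snd z)])"
    proof (rule PT_run[OF state_W poly_bounded_mono])
      show "poly_bounded ?W (\<lambda>z. b (fst (fst (fst z))))"
        using b by (rule poly_bounded_comp) auto
      fix z assume "z \<in> inputs ?W"
      then show "cost (message M) [state M (net (fst (fst (fst z)))) (snd (fst (fst z))) (snd z)] \<le> b (fst (fst (fst z)))"
        using cost_M(2)[of "fst (fst (fst z))" "snd z" "snd (fst (fst z))"] b_mono[of "snd (fst (fst z))" "fst (fst (fst z))"]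
        by (auto intro: order_trans)
    qed
    then have msg: "PT ?W (\<lambda>z. Node (Num (real (snd z)))
        (eval (message M) [state M (net (fst (fst (fst z)))) (snd (fst (fst z))) (snd z)]))"
      by (intro PT_Node PT_Num_nat PTn_iter_index)
    have "PT ?W (\<lambda>z. table (N (fst (fst (fst z)))) (\<lambda>v. Num (if E (fst (fst (fst z))) (snd (fst z)) v then 1 else 0)))"
      by (rule PT_table_nth[OF PT_iter_outer[OF PT_iter_outer[OF PT_loop_outer[OF E]]]
        PTn_iter_outer[OF PTn_iter_index]]) auto
    then have "PTb ?W (\<lambda>z. E (fst (fst (fst z))) (snd (fst z)) (snd z))"
      by (rule PTb_table_nth[OF _ PTn_iter_index]) auto
    then show "PT ?V (\<lambda>z. inbox M (net (fst (fst z))) (state M (net (fst (fst z))) (snd (fst z))) (snd z))"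
      unfolding inbox_def net
      by (rule PT_collect[OF PTc_iter_outer[OF NH]]) (rule PT_restrict[OF msg])
  qed
  have "PTn ?H (\<lambda>z. rest (fst z) (Suc (snd z)))"
  proof -
    have "PTb ?H (\<lambda>z. \<exists>v<N (fst z). decision M (net (fst z)) v (Suc (snd z)) = Empty)"
      by (rule PTb_ex[OF NH PTb_is_Empty[OF dec_V]])
    then have "PTn ?H (\<lambda>z. rest (fst z) (snd z) +
      (if \<exists>v<N (fst z). decision M (net (fst z)) v (Suc (snd z)) = Empty then 1 else 0))"
      by (intro PTn_add acc(3) PTn_if PTn_const)
    then show ?thesis by (rule PTn_cong) (simp add: rest_def)
  qed
  then have "PT ?H (\<lambda>z. Node (table (N (fst z)) (state M (net (fst z)) (Suc (snd z))))
    (Node (table (N (fst z)) (\<lambda>v. decision M (net (fst z)) v (Suc (snd z)))) (Num (real (rest (fst z) (Suc (snd z)))))))"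
    by (intro PT_Node PT_Num_nat PT_table[OF NH dec_V] PT_table[OF NH update_V])
  then have "PT ?H (\<lambda>z. st (fst z) (Suc (snd z)))"
    by (rule PT_cong) (simp add: st_def)
  moreover have "PT G (\<lambda>x. st x 0)"
  proof -
    have a: "PT G (\<lambda>x. table (N x) (\<lambda>v. val_of_list [Num (real (N x)), Num (real v)]))"
      unfolding val_of_list.simps
      by (intro PT_table[OF N] PT_Node PT_Num_nat PT_Empty PTn_iter_index PTn_iter_outer[OF PTc_PTn[OF N]])
    have "PT G (\<lambda>x. table (N x) (\<lambda>v. Empty))" by (intro PT_table[OF N] PT_Empty)
    from PT_Node[OF a PT_Node[OF this PT_nat_const[of _ 0]]] show ?thesis
      by (rule PT_cong) (simp add: st_def rest_def net)
  qed
  ultimately have "PT G (\<lambda>x. st x (F x))" by (rule PT_loop[OF F, rotated])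
  from PT_Node_D(2)[OF this[unfolded st_def]]
  have fin: "PT G (\<lambda>x. table (N x) (\<lambda>v. decision M (net x) v (F x)))" "PTn G (\<lambda>x. rest x (F x))"
    unfolding PTn_def PTr_def by (rule PT_Node_D)+
  then show "PTn G (\<lambda>x. snd (mis_fuel M (N x) (F x) (E x)))"
    by (simp add: rest_def mis_fuel_def net_def)
  let ?U = "iter_ctx G N"
  have "PT ?U (\<lambda>z. decision M (net (fst z)) (snd z) (F (fst z)))"
    by (rule PT_table_nth[OF PT_iter_outer[OF fin(1)] PTn_iter_index]) auto
  then have "PTb ?U (\<lambda>z. decision M (net (fst z)) (snd z) (F (fst z)) = Num 1)"
    by (intro PTb_eq_Num PTr_1)
  then have "PTb ?U (\<lambda>z. snd z \<in> fst (mis_fuel M (N (fst z)) (F (fst z)) (E (fst z))))"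
    by (rule PTb_cong) (auto simp: mis_fuel_def net_def)
  then show "PT G (\<lambda>x. table (N x) (\<lambda>v. Num (if v \<in> fst (mis_fuel M (N x) (F x) (E x)) then 1 else 0)))"
    by (intro PT_table[OF N] PT_of_bool)
qed

context
  fixes M :: algorithm and T :: "nat \<Rightarrow> nat" and hmin \<epsilon> :: real and G :: "'x ctx"
    and I :: "'x \<Rightarrow> line_network" and B :: "'x \<Rightarrow> nat set" and F :: "'x \<Rightarrow> nat" and l :: "'x \<Rightarrow> nat \<Rightarrow> real"
  assumes M: "MIS_algorithm M T" and ic: "inst_ctx hmin \<epsilon> G I B" and F: "PTc G F"
    and l: "PT G (\<lambda>x. table (vertices (I x)) (\<lambda>v. Num (l x v)))"
begin

private lemma N: "PTc G (\<lambda>x. vertices (I x))"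
  by (rule PTc_vertices[OF ic])

private lemma ic_iter: "inst_ctx hmin \<epsilon> (iter_ctx G (\<lambda>x. vertices (I x))) (\<lambda>z. I (fst z)) (\<lambda>z. B (fst z))"
  by (rule inst_ctx_iter[OF ic])

lemma PT_graph_table: "PT G (\<lambda>x. table (vertices (I x)) (\<lambda>u. table (vertices (I x))
    (\<lambda>v. Num (if conflict_graph (I x) (B x) (l x) u v then 1 else 0))))"
proof (rule PT_table[OF N], rule PT_table[OF PTc_iter_outer[OF N]], rule PT_of_bool)
  let ?U = "iter_ctx G (\<lambda>x. vertices (I x))"
  show "PTb (iter_ctx ?U (\<lambda>z. vertices (I (fst z))))
    (\<lambda>z. conflict_graph (I (fst (fst z))) (B (fst (fst z))) (l (fst (fst z))) (snd (fst z)) (snd z))"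
    by (rule PTb_conflict_graph[OF inst_ctx_iter[OF ic_iter] PT_iter_outer[OF PT_iter_outer[OF l]]
      PTc_iter_outer[OF PTc_iter_index[OF N]] PTc_iter_index[OF PTc_iter_outer[OF N]]])
qed

abbreviation (input) "solve x \<equiv> mis_fuel M (vertices (I x)) (F x)"

lemmas PT_solve = PT_mis_fuel[OF M N F simple_graph_conflict_graph PT_graph_table]

lemma PT_raise: "PT G (\<lambda>x. table (vertices (I x)) (\<lambda>v. Num (if v \<in> raise (solve x) (I x) (B x) (l x) then 1 else 0)))"
proof (rule PT_table[OF N], rule PT_of_bool)
  let ?U = "iter_ctx G (\<lambda>x. vertices (I x))"
  have "PTb ?U (\<lambda>z. snd z \<in> fst (solve (fst z) (conflict_graph (I (fst z)) (B (fst z)) (l (fst z)))))"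
    by (rule PTb_table_nth[OF PT_iter_outer[OF PT_solve(1)] PTn_iter_index]) auto
  then show "PTb ?U (\<lambda>z. snd z \<in> raise (solve (fst z)) (I (fst z)) (B (fst z)) (l (fst z)))"
    unfolding raise_def mem_Collect_eq
    by (intro PTb_conj PTb_restrict PTb_active[OF ic_iter PT_iter_outer[OF l] PTc_iter_index[OF N]])
qed

lemma PT_charge_step:
  "PT G (\<lambda>x. table (vertices (I x)) (\<lambda>v. Num (charge_step (solve x) (I x) (B x) (l x) v)))"
proof (rule PT_table[OF N], rule PT_Num)
  let ?U = "iter_ctx G (\<lambda>x. vertices (I x))"
  let ?P = "\<lambda>z. valid (I (fst z)) (B (fst z)) (snd z)"
  let ?U1 = "restrict_ctx ?U ?P"
  let ?W = "iter_ctx ?U1 (\<lambda>z. vertices (I (fst z)))"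
  let ?R = "\<lambda>z. snd z \<in> raise (solve (fst (fst z))) (I (fst (fst z))) (B (fst (fst z))) (l (fst (fst z)))"
  let ?W1 = "restrict_ctx ?W ?R"
  have ic1: "inst_ctx hmin \<epsilon> ?U1 (\<lambda>z. I (fst z)) (\<lambda>z. B (fst z))"
    by (rule inst_ctx_restrict[OF ic_iter])
  have N1: "PTc ?U1 (\<lambda>z. vertices (I (fst z)))" by (rule PTc_vertices[OF ic1])
  have ic2: "inst_ctx hmin \<epsilon> ?W1 (\<lambda>z. I (fst (fst z))) (\<lambda>z. B (fst (fst z)))"
    by (rule inst_ctx_restrict[OF inst_ctx_iter[OF ic1]])
  have idx: "PTc ?W1 snd" "PTc ?W1 (\<lambda>z. snd (fst z))"
    by (rule PTc_restrict PTc_iter_index[OF N1] PTc_iter_outer[OF PTc_restrict[OF PTc_iter_index[OF N]]])+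
  have val: "\<And>z. z \<in> inputs ?W1 \<Longrightarrow> valid (I (fst (fst z))) (B (fst (fst z))) (snd z)"
    by (auto simp: raise_def dest: active_valid)
  have R: "PTb ?W ?R"
    by (rule PTb_table_nth[OF PT_iter_outer[OF PT_restrict[OF PT_iter_outer[OF PT_raise]]] PTn_iter_index]) auto
  have l2: "PTr ?W1 (\<lambda>z. l (fst (fst z)) (snd z))"
    by (rule PTr_table_nth[OF PT_restrict[OF PT_iter_outer[OF PT_restrict[OF PT_iter_outer[OF l]]]] PTc_PTn[OF idx(1)]])
      auto
  have "PTr ?W1 (\<lambda>z. weight (I (fst (fst z))) (snd z) (snd (fst z)))"
    by (rule PTr_weight[OF ic2 idx(1) val idx(2)]) auto
  then have "PTr ?W (\<lambda>z. if ?R z then (profit_of (I (fst (fst z))) (snd z) - l (fst (fst z)) (snd z)) *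
      weight (I (fst (fst z))) (snd z) (snd (fst z)) else 0)"
    by (intro PTr_if R PTr_0 PTr_mult PTr_diff l2 PT_vertex_known(2)[OF ic2 idx(1) valid_known[OF val]])
  from PTr_sum[OF N1, of "\<lambda>z u. if u \<in> raise (solve (fst z)) (I (fst z)) (B (fst z)) (l (fst z))
      then (profit_of (I (fst z)) u - l (fst z) u) * weight (I (fst z)) u (snd z) else 0", OF this]
  have sum: "PTr ?U1 (\<lambda>z. \<Sum>u<vertices (I (fst z)). if u \<in> raise (solve (fst z)) (I (fst z)) (B (fst z)) (l (fst z))
      then (profit_of (I (fst z)) u - l (fst z) u) * weight (I (fst z)) u (snd z) else 0)" .
  have l1: "PTr ?U1 (\<lambda>z. l (fst z) (snd z))"
    by (rule PTr_table_nth[OF PT_restrict[OF PT_iter_outer[OF l]] PTn_restrict[OF PTn_iter_index]]) auto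
  show "PTr ?U (\<lambda>z. charge_step (solve (fst z)) (I (fst z)) (B (fst z)) (l (fst z)) (snd z))"
    unfolding charge_step_def
    by (rule PTr_if[OF PTb_valid[OF ic_iter PTc_iter_index[OF N]] PTr_add[OF l1 sum] PTr_0])
qed

lemma PTn_step_rounds: "PTn G (\<lambda>x. step_rounds (solve x) (I x) (B x) (l x))"
  unfolding step_rounds_def
  by (intro PTn_if PTb_ex N PTb_unsat[OF ic_iter PT_iter_outer[OF l] PTc_iter_index[OF N]]
      PTn_add PTn_restrict PTn_const PT_solve(2))

end

section \<open>Programs for loads, the output and the two complete phases\<close>

lemma vsize_num_table: "vsize (table n (\<lambda>v. Num (f v))) = 1 + 2 * n"
  by (simp add: table_def vsize_val_of_list comp_def sum_list_triv)

definition member_table :: "nat \<Rightarrow> nat set \<Rightarrow> val" where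
  "member_table n S = table n (\<lambda>v. Num (if v \<in> S then 1 else 0))"

lemma PTb_member:
  assumes "PT G (\<lambda>x. member_table (n x) (S x))" "PTn G v" "\<And>x. x \<in> inputs G \<Longrightarrow> v x < n x"
  shows "PTb G (\<lambda>x. v x \<in> S x)"
  using assms unfolding member_table_def by (rule PTb_table_nth)

lemma PTb_covers:
  assumes ic: "inst_ctx hmin \<epsilon> G I B"
    and u: "PTc G u" and u_val: "\<And>x. x \<in> inputs G \<Longrightarrow> valid (I x) (B x) (u x)" and e: "PTn G e"
  shows "PTb G (\<lambda>x. covers (I x) (u x) (e x))"
  unfolding covers_def
  by (intro PTb_conj PTb_restrict PTb_nat_le PTb_nat_less PTn_add e PTn_vertex[OF ic u]
      PT_vertex_known[OF ic u valid_known[OF u_val]])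

context
  fixes hmin \<epsilon> :: real and G :: "'x ctx" and I :: "'x \<Rightarrow> line_network" and B S :: "'x \<Rightarrow> nat set"
    and r :: "'x \<Rightarrow> nat" and w :: "'x \<Rightarrow> bool"
  assumes ic: "inst_ctx hmin \<epsilon> G I B"
    and S: "PT G (\<lambda>x. member_table (vertices (I x)) (S x))"
    and S_val: "\<And>x v. x \<in> inputs G \<Longrightarrow> v \<in> S x \<Longrightarrow> valid (I x) (B x) v"
    and r: "PTn G r" and w: "PTb G w"
begin

abbreviation (input) "members \<equiv> restrict_ctx (iter_ctx G (\<lambda>x. vertices (I x))) (\<lambda>z. snd z \<in> S (fst z))"

lemma members:
  "inst_ctx hmin \<epsilon> members (\<lambda>z. I (fst z)) (\<lambda>z. B (fst z))" "PTc members snd"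
  "z \<in> inputs members \<Longrightarrow> valid (I (fst z)) (B (fst z)) (snd z)"
  using S_val by (auto intro: inst_ctx_restrict[OF inst_ctx_iter[OF ic]]
    PTc_restrict[OF PTc_iter_index[OF PTc_vertices[OF ic]]])

lemmas PT_members = PTn_vertex[OF members(1,2)] PT_vertex_known[OF members(1,2) valid_known[OF members(3)]]

text \<open>The common form of \<open>load\<close> and \<open>class_profit\<close>. Membership in
  \<open>S\<close> is tested first, since only then is the vertex valid and its data
  readable.\<close>

lemma PTr_class_sum:
  assumes Q: "PTb members (\<lambda>z. Q (fst z) (snd z))" and f: "PTr members (\<lambda>z. f (fst z) (snd z))"
  shows "PTr G (\<lambda>x. \<Sum>u<vertices (I x).
    if u \<in> S x \<and> res_of (I x) u = r x \<and> (wide (I x) u \<longleftrightarrow> w x) \<and> Q x u then f x u else 0)"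
proof (rule PTr_sum[OF PTc_vertices[OF ic]])
  let ?U = "iter_ctx G (\<lambda>x. vertices (I x))"
  let ?P = "\<lambda>z. res_of (I (fst z)) (snd z) = r (fst z) \<and> (wide (I (fst z)) (snd z) \<longleftrightarrow> w (fst z)) \<and> Q (fst z) (snd z)"
  have "PTb members ?P"
    by (intro PTb_conj PTb_restrict PTb_nat_eq PTb_iff PT_members Q PTn_restrict[OF PTn_iter_outer[OF r]]
      PTb_restrict[OF PTb_iter_outer[OF w]])
  then have P: "PTr members (\<lambda>z. if ?P z then f (fst z) (snd z) else 0)"
    by (rule PTr_if[OF _ PTr_restrict[OF f] PTr_0])
  have "PTb ?U (\<lambda>z. snd z \<in> S (fst z))"
    by (rule PTb_member[OF PT_iter_outer[OF S] PTn_iter_index]) auto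
  from PTr_if[OF this P PTr_0] show "PTr ?U (\<lambda>z. if snd z \<in> S (fst z) \<and> ?P z then f (fst z) (snd z) else 0)"
    by (rule PTr_cong) auto
qed

lemma PTr_class_profit: "PTr G (\<lambda>x. class_profit (I x) (S x) (r x) (w x))"
  using PTr_class_sum[OF PTb_True PT_members(5)] by (simp add: class_profit_def)

lemma PTr_load: "PTn G e \<Longrightarrow> PTr G (\<lambda>x. load (I x) (S x) (r x) (w x) (e x))"
  unfolding load_def
  by (intro PTr_class_sum PTb_covers[OF members(1,2,3)] PTn_restrict[OF PTn_iter_outer] PT_members)

end

lemma PTb_compatible:
  assumes ic: "inst_ctx hmin \<epsilon> G I B"
    and S: "PT G (\<lambda>x. member_table (vertices (I x)) (S x))"
    and S_val: "\<And>x v. x \<in> inputs G \<Longrightarrow> v \<in> S x \<Longrightarrow> valid (I x) (B x) v"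
    and v: "PTc G v" and v_val: "\<And>x. x \<in> inputs G \<Longrightarrow> valid (I x) (B x) (v x)"
  shows "PTb G (\<lambda>x. compatible (I x) (S x) (v x))"
  unfolding compatible_def
proof (intro PTb_conj PTb_restrict, goal_cases)
  case 1
  let ?U = "iter_ctx G (\<lambda>x. vertices (I x))"
  have icU: "inst_ctx hmin \<epsilon> ?U (\<lambda>z. I (fst z)) (\<lambda>z. B (fst z))" by (rule inst_ctx_iter[OF ic])
  have idx: "PTc ?U snd" by (rule PTc_iter_index[OF PTc_vertices[OF ic]])
  have "PTb ?U (\<lambda>z. snd z \<in> S (fst z))"
    by (rule PTb_member[OF PT_iter_outer[OF S] PTn_iter_index]) auto
  moreover have "PTb ?U (\<lambda>z. proc_of (I (fst z)) (snd z) \<noteq> proc_of (I (fst z)) (v (fst z)))"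
    by (intro PTb_not PTb_nat_eq PTn_vertex(1)[OF icU idx] PTn_vertex(1)[OF icU PTc_iter_outer[OF v]])
  ultimately have "PTb ?U (\<lambda>z. snd z \<in> S (fst z) \<longrightarrow> proc_of (I (fst z)) (snd z) \<noteq> proc_of (I (fst z)) (v (fst z)))"
    by (rule PTb_imp[OF _ PTb_restrict])
  then show ?case by (rule PTb_all[OF PTc_vertices[OF ic]])
next
  case 2
  let ?U = "iter_ctx G (\<lambda>x. Suc (slots (I x)))"
  have icU: "inst_ctx hmin \<epsilon> ?U (\<lambda>z. I (fst z)) (\<lambda>z. B (fst z))" by (rule inst_ctx_iter[OF ic])
  have sl: "PTc G (\<lambda>x. Suc (slots (I x)))"
    using PTc_add[OF inst_ctxD(2)[OF ic] PTc_const[of _ 1]] by simp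
  have vU: "PTc ?U (\<lambda>z. v (fst z))" by (rule PTc_iter_outer[OF v])
  have val: "\<And>z. z \<in> inputs ?U \<Longrightarrow> valid (I (fst z)) (B (fst z)) (v (fst z))" using v_val by auto
  have S_valU: "\<And>z u. z \<in> inputs ?U \<Longrightarrow> u \<in> S (fst z) \<Longrightarrow> valid (I (fst z)) (B (fst z)) u"
    using S_val by auto
  note known = PTn_vertex[OF icU vU] PT_vertex_known[OF icU vU valid_known[OF val]]
  have "PTb ?U (\<lambda>z. load (I (fst z)) (S (fst z)) (res_of (I (fst z)) (v (fst z))) (wide (I (fst z)) (v (fst z))) (snd z) +
      height_of (I (fst z)) (v (fst z)) \<le> 1)"
    by (intro PTb_le PTr_add PTr_1 PTr_load[OF icU PT_iter_outer[OF S] S_valU] known PTn_iter_index)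
  with PTb_covers[OF icU vU val PTn_iter_index]
  have "PTb ?U (\<lambda>z. covers (I (fst z)) (v (fst z)) (snd z) \<longrightarrow>
    load (I (fst z)) (S (fst z)) (res_of (I (fst z)) (v (fst z))) (wide (I (fst z)) (v (fst z))) (snd z) +
      height_of (I (fst z)) (v (fst z)) \<le> 1)"
    by (rule PTb_imp[OF _ PTb_restrict])
  then show ?case by (rule PTb_all[OF sl])
qed

lemma PTb_better_class:
  assumes ic: "inst_ctx hmin \<epsilon> G I B"
    and S: "PT G (\<lambda>x. member_table (vertices (I x)) (S x))"
    and S_val: "\<And>x v. x \<in> inputs G \<Longrightarrow> v \<in> S x \<Longrightarrow> valid (I x) (B x) v"
    and v: "PTc G v" and v_less: "\<And>x. x \<in> inputs G \<Longrightarrow> v x < vertices (I x)"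
  shows "PTb G (\<lambda>x. v x \<in> better_class (I x) (S x))"
  unfolding better_class_def mem_Collect_eq
proof (rule PTb_conj)
  show "PTb G (\<lambda>x. v x \<in> S x)" by (rule PTb_member[OF S PTc_PTn[OF v] v_less])
  let ?H = "restrict_ctx G (\<lambda>x. v x \<in> S x)"
  have icH: "inst_ctx hmin \<epsilon> ?H I B" by (rule inst_ctx_restrict[OF ic])
  have vH: "PTc ?H v" by (rule PTc_restrict[OF v])
  have S_valH: "\<And>x u. x \<in> inputs ?H \<Longrightarrow> u \<in> S x \<Longrightarrow> valid (I x) (B x) u" using S_val by auto
  show "PTb ?H (\<lambda>x. wide (I x) (v x) \<longleftrightarrow>
    class_profit (I x) (S x) (res_of (I x) (v x)) False \<le> class_profit (I x) (S x) (res_of (I x) (v x)) True)"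
    by (intro PTb_iff PTb_le PTr_class_profit[OF icH PT_restrict[OF S] S_valH] PTb_True PTb_False
      PTn_vertex[OF icH vH] PT_vertex_known[OF icH vH valid_known[OF S_valH]]) auto
qed

text \<open>Sums serve as a definite description operator for the selected instance of a processor.\<close>

definition selection :: "line_network \<Rightarrow> nat set \<Rightarrow> nat \<Rightarrow> val" where
  "selection I S i =
     (if \<exists>v<vertices I. v \<in> better_class I S \<and> proc_of I v = i
      then Node (Num (real (\<Sum>v<vertices I. if v \<in> better_class I S \<and> proc_of I v = i then res_of I v else 0)))
        (Num (real (\<Sum>v<vertices I. if v \<in> better_class I S \<and> proc_of I v = i then start_of I v else 0)))
      else Num 0)"

lemma PT_selection:
  assumes ic: "inst_ctx hmin \<epsilon> G I B"
    and S: "PT G (\<lambda>x. member_table (vertices (I x)) (S x))"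
    and S_val: "\<And>x v. x \<in> inputs G \<Longrightarrow> v \<in> S x \<Longrightarrow> valid (I x) (B x) v"
    and i: "PTn G i"
  shows "PT G (\<lambda>x. selection (I x) (S x) (i x))"
proof -
  let ?U = "iter_ctx G (\<lambda>x. vertices (I x))"
  have icU: "inst_ctx hmin \<epsilon> ?U (\<lambda>z. I (fst z)) (\<lambda>z. B (fst z))" by (rule inst_ctx_iter[OF ic])
  have N: "PTc G (\<lambda>x. vertices (I x))" by (rule PTc_vertices[OF ic])
  have idx: "PTc ?U snd" by (rule PTc_iter_index[OF N])
  have S_valU: "\<And>z u. z \<in> inputs ?U \<Longrightarrow> u \<in> S (fst z) \<Longrightarrow> valid (I (fst z)) (B (fst z)) u"
    using S_val by auto
  have "PTb ?U (\<lambda>z. snd z \<in> better_class (I (fst z)) (S (fst z)))"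
    by (rule PTb_better_class[OF icU PT_iter_outer[OF S] S_valU idx]) auto
  then have sel: "PTb ?U (\<lambda>z. snd z \<in> better_class (I (fst z)) (S (fst z)) \<and> proc_of (I (fst z)) (snd z) = i (fst z))"
    by (rule PTb_conj[OF _ PTb_restrict[OF PTb_nat_eq[OF PTn_vertex(1)[OF icU idx] PTn_iter_outer[OF i]]]])
  have "PTn G (\<lambda>x. \<Sum>v<vertices (I x). if v \<in> better_class (I x) (S x) \<and> proc_of (I x) v = i x then res_of (I x) v else 0)"
    by (rule PTn_sum[OF N PTn_if[OF sel PTn_restrict[OF PTn_vertex(2)[OF icU idx]] PTn_const]])
  moreover have "PTn G (\<lambda>x. \<Sum>v<vertices (I x). if v \<in> better_class (I x) (S x) \<and> proc_of (I x) v = i x then start_of (I x) v else 0)"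
    by (rule PTn_sum[OF N PTn_if[OF sel PTn_restrict[OF PTn_vertex(3)[OF icU idx]] PTn_const]])
  ultimately show ?thesis
    unfolding selection_def
    by (intro PT_if PTb_ex[OF N sel] PT_Node PT_Num_nat PTn_restrict PT_Num PTr_0)
qed

context
  fixes M :: algorithm and T :: "nat \<Rightarrow> nat" and hmin \<epsilon> :: real and G :: "'x ctx"
    and I :: "'x \<Rightarrow> line_network" and B :: "'x \<Rightarrow> nat set" and t :: "'x \<Rightarrow> nat"
  assumes M: "MIS_algorithm M T" and ic: "inst_ctx hmin \<epsilon> G I B" and t: "PTc G t"
begin

lemma N_t: "PTc G (\<lambda>x. vertices (I x))"
  by (rule PTc_vertices[OF ic])

abbreviation (input) "solve_t x \<equiv> mis_fuel M (vertices (I x)) (Suc (t x))"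
abbreviation (input) "N x \<equiv> vertices (I x)"
abbreviation (input) "charge_t x \<equiv> charge (solve_t x) (I x) (B x)"
abbreviation (input) "raised_t x \<equiv> raised (solve_t x) (I x) (B x)"
abbreviation (input) "rounds_t x \<equiv> rounds (solve_t x) (I x) (B x)"
abbreviation (input) "chosen_t x \<equiv> chosen (solve_t x) (I x) (B x) (t x)"

lemma Ft: "PTc G (\<lambda>x. Suc (t x))"
  using PTc_add[OF t PTc_const[of _ 1]] by simp

text \<open>Prepending the raised sets stores the latest one first, which is the order in which the
  second phase consumes them.\<close>

lemma PT_phase1:
  "PT G (\<lambda>x. val_of_list (map (\<lambda>k. member_table (N x) (raised_t x k)) (rev [0..<t x])))"
  "PTn G (\<lambda>x. rounds_t x (t x))"
proof -
  define st where "st x k = Node (table (N x) (\<lambda>v. Num (charge_t x k v)))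
    (Node (val_of_list (map (\<lambda>k. member_table (N x) (raised_t x k)) (rev [0..<k])))
      (Num (real (rounds_t x k))))" for x k
  let ?H = "loop_ctx G t st"
  have "poly_bounded (iter_ctx G t) (\<lambda>z. 5 + 2 * N (fst z) + (t (fst z) + t (fst z) * (1 + 2 * N (fst z))))"
    using PTc_iter_outer[OF N_t] PTc_iter_outer[OF t] unfolding PTc_def by (intro poly_bounded_intros) auto
  then have "poly_bounded (iter_ctx G t) (\<lambda>z. vsize (st (fst z) (snd z)))"
  proof (rule poly_bounded_mono)
    fix z assume "z \<in> inputs (iter_ctx G t)"
    then have "snd z \<le> t (fst z)" by auto
    then have "snd z + snd z * (1 + 2 * N (fst z)) \<le> t (fst z) + t (fst z) * (1 + 2 * N (fst z))"
      by (intro add_mono mult_le_mono1)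
    then show "vsize (st (fst z) (snd z)) \<le>
      5 + 2 * N (fst z) + (t (fst z) + t (fst z) * (1 + 2 * N (fst z)))"
      unfolding st_def member_table_def vsize.simps vsize_val_of_list vsize_num_table
      by (simp add: comp_def vsize_num_table sum_list_triv)
  qed
  then have "PT ?H (\<lambda>z. st (fst z) (snd z))" by (rule PT_loop_acc)
  then have st: "PT ?H (\<lambda>z. Node (table (N (fst z)) (\<lambda>v. Num (charge_t (fst z) (snd z) v)))
    (Node (val_of_list (map (\<lambda>k. member_table (N (fst z)) (raised_t (fst z) k)) (rev [0..<snd z])))
      (Num (real (rounds_t (fst z) (snd z))))))"
    by (rule PT_cong) (simp add: st_def)
  note a = PT_Node_D(1)[OF st] PT_Node_D[OF PT_Node_D(2)[OF st]]
  have icH: "inst_ctx hmin \<epsilon> ?H (\<lambda>z. I (fst z)) (\<lambda>z. B (fst z))" by (rule inst_ctx_loop[OF ic])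
  note step = PT_raise[OF M icH PTc_loop_outer[OF Ft] a(1)] PT_charge_step[OF M icH PTc_loop_outer[OF Ft] a(1)]
    PTn_step_rounds[OF M icH PTc_loop_outer[OF Ft] a(1)]
  have "PTn ?H (\<lambda>z. rounds_t (fst z) (snd z))"
    using a(3) by (simp add: PTn_def PTr_def)
  from PT_Node[OF step(2) PT_Node[OF PT_Node[OF step(1) a(2)] PT_Num_nat[OF PTn_add[OF this step(3)]]]]
  have "PT ?H (\<lambda>z. st (fst z) (Suc (snd z)))"
    by (rule PT_cong) (simp add: st_def charge_def raised_def rounds_def member_table_def)
  moreover have "PT G (\<lambda>x. st x 0)"
  proof -
    have "PT G (\<lambda>x. table (N x) (\<lambda>v. Num (real 0)))"
      by (intro PT_table[OF N_t] PT_nat_const)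
    from PT_Node[OF this PT_Node[OF PT_Empty PT_nat_const[of _ 0]]] show ?thesis
      by (rule PT_cong) (simp add: st_def charge_def rounds_def)
  qed
  ultimately have "PT G (\<lambda>x. st x (t x))" by (rule PT_loop[OF t, rotated])
  from PT_Node_D(2)[OF this[unfolded st_def]]
  show "PT G (\<lambda>x. val_of_list (map (\<lambda>k. member_table (N x) (raised_t x k)) (rev [0..<t x])))"
    "PTn G (\<lambda>x. rounds_t x (t x))"
    unfolding PTn_def PTr_def by (rule PT_Node_D)+
qed

lemma PT_phase2:
  "PT G (\<lambda>x. member_table (N x) (chosen_t x (t x)))"
proof -
  define st where "st x j = member_table (N x) (chosen_t x j)" for x j
  let ?H = "loop_ctx G t st"
  have "poly_bounded (iter_ctx G t) (\<lambda>z. 1 + 2 * N (fst z))"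
    using PTc_iter_outer[OF N_t] unfolding PTc_def by (intro poly_bounded_intros) auto
  then have "poly_bounded (iter_ctx G t) (\<lambda>z. vsize (st (fst z) (snd z)))"
    by (rule poly_bounded_mono) (simp add: st_def member_table_def vsize_num_table)
  then have S: "PT ?H (\<lambda>z. member_table (N (fst z)) (chosen_t (fst z) (snd z)))"
    using PT_loop_acc[of G t st] by (simp add: st_def)
  have icH: "inst_ctx hmin \<epsilon> ?H (\<lambda>z. I (fst z)) (\<lambda>z. B (fst z))" by (rule inst_ctx_loop[OF ic])
  have N: "PTc ?H (\<lambda>z. N (fst z))" by (rule PTc_vertices[OF icH])
  have "PT ?H (\<lambda>z. elems (val_of_list (map (\<lambda>k. member_table (N (fst z)) (raised_t (fst z) k))
    (rev [0..<t (fst z)]))) ! snd z)"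
    by (rule PT_nth[OF PT_loop_outer[OF PT_phase1(1)] PTn_loop_index]) auto
  then have R: "PT ?H (\<lambda>z. member_table (N (fst z)) (raised_t (fst z) (t (fst z) - Suc (snd z))))"
    by (rule PT_cong) (auto simp: rev_nth)
  let ?U = "iter_ctx ?H (\<lambda>z. N (fst z))"
  let ?S = "\<lambda>z. chosen_t (fst (fst z)) (snd (fst z))"
  let ?R = "\<lambda>z. raised_t (fst (fst z)) (t (fst (fst z)) - Suc (snd (fst z)))"
  let ?U1 = "restrict_ctx ?U (\<lambda>z. snd z \<in> ?R z)"
  have mem: "PTb ?U (\<lambda>z. snd z \<in> ?S z)" "PTb ?U (\<lambda>z. snd z \<in> ?R z)"
    by (rule PTb_member[OF PT_iter_outer[OF S] PTn_iter_index] PTb_member[OF PT_iter_outer[OF R] PTn_iter_index]; auto)+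
  have "PTb ?U1 (\<lambda>z. compatible (I (fst (fst z))) (?S z) (snd z))"
    by (rule PTb_compatible[OF inst_ctx_restrict[OF inst_ctx_iter[OF icH]] PT_restrict[OF PT_iter_outer[OF S]] _
      PTc_restrict[OF PTc_iter_index[OF N]]]) (auto intro: chosen_valid raised_valid)
  from PTb_disj[OF mem(1) PTb_restrict[OF PTb_conj[OF mem(2) this]]]
  have mem_Suc: "PTb ?U (\<lambda>z. snd z \<in> chosen_t (fst (fst z)) (Suc (snd (fst z))))"
    by (rule PTb_cong) auto
  have "PT ?H (\<lambda>z. member_table (N (fst z)) (chosen_t (fst z) (Suc (snd z))))"
    unfolding member_table_def by (rule PT_table[OF N], rule PT_of_bool, rule mem_Suc)
  then have "PT ?H (\<lambda>z. st (fst z) (Suc (snd z)))"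
    by (rule PT_cong) (simp add: st_def)
  moreover have "PT G (\<lambda>x. st x 0)"
  proof -
    have "PT G (\<lambda>x. table (N x) (\<lambda>v. Num (real 0)))"
      by (intro PT_table[OF N_t] PT_nat_const)
    then show ?thesis by (rule PT_cong) (simp add: st_def member_table_def)
  qed
  ultimately have "PT G (\<lambda>x. st x (t x))" by (rule PT_loop[OF t, rotated])
  then show ?thesis by (simp add: st_def)
qed

lemma PT_simulation:
  assumes i: "PTn G i"
  shows "PT G (\<lambda>x. if rounds_t x (t x) < t x
    then selection (I x) (chosen_t x (t x)) (i x) else Empty)"
  by (intro PT_if PTb_nat_less PT_phase1(2) PTc_PTn[OF t] PT_restrict PT_Empty PT_selection[OF ic PT_phase2] i)
    (rule chosen_valid)

end

section \<open>The distributed algorithm\<close>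

definition node_state :: "real \<Rightarrow> real \<Rightarrow> line_network \<Rightarrow> nat \<Rightarrow> nat \<Rightarrow> val" where
  "node_state hmin \<epsilon> I i t = Node (knowledge (processor_network hmin \<epsilon> I) i)
     (Node (Num (real t)) (knowledge_table hmin \<epsilon> I (ball I t i)))"

text \<open>The model starts a node with its bare knowledge, while later states carry a round number
  and a table; every program has to cope with both shapes.\<close>

definition raw_state :: "real \<Rightarrow> real \<Rightarrow> line_network \<Rightarrow> nat \<Rightarrow> nat \<Rightarrow> val" where
  "raw_state hmin \<epsilon> I i t =
     (if t = 0 then knowledge (processor_network hmin \<epsilon> I) i else node_state hmin \<epsilon> I i t)"

definition simulation :: "algorithm \<Rightarrow> line_network \<Rightarrow> nat \<Rightarrow> nat \<Rightarrow> val" where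
  "simulation M I i t = (let solve = mis_fuel M (vertices I) (Suc t); B = ball I t i
     in if rounds solve I B t < t then selection I (chosen solve I B t t) i else Empty)"

lemma vsize_knowledge:
  assumes "valid_line_network I" "i < processors I"
  shows "vsize (knowledge (processor_network hmin \<epsilon> I) i) \<le> 40 + 2 * resources I"
proof -
  have sub: "acc I i \<subseteq> {..<resources I}" using assms by (auto simp: valid_line_network_def)
  then have "card (acc I i) \<le> resources I" using card_mono[of "{..<resources I}"] by simp
  then show ?thesis
    by (simp add: processor_network_def vsize_val_of_list comp_def sum_list_triv)
qed

lemma vsize_node_state:
  assumes "valid_line_network I" "i < processors I"
  shows "vsize (node_state hmin \<epsilon> I i t) \<le> 44 + 2 * resources I + processors I + processors I * (41 + 2 * resources I)"
proof -
  let ?f = "\<lambda>j. if j \<in> ball I t i then knowledge (processor_network hmin \<epsilon> I) j else Empty"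
  have "vsize (?f j) \<le> 41 + 2 * resources I" if "j < processors I" for j
    using vsize_knowledge[OF assms(1) that, of hmin \<epsilon>] by auto
  then have "sum_list (map (\<lambda>j. vsize (?f j)) [0..<processors I]) \<le>
    sum_list (map (\<lambda>_. 41 + 2 * resources I) [0..<processors I])"
    by (intro sum_list_mono) auto
  then have "vsize (knowledge_table hmin \<epsilon> I (ball I t i)) \<le> 1 + processors I + processors I * (41 + 2 * resources I)"
    unfolding knowledge_table_def table_def vsize_val_of_list by (simp add: comp_def sum_list_triv)
  then show ?thesis
    using vsize_knowledge[OF assms, of hmin \<epsilon>] by (simp add: node_state_def)
qed

context
  fixes hmin \<epsilon> :: real and G :: "'x ctx" and I :: "'x \<Rightarrow> line_network" and i t :: "'x \<Rightarrow> nat"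
  assumes raw: "PT G (\<lambda>x. raw_state hmin \<epsilon> (I x) (i x) (t x))"
    and val: "\<And>x. x \<in> inputs G \<Longrightarrow> valid_line_network (I x)"
    and i: "\<And>x. x \<in> inputs G \<Longrightarrow> i x < processors (I x)"
    and bounds: "\<And>x. x \<in> inputs G \<Longrightarrow> slots (I x) + resources (I x) + processors (I x) + t x \<le> bound G x"
begin

abbreviation "know x j \<equiv> knowledge (processor_network hmin \<epsilon> (I x)) j"

text \<open>The two shapes differ in their first component: the number of slots in the initial
  knowledge, a list afterwards. In round 0 the table is built from the node's own entry.\<close>

lemma PT_node_state: "PT G (\<lambda>x. node_state hmin \<epsilon> (I x) (i x) (t x))"
proof -
  have "PTb G (\<lambda>x. \<exists>u w. (case raw_state hmin \<epsilon> (I x) (i x) (t x) of Node u _ \<Rightarrow> u | _ \<Rightarrow> Empty) = Node u w)"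
    by (rule PTb_is_Node[OF PT_fst_Node[OF raw]])
  then have later: "PTb G (\<lambda>x. t x \<noteq> 0)"
    by (rule PTb_cong) (auto simp: raw_state_def node_state_def processor_network_def)
  let ?H = "restrict_ctx G (\<lambda>x. \<not> t x \<noteq> 0)"
  have own: "PT ?H (\<lambda>x. know x (i x))"
    by (rule PT_cong[OF PT_restrict[OF raw]]) (auto simp: raw_state_def)
  have fields: "PT ?H (\<lambda>x. elems (know x (i x)) ! k)" if "k < 12" for k
    by (rule PT_nth[OF own PTn_const]) (use that in \<open>simp add: processor_network_def eval_nat_numeral\<close>)
  have "PTn ?H i" "PTn ?H (\<lambda>x. processors (I x))"
    using fields[of 5] fields[of 2] by (simp_all add: PTn_def PTr_def processor_network_def eval_nat_numeral)
  moreover have "poly_bounded ?H (\<lambda>x. processors (I x))"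
    by (rule poly_bounded_mono[OF poly_bounded_bound])
      (use bounds in \<open>fastforce simp: restrict_ctx_def\<close>)
  ultimately have "PTn ?H i" and m: "PTc ?H (\<lambda>x. processors (I x))" by (simp_all add: PTc_def)
  then have "PT (iter_ctx ?H (\<lambda>x. processors (I x))) (\<lambda>z. if snd z = i (fst z) then know (fst z) (i (fst z)) else Empty)"
    by (intro PT_if PTb_nat_eq PTn_iter_index PTn_iter_outer PT_restrict PT_iter_outer[OF own] PT_Empty)
  then have "PT ?H (\<lambda>x. table (processors (I x)) (\<lambda>j. if j = i x then know x (i x) else Empty))"
    by (intro PT_table[OF m])
  from PT_Node[OF own PT_Node[OF PT_nat_const[of _ 0] this]]
  have "PT ?H (\<lambda>x. node_state hmin \<epsilon> (I x) (i x) (t x))"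
    by (rule PT_cong) (auto simp: node_state_def knowledge_table_def intro!: table_cong)
  from PT_if[OF later PT_restrict[OF raw] this] show ?thesis
    by (rule PT_cong) (auto simp: raw_state_def)
qed

lemma PT_own: "PT G (\<lambda>x. know x (i x))" "PTn G t"
  "PT G (\<lambda>x. knowledge_table hmin \<epsilon> (I x) (ball (I x) (t x) (i x)))"
  using PT_Node_D[OF PT_node_state[unfolded node_state_def]]
    PT_Node_D[OF PT_Node_D(2)[OF PT_node_state[unfolded node_state_def]]]
  by (simp_all add: PTn_def PTr_def)

lemma PTc_own:
  "PTc G t" "PTc G (\<lambda>x. slots (I x))" "PTc G (\<lambda>x. resources (I x))" "PTc G (\<lambda>x. processors (I x))" "PTn G i"
proof -
  have fields: "PT G (\<lambda>x. elems (know x (i x)) ! k)" if "k < 12" for k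
    by (rule PT_nth[OF PT_own(1) PTn_const]) (use that in \<open>simp add: processor_network_def eval_nat_numeral\<close>)
  have small: "poly_bounded G f" if "\<And>x. x \<in> inputs G \<Longrightarrow> f x \<le> bound G x" for f
    using poly_bounded_bound that by (rule poly_bounded_mono)
  show "PTn G i"
    using fields[of 5] by (simp add: PTn_def PTr_def processor_network_def eval_nat_numeral)
  show "PTc G t" "PTc G (\<lambda>x. slots (I x))" "PTc G (\<lambda>x. resources (I x))" "PTc G (\<lambda>x. processors (I x))"
    unfolding PTc_def using PT_own(2) fields[of 0] fields[of 1] fields[of 2]
    by (auto simp: PTn_def PTr_def processor_network_def eval_nat_numeral intro!: small dest!: bounds)
qed

lemma inst_ctx_ball: "inst_ctx hmin \<epsilon> G I (\<lambda>x. ball (I x) (t x) (i x))"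
  unfolding inst_ctx_def using val PTc_own PT_own(3) by auto

lemma PT_simulation':
  assumes "MIS_algorithm M T"
  shows "PT G (\<lambda>x. simulation M (I x) (i x) (t x))"
  using PT_simulation[OF assms inst_ctx_ball PTc_own(1,5)] by (simp add: simulation_def Let_def)

text \<open>The larger ball is the union of the own ball and those of the neighbours. Entries known
  to several of them coincide, so for each processor the first nonempty entry can be kept.\<close>

lemma PT_merge:
  assumes inbox: "PT G (\<lambda>x. val_of_list (map (\<lambda>u. Node (Num (real u)) (node_state hmin \<epsilon> (I x) u (t x)))
    (filter (linked (I x) (i x)) [0..<processors (I x)])))"
  shows "PT G (\<lambda>x. node_state hmin \<epsilon> (I x) (i x) (Suc (t x)))"
proof -
  define nb where "nb x = filter (linked (I x) (i x)) [0..<processors (I x)]" for x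
  define K where "K x k = ball (I x) (t x) (i x) \<union> (\<Union>u\<in>set (take k (nb x)). ball (I x) (t x) u)" for x k
  let ?U = "iter_ctx G (\<lambda>x. processors (I x))"
  let ?L = "\<lambda>z. val_of_list (map (\<lambda>u. Node (Num (real u)) (node_state hmin \<epsilon> (I (fst z)) u (t (fst z)))) (nb (fst z)))"
  define st where "st z k = (if snd z \<in> K (fst z) k then know (fst z) (snd z) else Empty)" for z :: "'x \<times> nat" and k
  let ?H = "foreach_ctx ?U (\<lambda>z. elems (?L z)) st"
  have L: "PT ?U ?L" using PT_iter_outer[OF inbox] by (simp add: nb_def)
  have "poly_bounded ?H (\<lambda>w. 41 + 2 * resources (I (fst (fst w))))"
    using PTc_own(3) poly_bounded_comp[of G "\<lambda>x. resources (I x)" ?H "\<lambda>w. fst (fst w)"]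
    unfolding PTc_def by (intro poly_bounded_intros) (auto simp: foreach_ctx_def)
  then have "poly_bounded ?H (\<lambda>w. vsize (st (fst w) (snd w)))"
    by (rule poly_bounded_mono)
      (use val vsize_knowledge[of _ _ hmin \<epsilon>] in \<open>fastforce simp: st_def intro: le_SucI\<close>)
  then have acc: "PT ?H (\<lambda>w. st (fst w) (snd w))" by (rule PT_foreach_acc)
  have elem: "PT ?H (\<lambda>w. Node (Num (real (nb (fst (fst w)) ! snd w))) (Node (know (fst (fst w)) (nb (fst (fst w)) ! snd w))
    (Node (Num (real (t (fst (fst w))))) (table (processors (I (fst (fst w)))) (\<lambda>j.
      if j \<in> ball (I (fst (fst w))) (t (fst (fst w))) (nb (fst (fst w)) ! snd w) then know (fst (fst w)) j else Empty)))))"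
    by (rule PT_cong[OF PT_foreach_elem[OF L]]) (auto simp: node_state_def knowledge_table_def)
  note tab = PT_Node_D(2)[OF PT_Node_D(2)[OF PT_Node_D(2)[OF elem]]]
  have idx: "PTn ?H (\<lambda>w. snd (fst w))"
    using PT_foreach_outer[OF PTn_iter_index[unfolded PTn_def PTr_def]] by (simp add: PTn_def PTr_def)
  have entry: "PT ?H (\<lambda>w. if snd (fst w) \<in> ball (I (fst (fst w))) (t (fst (fst w))) (nb (fst (fst w)) ! snd w)
      then know (fst (fst w)) (snd (fst w)) else Empty)"
    by (rule PT_table_nth[OF tab idx]) auto
  have "PT ?H (\<lambda>w. if st (fst w) (snd w) = Empty then
      if snd (fst w) \<in> ball (I (fst (fst w))) (t (fst (fst w))) (nb (fst (fst w)) ! snd w)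
        then know (fst (fst w)) (snd (fst w)) else Empty
      else st (fst w) (snd w))"
    by (rule PT_if[OF PTb_is_Empty[OF acc] PT_restrict[OF entry] PT_restrict[OF acc]])
  then have "PT ?H (\<lambda>w. st (fst w) (Suc (snd w)))"
    by (rule PT_cong) (auto simp: st_def K_def take_Suc_conv_app_nth processor_network_def)
  moreover have "PT ?U (\<lambda>z. st z 0)"
  proof -
    have "PT ?U (\<lambda>z. if snd z \<in> ball (I (fst z)) (t (fst z)) (i (fst z)) then know (fst z) (snd z) else Empty)"
      by (rule PT_table_nth[OF PT_iter_outer[OF PT_own(3)[unfolded knowledge_table_def]] PTn_iter_index]) auto
    then show ?thesis by (rule PT_cong) (simp add: st_def K_def)
  qed
  ultimately have "PT ?U (\<lambda>z. st z (length (elems (?L z))))"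
    by (rule PT_foreach[OF L, rotated])
  then have "PT ?U (\<lambda>z. if snd z \<in> ball (I (fst z)) (Suc (t (fst z))) (i (fst z)) then know (fst z) (snd z) else Empty)"
    by (rule PT_cong) (auto simp: st_def K_def nb_def)
  then have "PT G (\<lambda>x. table (processors (I x)) (\<lambda>j. if j \<in> ball (I x) (Suc (t x)) (i x) then know x j else Empty))"
    by (rule PT_table[OF PTc_own(4)])
  from PT_Node[OF PT_own(1) PT_Node[OF PT_Num_nat[OF PTn_Suc[OF PT_own(2)]] this]]
  show ?thesis by (simp add: node_state_def knowledge_table_def)
qed

end

lemma admissible_valid: "I \<in> admissible hmin \<Longrightarrow> valid_line_network I"
  by (simp add: admissible_def)

lemma processor_network_simps [simp]:
  "nodes (processor_network hmin \<epsilon> I) = processors I"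
  "link (processor_network hmin \<epsilon> I) = linked I"
  by (auto simp: processor_network_def linked_def fun_eq_iff)

text \<open>Messages carry all that a node has collected, updates merge them, and answers are
  simulations. The inputs of the three programs are triples of instance, round and node, so that one
  polynomial bound in size plus round covers all local steps, as \<open>poly_local_time\<close>
  requires.\<close>

lemma gather_algorithm:
  assumes M: "MIS_algorithm M T"
  shows "\<exists>A. poly_local_time A (admissible hmin) (processor_network hmin \<epsilon>)
      (\<lambda>I. slots I + resources I + processors I) \<and>
    (\<forall>I\<in>admissible hmin. \<forall>i<processors I. \<forall>t.
      answer_at A (processor_network hmin \<epsilon> I) t i = simulation M I i t)"
proof -
  define X :: "(line_network \<times> nat \<times> nat) set"
    where "X = {x. fst x \<in> admissible hmin \<and> snd (snd x) < processors (fst x)}"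
  define sz where "sz x = slots (fst x) + resources (fst x) + processors (fst x) + fst (snd x)"
    for x :: "line_network \<times> nat \<times> nat"
  define raw where "raw x = raw_state hmin \<epsilon> (fst x) (snd (snd x)) (fst (snd x))"
    for x :: "line_network \<times> nat \<times> nat"
  define mail where "mail x = val_of_list (map (\<lambda>u. Node (Num (real u)) (node_state hmin \<epsilon> (fst x) u (fst (snd x))))
    (filter (linked (fst x) (snd (snd x))) [0..<processors (fst x)]))" for x :: "line_network \<times> nat \<times> nat"
  define b where "b x = 44 + 2 * sz x + sz x + sz x * (41 + 2 * sz x)" for x :: "line_network \<times> nat \<times> nat"
  have b: "vsize (node_state hmin \<epsilon> (fst x) u (fst (snd x))) \<le> b x" if "x \<in> X" "u < processors (fst x)" for x u
  proof -
    have "vsize (node_state hmin \<epsilon> (fst x) u (fst (snd x))) \<le>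
      44 + 2 * resources (fst x) + processors (fst x) + processors (fst x) * (41 + 2 * resources (fst x))"
      using that admissible_valid unfolding X_def by (intro vsize_node_state) auto
    also have "\<dots> \<le> b x"
      unfolding b_def by (intro add_mono mult_le_mono) (auto simp: sz_def)
    finally show ?thesis .
  qed
  have raw_b: "vsize (raw x) \<le> b x" if "x \<in> X" for x
  proof -
    have "vsize (knowledge (processor_network hmin \<epsilon> (fst x)) (snd (snd x))) \<le>
      vsize (node_state hmin \<epsilon> (fst x) (snd (snd x)) (fst (snd x)))"
      by (simp add: node_state_def)
    then show ?thesis
      using b[OF that, of "snd (snd x)"] that by (auto simp: raw_def raw_state_def X_def)
  qed
  have mail_b: "vsize (mail x) \<le> 1 + sz x + sz x * (2 + b x)" if "x \<in> X" for x
  proof -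
    let ?l = "filter (linked (fst x) (snd (snd x))) [0..<processors (fst x)]"
    have len: "length ?l \<le> sz x"
      using length_filter_le[of "linked (fst x) (snd (snd x))" "[0..<processors (fst x)]"]
      by (simp add: sz_def)
    have "sum_list (map (\<lambda>u. vsize (Node (Num (real u)) (node_state hmin \<epsilon> (fst x) u (fst (snd x))))) ?l) \<le>
      sum_list (map (\<lambda>_. 2 + b x) ?l)"
      using b[OF that] by (intro sum_list_mono) auto
    also have "\<dots> = length ?l * (2 + b x)" by (simp only: sum_list_triv of_nat_id)
    also have "\<dots> \<le> sz x * (2 + b x)" using len by (rule mult_le_mono1)
    finally show ?thesis using len unfolding mail_def vsize_val_of_list by (simp add: comp_def)
  qed
  \<comment> \<open>These are the two environments prescribed by the model: the state alone for
    messages and answers, state and inbox for updates.\<close>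
  define G1 where "G1 = Ctx X sz (\<lambda>x. [raw x])"
  define G2 where "G2 = Ctx X sz (\<lambda>x. [raw x, mail x])"
  have sz: "poly_bounded (Ctx X sz E) sz" for E
    using poly_bounded_bound[of "Ctx X sz E"] by simp
  have poly_b: "poly_bounded (Ctx X sz E) b" for E
    unfolding b_def by (intro poly_bounded_intros sz)
  have raw1: "PT G1 raw"
    unfolding G1_def
    by (rule PT_var[where i = 0, OF _ poly_bounded_mono[OF poly_b]]) (auto simp: raw_b)
  have raw2: "PT G2 raw"
    unfolding G2_def
    by (rule PT_var[where i = 0, OF _ poly_bounded_mono[OF poly_b]]) (auto simp: raw_b)
  have "poly_bounded G2 (\<lambda>x. 1 + sz x + sz x * (2 + b x))"
    unfolding G2_def by (intro poly_bounded_intros sz poly_b)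
  then have mail2: "PT G2 mail"
    by (intro PT_var[where i = 1, OF _ poly_bounded_mono]) (use mail_b in \<open>auto simp: G2_def\<close>)
  have inputs: "valid_line_network (fst x)" "snd (snd x) < processors (fst x)"
    "slots (fst x) + resources (fst x) + processors (fst x) + fst (snd x) \<le> sz x" if "x \<in> X" for x
    using that admissible_valid by (auto simp: X_def sz_def)
  note ctx1 = raw1[unfolded raw_def] and ctx2 = raw2[unfolded raw_def]
  have "PT G1 (\<lambda>x. node_state hmin \<epsilon> (fst x) (snd (snd x)) (fst (snd x)))"
    by (rule PT_node_state[OF ctx1]) (use inputs in \<open>auto simp: G1_def\<close>)
  then obtain em where "\<forall>x\<in>inputs G1. eval em (vars G1 x) = node_state hmin \<epsilon> (fst x) (snd (snd x)) (fst (snd x))"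
    "poly_bounded G1 (\<lambda>x. cost em (vars G1 x))"
    unfolding PT_def by blast
  then have em: "\<And>x. x \<in> X \<Longrightarrow> eval em [raw x] = node_state hmin \<epsilon> (fst x) (snd (snd x)) (fst (snd x))"
    "poly_bounded G1 (\<lambda>x. cost em [raw x])"
    by (simp_all add: G1_def)
  have "PT G1 (\<lambda>x. simulation M (fst x) (snd (snd x)) (fst (snd x)))"
    by (rule PT_simulation'[OF ctx1 _ _ _ M]) (use inputs in \<open>auto simp: G1_def\<close>)
  then obtain ea where "\<forall>x\<in>inputs G1. eval ea (vars G1 x) = simulation M (fst x) (snd (snd x)) (fst (snd x))"
    "poly_bounded G1 (\<lambda>x. cost ea (vars G1 x))"
    unfolding PT_def by blast
  then have ea: "\<And>x. x \<in> X \<Longrightarrow> eval ea [raw x] = simulation M (fst x) (snd (snd x)) (fst (snd x))"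
    "poly_bounded G1 (\<lambda>x. cost ea [raw x])"
    by (simp_all add: G1_def)
  have "PT G2 (\<lambda>x. node_state hmin \<epsilon> (fst x) (snd (snd x)) (Suc (fst (snd x))))"
    by (rule PT_merge[OF ctx2 _ _ _ mail2[unfolded mail_def]]) (use inputs in \<open>auto simp: G2_def\<close>)
  then obtain eu where "\<forall>x\<in>inputs G2. eval eu (vars G2 x) = node_state hmin \<epsilon> (fst x) (snd (snd x)) (Suc (fst (snd x)))"
    "poly_bounded G2 (\<lambda>x. cost eu (vars G2 x))"
    unfolding PT_def by blast
  then have eu: "\<And>x. x \<in> X \<Longrightarrow> eval eu [raw x, mail x] = node_state hmin \<epsilon> (fst x) (snd (snd x)) (Suc (fst (snd x)))"
    "poly_bounded G2 (\<lambda>x. cost eu [raw x, mail x])"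
    by (simp_all add: G2_def)
  define A where "A = \<lparr>message = em, update = eu, answer = ea\<rparr>"
  let ?net = "processor_network hmin \<epsilon>"
  have mail: "inbox A (?net I) st i = mail (I, t, i)"
    if "I \<in> admissible hmin" "\<And>u. u < processors I \<Longrightarrow> st u = raw (I, t, u)" for I st t i
    unfolding inbox_def mail_def using that em(1)[of "(I, t, _)"]
    by (auto simp: A_def X_def intro!: arg_cong[of _ _ val_of_list])
  have state: "state A (?net I) t i = raw (I, t, i)" if "I \<in> admissible hmin" "i < processors I" for I t i
    using that(2)
  proof (induction t arbitrary: i)
    case 0
    then show ?case by (simp add: raw_def raw_state_def)
  next
    case (Suc t)
    have "state A (?net I) (Suc t) i = eval eu [raw (I, t, i), mail (I, t, i)]"
      using mail[OF that(1), of "state A (?net I) t" t i] Suc by (simp add: A_def)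
    also have "\<dots> = raw (I, Suc t, i)"
      using eu(1)[of "(I, t, i)"] that(1) Suc.prems by (simp add: X_def raw_def raw_state_def)
    finally show ?case .
  qed
  have "poly_bounded (Ctx X sz (\<lambda>_. [])) (\<lambda>x. cost ea [raw x] + cost em [raw x] + cost eu [raw x, mail x])"
    using em(2) ea(2) eu(2) by (intro poly_bounded_add) (simp_all add: poly_bounded_def G1_def G2_def)
  then obtain c d where cd: "\<And>x. x \<in> X \<Longrightarrow> cost ea [raw x] + cost em [raw x] + cost eu [raw x, mail x] \<le> c * (sz x + 1) ^ d"
    by (auto simp: poly_bounded_def)
  have "local_cost A (?net I) t i \<le> c * (slots I + resources I + processors I + t + 1) ^ d"
    if "I \<in> admissible hmin" "i < processors I" for I t i
    using cd[of "(I, t, i)"] that state[OF that] mail[OF that(1), of "state A (?net I) t" t i] state[OF that(1)]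
    by (simp add: local_cost_def A_def X_def sz_def)
  then have "poly_local_time A (admissible hmin) ?net (\<lambda>I. slots I + resources I + processors I)"
    unfolding poly_local_time_def by (intro exI[of _ c] exI[of _ d]) auto
  moreover have "answer_at A (?net I) t i = simulation M I i t"
    if "I \<in> admissible hmin" "i < processors I" for I i t
    using ea(1)[of "(I, t, i)"] state[OF that] that by (simp add: answer_at_def A_def X_def)
  ultimately show ?thesis by blast
qed

subsection \<open>The selected instances\<close>

definition instance_of :: "line_network \<Rightarrow> nat \<Rightarrow> nat \<times> nat \<times> nat" where
  "instance_of I v = (proc_of I v, res_of I v, start_of I v)"

lemma instance_of_covers:
  "e \<in> occupied I (instance_of I v) \<longleftrightarrow> covers I v e"
  by (simp add: occupied_def instance_of_def covers_def len_of_def)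

lemma instance_of_valid:
  assumes "valid_line_network I" "valid I B v"
  shows "instance_of I v \<in> demand_instances I"
  using assms vertices_proc_of[OF valid_less[OF assms(2)]]
  unfolding valid_def demand_instances_def occupied_def instance_of_def len_of_def by auto

lemma instance_of_surj:
  assumes I: "valid_line_network I" and d: "d \<in> demand_instances I"
  obtains v where "valid I UNIV v" "instance_of I v = d"
proof -
  obtain i T s where dd: "d = (i, T, s)" by (cases d)
  have i: "i < processors I" "T \<in> acc I i" "T < resources I"
    and occ: "{s..<s + proc_time (demand_of I i)} \<subseteq> {release (demand_of I i)..deadline (demand_of I i)}"
    and rel: "1 \<le> release (demand_of I i)" "deadline (demand_of I i) \<le> slots I" "1 \<le> proc_time (demand_of I i)"
    using I d unfolding dd demand_instances_def occupied_def valid_line_network_def by auto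
  have s: "release (demand_of I i) \<le> s" "s + proc_time (demand_of I i) \<le> Suc (deadline (demand_of I i))"
  proof -
    have "s \<in> {s..<s + proc_time (demand_of I i)}" using rel(3) by simp
    from subsetD[OF occ this] show "release (demand_of I i) \<le> s" by simp
    have "s + proc_time (demand_of I i) - 1 \<in> {s..<s + proc_time (demand_of I i)}" using rel(3) by auto
    from subsetD[OF occ this] show "s + proc_time (demand_of I i) \<le> Suc (deadline (demand_of I i))"
      unfolding atLeastAtMost_iff by linarith
  qed
  have sn: "1 \<le> s" "s \<le> slots I" using s rel by auto
  obtain s0 where s0: "s = Suc s0" "s0 < slots I" using sn by (cases s) auto
  define w where "w = T * slots I + s0"
  have w: "w < resources I * slots I"
  proof -
    have "w < Suc T * slots I" using s0 by (simp add: w_def)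
    also have "\<dots> \<le> resources I * slots I" using i by (intro mult_le_mono1) simp
    finally show ?thesis .
  qed
  \<comment> \<open>The mixed-radix number with digits \<open>i\<close>, \<open>T\<close> and
    \<open>s0\<close>; the remaining steps read the digits off again.\<close>
  define v where "v = i * (resources I * slots I) + w"
  have n: "0 < slots I" using sn by simp
  have "resources I \<noteq> 0" using i by auto
  then have "proc_of I v = i" using w n by (simp add: proc_of_def v_def)
  moreover have "v div slots I = i * resources I + T"
  proof -
    have "v = s0 + (i * resources I + T) * slots I" by (simp add: v_def w_def algebra_simps)
    then show ?thesis using s0(2) by simp
  qed
  then have "res_of I v = T" using i by (simp add: res_of_def)
  moreover have "start_of I v = s"
  proof -
    have "v = s0 + (i * resources I + T) * slots I" by (simp add: v_def w_def algebra_simps)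
    then have "v mod slots I = s0" using s0(2) by simp
    then show ?thesis using s0(1) by (simp add: start_of_def)
  qed
  moreover have "v < vertices I"
  proof -
    have "v < Suc i * (resources I * slots I)" using w by (simp add: v_def)
    also have "\<dots> \<le> processors I * (resources I * slots I)" using i by (intro mult_le_mono1) simp
    also have "\<dots> = vertices I" by (simp add: vertices_def)
    finally show ?thesis .
  qed
  ultimately have "valid I UNIV v" "instance_of I v = d"
    using i s by (simp_all add: valid_def instance_of_def dd len_of_def)
  then show thesis by (rule that)
qed

text \<open>With a unique surviving vertex per processor, each sum has exactly one nonvanishing
  condition and so returns the value at that vertex.\<close>

lemma selection_eq:
  assumes uniq: "\<And>u v. u \<in> better_class I S \<Longrightarrow> v \<in> better_class I S \<Longrightarrow> proc_of I u = proc_of I v \<Longrightarrow> u = v"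
    and v: "v \<in> better_class I S" "v < vertices I"
  shows "selection I S (proc_of I v) = Node (Num (real (res_of I v))) (Num (real (start_of I v)))"
proof -
  have "(\<Sum>u<vertices I. if u \<in> better_class I S \<and> proc_of I u = proc_of I v then f u else 0) = f v" for f :: "nat \<Rightarrow> nat"
  proof -
    have "(\<Sum>u<vertices I. if u \<in> better_class I S \<and> proc_of I u = proc_of I v then f u else 0) =
      (\<Sum>u<vertices I. if u = v then f u else 0)"
      using uniq v(1) by (intro sum.cong) auto
    then show ?thesis using v(2) by simp
  qed
  then show ?thesis using v unfolding selection_def by auto
qed

lemma selection_cong:
  assumes "\<And>v. proc_of I v = i \<Longrightarrow> v \<in> better_class I S \<longleftrightarrow> v \<in> better_class I S'"
  shows "selection I S i = selection I S' i"
proof -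
  have eq: "v \<in> better_class I S \<and> proc_of I v = i \<longleftrightarrow> v \<in> better_class I S' \<and> proc_of I v = i" for v
    using assms by blast
  show ?thesis unfolding selection_def by (simp only: eq)
qed

lemma selection_not_Empty: "selection I S i \<noteq> Empty"
  by (simp add: selection_def)

context line_run
begin

abbreviation "final \<equiv> chosen mis I B step_bound step_bound"

lemma better_class_final:
  "u \<in> better_class I final \<Longrightarrow> valid I B u"
  "u \<in> better_class I final \<Longrightarrow> v \<in> better_class I final \<Longrightarrow> proc_of I u = proc_of I v \<Longrightarrow> u = v"
  using packed_chosen[of step_bound step_bound] by (auto simp: better_class_def packed_def)

lemma selected_final:
  "{(i, T, s). i < processors I \<and> selection I final i = Node (Num (real T)) (Num (real s))} =
    instance_of I ` better_class I final"
proof (intro set_eqI iffI)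
  fix d assume "d \<in> {(i, T, s). i < processors I \<and> selection I final i = Node (Num (real T)) (Num (real s))}"
  then obtain i T s where d: "d = (i, T, s)" "selection I final i = Node (Num (real T)) (Num (real s))"
    by auto
  then obtain v where v: "v < vertices I" "v \<in> better_class I final" "proc_of I v = i"
    by (auto simp: selection_def split: if_splits)
  have "selection I final (proc_of I v) = Node (Num (real (res_of I v))) (Num (real (start_of I v)))"
    by (rule selection_eq[OF better_class_final(2) v(2,1)])
  then have "d = instance_of I v" using d v(3) by (simp add: instance_of_def)
  then show "d \<in> instance_of I ` better_class I final" using v by blast
next
  fix d assume "d \<in> instance_of I ` better_class I final"
  then obtain v where v: "d = instance_of I v" "v \<in> better_class I final" by blast
  have less: "v < vertices I" using better_class_final(1)[OF v(2)] by (rule valid_less)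
  have "selection I final (proc_of I v) = Node (Num (real (res_of I v))) (Num (real (start_of I v)))"
    by (rule selection_eq[OF better_class_final(2) v(2) less])
  then show "d \<in> {(i, T, s). i < processors I \<and> selection I final i = Node (Num (real T)) (Num (real s))}"
    using v(1) vertices_proc_of[OF less] by (simp add: instance_of_def)
qed

lemma inj_on_instance_of:
  "inj_on (instance_of I) (better_class I final)"
  using better_class_final(2) by (auto simp: inj_on_def instance_of_def)

lemma feasible_final: "feasible I (instance_of I ` better_class I final)"
  unfolding feasible_def
proof (intro conjI ballI allI impI)
  show "instance_of I ` better_class I final \<subseteq> demand_instances I"
    using instance_of_valid better_class_final(1) adm unfolding admissible_def by blast
  show "d = e" if "d \<in> instance_of I ` better_class I final" "e \<in> instance_of I ` better_class I final" "fst d = fst e" for d e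
  proof -
    obtain u v where "u \<in> better_class I final" "v \<in> better_class I final" "d = instance_of I u" "e = instance_of I v"
      using \<open>d \<in> _\<close> \<open>e \<in> _\<close> by blast
    then show ?thesis using better_class_final(2)[of u v] that(3) by (simp add: instance_of_def)
  qed
  fix T t
  have "{d \<in> instance_of I ` better_class I final. fst (snd d) = T \<and> t \<in> occupied I d} =
    instance_of I ` {v \<in> better_class I final. res_of I v = T \<and> covers I v t}"
    using instance_of_covers[of t I] by (auto simp: instance_of_def)
  then have "(\<Sum>d\<in>{d \<in> instance_of I ` better_class I final. fst (snd d) = T \<and> t \<in> occupied I d}. height (demand_of I (fst d))) =
    (\<Sum>v\<in>{v \<in> better_class I final. res_of I v = T \<and> covers I v t}. height_of I v)"
    using inj_on_subset[OF inj_on_instance_of, of "{v \<in> better_class I final. res_of I v = T \<and> covers I v t}"]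
    by (simp add: sum.reindex comp_def height_of_def) (simp add: instance_of_def)
  also have "\<dots> \<le> 1" by (rule better_class_packed[OF packed_chosen])
  finally show "(\<Sum>d\<in>{d \<in> instance_of I ` better_class I final. fst (snd d) = T \<and> t \<in> occupied I d}. height (demand_of I (fst d))) \<le> 1" .
qed

lemma total_profit_final:
  "total_profit I (instance_of I ` better_class I final) = (\<Sum>v\<in>better_class I final. profit_of I v)"
  unfolding total_profit_def using inj_on_instance_of
  by (simp add: sum.reindex comp_def profit_of_def) (simp add: instance_of_def)

end

text \<open>A feasible set becomes a set of vertices through the encoding, which is onto the demand
  instances because with \<open>B = UNIV\<close> no processor is left out. Feasibility then provides
  the premises of \<open>profit_ratio\<close>.\<close>

lemma (in line_run) profit_final:
  assumes B: "B = UNIV" and S: "feasible I S"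
  shows "total_profit I S \<le> 21 * total_profit I (instance_of I ` better_class I final)"
proof -
  define A where "A = {v. valid I B v \<and> instance_of I v \<in> S}"
  have SI: "S \<subseteq> demand_instances I" and Sp: "\<And>d e. d \<in> S \<Longrightarrow> e \<in> S \<Longrightarrow> fst d = fst e \<Longrightarrow> d = e"
    and Sl: "\<And>T t. T < resources I \<Longrightarrow> t \<in> {1..slots I} \<Longrightarrow>
      (\<Sum>d\<in>{d \<in> S. fst (snd d) = T \<and> t \<in> occupied I d}. height (demand_of I (fst d))) \<le> 1"
    using S unfolding feasible_def by blast+
  have val: "valid_line_network I" using adm by (simp add: admissible_def)
  have image: "instance_of I ` A = S"
  proof
    show "S \<subseteq> instance_of I ` A"
    proof
      fix d assume d: "d \<in> S"
      then obtain v where "valid I UNIV v" "instance_of I v = d"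
        using SI instance_of_surj[OF val, of d] by blast
      then show "d \<in> instance_of I ` A" using d B by (auto simp: A_def)
    qed
  qed (auto simp: A_def)
  have inj: "u = v" if "u < vertices I" "v < vertices I" "instance_of I u = instance_of I v" for u v
  proof -
    have eq: "proc_of I u = proc_of I v" "res_of I u = res_of I v" "u mod slots I = v mod slots I"
      using that(3) by (auto simp: instance_of_def start_of_def)
    have "proc_of I w = w div slots I div resources I" for w
      unfolding proc_of_def by (metis div_mult2_eq mult.commute)
    then have "u div slots I = v div slots I"
      using eq(1,2) unfolding res_of_def by (metis div_mult_mod_eq)
    then show ?thesis using eq(3) by (metis div_mult_mod_eq)
  qed
  then have injA: "inj_on (instance_of I) A"
    by (auto simp: inj_on_def A_def dest: valid_less)
  have "(\<Sum>v\<in>A. profit_of I v) \<le> 21 * (\<Sum>v\<in>better_class I final. profit_of I v)"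
  proof (rule profit_ratio)
    show "\<not> unsat I B (ch step_bound) v" for v by (rule all_satisfied) simp
    show "valid I B v" if "v \<in> A" for v using that by (simp add: A_def)
    show "v = w" if "v \<in> A" "w \<in> A" "proc_of I v = proc_of I w" for v w
      using that Sp[of "instance_of I v" "instance_of I w"] inj_onD[OF injA, of v w]
      by (auto simp: A_def instance_of_def)
    show "(\<Sum>v\<in>{v \<in> A. res_of I v = T \<and> covers I v e}. height_of I v) \<le> 1" for T e
    proof (cases "T < resources I \<and> e \<in> {1..slots I}")
      case True
      have "{d \<in> S. fst (snd d) = T \<and> e \<in> occupied I d} = instance_of I ` {v \<in> A. res_of I v = T \<and> covers I v e}"
        using instance_of_covers[of e I] by (auto simp: image[symmetric] instance_of_def)
      then have "(\<Sum>d\<in>{d \<in> S. fst (snd d) = T \<and> e \<in> occupied I d}. height (demand_of I (fst d))) =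
        (\<Sum>v\<in>{v \<in> A. res_of I v = T \<and> covers I v e}. height_of I v)"
        using inj_on_subset[OF injA, of "{v \<in> A. res_of I v = T \<and> covers I v e}"]
        by (simp add: sum.reindex comp_def height_of_def) (simp add: instance_of_def)
      then show ?thesis using Sl[of T e] True by simp
    next
      case False
      \<comment> \<open>Feasibility speaks only of existing resources and slots; elsewhere there is
        no valid vertex and the sum is empty.\<close>
      have "T < resources I \<and> e \<in> {1..slots I}" if "v \<in> A" "res_of I v = T" "covers I v e" for v
        using that validD(8,9)[of v] by (auto simp: A_def covers_def start_of_def)
      then have "{v \<in> A. res_of I v = T \<and> covers I v e} = {}" using False by blast
      then show ?thesis by (metis sum.empty zero_le_one)
    qed
  qed
  moreover have "total_profit I S = (\<Sum>v\<in>A. profit_of I v)"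
    unfolding total_profit_def image[symmetric] using injA
    by (simp add: sum.reindex comp_def profit_of_def) (simp add: instance_of_def)
  ultimately show ?thesis by (simp add: total_profit_final)
qed

section \<open>The round bound and the correctness of the distributed algorithm\<close>

lemma (in line_run) rounds_bound:
  assumes "\<And>E. simple_graph (vertices I) E \<Longrightarrow> snd (mis E) \<le> r"
  shows "rounds mis I B k \<le> step_bound * (r + 4)"
proof -
  \<comment> \<open>Steps from \<open>step_bound\<close> on find everything satisfied and count as
    0, so the bound holds for any \<open>k\<close>.\<close>
  have "rounds mis I B k \<le> (\<Sum>j<k. if j < step_bound then r + 4 else 0)"
    unfolding rounds_def
    using assms[OF simple_graph_conflict_graph] all_satisfied
    by (intro sum_mono) (auto simp: step_rounds_def not_less)
  also have "\<dots> = (\<Sum>j\<in>{..<k} \<inter> {j. j < step_bound}. r + 4)"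
    by (simp add: sum.If_cases)
  also have "\<dots> \<le> (\<Sum>j<step_bound. r + 4)"
    by (intro sum_mono2) auto
  finally show ?thesis by simp
qed

text \<open>The first alternative gives termination, the second the correctness of an early answer.
  Either way one of the two counts is below \<open>t\<close>, so fueled and true solver run alike in
  the ball, and by locality \<open>i\<close> gets what the run on all processors gives it. Hence
  answers of different processors in different rounds fit together.\<close>

lemma (in local_run) simulation_complete:
  assumes "rounds (mis_run M (vertices I)) I (ball I t i) t < t \<or> simulation M I i t \<noteq> Empty"
  shows "simulation M I i t = selection I full.final i"
proof -
  let ?solve = "mis_fuel M (vertices I) (Suc t)"
  have less: "rounds run I (ball I t i) t < t \<or> rounds ?solve I (ball I t i) t < t"
    using assms by (auto simp: simulation_def Let_def split: if_splits)
  then have "rounds ?solve I (ball I t i) t \<le> t \<or> rounds run I (ball I t i) t \<le> t" by auto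
  note agree = run_agree[of I ?solve t run, OF mis_fuel_agree[OF M] this]
  have D: "rounds ?solve I (ball I t i) t = rounds run I (ball I t i) t"
    using agree by blast
  then have lt: "rounds run I (ball I t i) t < t"
    using less by simp
  have "chosen ?solve I (ball I t i) t t = chosen run I (ball I t i) t t"
    by (rule chosen_agree) (use agree in auto)
  then have "simulation M I i t = selection I (chosen run I (ball I t i) t t) i"
    using lt D by (simp add: simulation_def Let_def)
  also have "\<dots> = selection I full.final i"
    by (rule selection_cong) (use local_output[OF lt order_refl] in simp)
  finally show ?thesis .
qed

lemma nat_floor_log_le: "real (Suc (nat \<lfloor>log 2 x\<rfloor>)) \<le> 2 * log1 x"
  unfolding log1_def by linarith

text \<open>The constant is \<open>2 * 2 * 3\<close>: each rounded logarithm plus 1 is at most twice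
  \<open>log1\<close>, and rounding up \<open>2 / hmin\<close> gives at most
  \<open>3 / hmin\<close>.\<close>

lemma (in line_run) step_bound_le:
  "real step_bound \<le> 12 * (1 / hmin * log1 (real (slots I)) * log1 (p_max I / p_min I))"
proof -
  have "real (nat \<lceil>2 / hmin\<rceil>) \<le> 2 / hmin + 1"
    using hmin by (simp add: of_nat_nat)
  also have "\<dots> \<le> 3 / hmin" using hmin by (simp add: field_simps)
  finally have J: "real (nat \<lceil>2 / hmin\<rceil>) \<le> 3 / hmin" .
  have "real step_bound = real (Suc (nat \<lfloor>log 2 (slots I)\<rfloor>)) * real levels * real (nat \<lceil>2 / hmin\<rceil>)"
    by (simp only: step_bound_def of_nat_mult)
  also have "\<dots> \<le> (2 * log1 (real (slots I))) * (2 * log1 (p_max I / p_min I)) * (3 / hmin)"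
    using nat_floor_log_le[of "real (slots I)"] nat_floor_log_le[of "p_max I / p_min I"] J hmin
    unfolding levels_def
    by (intro mult_mono mult_nonneg_nonneg J of_nat_0_le_iff) (auto simp: log1_def simp del: of_nat_Suc)
  finally show ?thesis by (simp add: mult_ac)
qed

theorem theorem4:
  shows "\<exists>C::real. \<forall>M T. MIS_algorithm M T \<longrightarrow>
    (\<forall>hmin \<epsilon> :: real. 0 < hmin \<and> hmin \<le> 1 / 2 \<and> 0 < \<epsilon> \<longrightarrow>
      (\<exists>A.
        poly_local_time A (admissible hmin) (processor_network hmin \<epsilon>)
          (\<lambda>I. slots I + resources I + processors I) \<and>
        (\<forall>I\<in>admissible hmin.
          let S = selected A (processor_network hmin \<epsilon> I);
              N = slots I * processors I * resources I
          in feasible I S \<and>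
             (\<forall>Opt. optimal I Opt \<longrightarrow> total_profit I S \<ge> total_profit I Opt / (23 + \<epsilon>)) \<and>
             (\<exists>t. terminates_within A (processor_network hmin \<epsilon> I) t \<and>
                real t \<le> C * (real (max 1 (T N)) / hmin * log1 (real (slots I)) *
                  log1 (1 / \<epsilon>) * log1 (p_max I / p_min I))))))"
proof (intro exI[of _ 61] allI impI)
  fix M T and hmin \<epsilon> :: real
  assume M: "MIS_algorithm M T" and h: "0 < hmin \<and> hmin \<le> 1 / 2 \<and> 0 < \<epsilon>"
  let ?net = "processor_network hmin \<epsilon>"
  obtain A where A: "poly_local_time A (admissible hmin) ?net (\<lambda>I. slots I + resources I + processors I)"
    and ans: "\<And>I i t. I \<in> admissible hmin \<Longrightarrow> i < processors I \<Longrightarrow> answer_at A (?net I) t i = simulation M I i t"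
    using gather_algorithm[OF M] by blast
  show "\<exists>A. poly_local_time A (admissible hmin) ?net (\<lambda>I. slots I + resources I + processors I) \<and>
    (\<forall>I\<in>admissible hmin.
      let S = selected A (?net I); N = slots I * processors I * resources I
      in feasible I S \<and>
         (\<forall>Opt. optimal I Opt \<longrightarrow> total_profit I S \<ge> total_profit I Opt / (23 + \<epsilon>)) \<and>
         (\<exists>t. terminates_within A (?net I) t \<and>
            real t \<le> 61 * (real (max 1 (T N)) / hmin * log1 (real (slots I)) *
              log1 (1 / \<epsilon>) * log1 (p_max I / p_min I))))"
  proof (intro exI[of _ A] conjI A ballI)
    fix I assume I: "I \<in> admissible hmin"
    define N where "N = slots I * processors I * resources I"
    have N: "vertices I = N" by (simp add: N_def vertices_def)
    interpret full: line_run I UNIV "mis_run M (vertices I)" hmin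
      by unfold_locales (use I h maximal_independent_mis_run[OF M] in auto)
    \<comment> \<open>In every ball the count is at most \<open>full.step_bound * (T N + 4)\<close>;
      the extra 1 makes the strict test in \<open>simulation\<close> succeed.\<close>
    define t where "t = full.step_bound * (T N + 4) + 1"
    have complete: "simulation M I i t = selection I full.final i" if i: "i < processors I" for i
    proof -
      interpret local_run I M T hmin i t
        by unfold_locales (use I h M i in auto)
      have "rounds (mis_run M (vertices I)) I (ball I t i) t \<le> full.step_bound * (T N + 4)"
        by (rule known.rounds_bound) (use terminates_within_mis_time(2)[OF M] in \<open>simp add: mis_run_def N\<close>)
      then show ?thesis by (intro simulation_complete disjI1) (simp add: t_def)
    qed
    have correct: "simulation M I i s = selection I full.final i"
      if "i < processors I" "simulation M I i s \<noteq> Empty" for i s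
    proof -
      interpret local_run I M T hmin i s
        by unfold_locales (use I h M that in auto)
      show ?thesis using that(2) by (intro simulation_complete disjI2)
    qed
    have outcome: "outcome A (?net I) i = selection I full.final i" if i: "i < processors I" for i
    proof -
      have "answer_at A (?net I) t i \<noteq> Empty"
        using complete[OF i] ans[OF I i] by (simp add: selection_not_Empty)
      \<comment> \<open>The first answer may come before round \<open>t\<close>; it is nonempty, and
        \<open>correct\<close> applies to every nonempty answer.\<close>
      then have "answer_at A (?net I) (LEAST s. answer_at A (?net I) s i \<noteq> Empty) i \<noteq> Empty"
        by (rule LeastI)
      then show ?thesis unfolding outcome_def using correct[OF i] ans[OF I i] by simp
    qed
    have sel: "selected A (?net I) = instance_of I ` better_class I full.final"
      unfolding full.selected_final[symmetric] selected_def using outcome by auto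
    have "total_profit I Opt / (23 + \<epsilon>) \<le> total_profit I (selected A (?net I))" if "optimal I Opt" for Opt
    proof -
      have "feasible I Opt" using that by (simp add: optimal_def)
      then have le: "total_profit I Opt \<le> 21 * total_profit I (selected A (?net I))"
        unfolding sel by (rule full.profit_final[OF refl])
      have "0 \<le> total_profit I (selected A (?net I))"
        unfolding sel full.total_profit_final using full.better_class_final(1) full.validD(3)
        by (intro sum_nonneg) (auto intro: less_imp_le)
      then have "21 * total_profit I (selected A (?net I)) \<le> (23 + \<epsilon>) * total_profit I (selected A (?net I))"
        using h by (intro mult_right_mono) auto
      with le show ?thesis using h by (simp add: field_simps)
    qed
    moreover have "feasible I (selected A (?net I))"
      unfolding sel by (rule full.feasible_final)
    moreover have "terminates_within A (?net I) t"
      unfolding terminates_within_def using complete ans[OF I] selection_not_Empty by auto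
    moreover have "real t \<le> 61 * (real (max 1 (T N)) / hmin * log1 (real (slots I)) *
      log1 (1 / \<epsilon>) * log1 (p_max I / p_min I))"
    proof -
      define \<tau> where "\<tau> = real (max 1 (T N))"
      define a where "a = 1 / hmin * log1 (real (slots I)) * log1 (p_max I / p_min I)"
      have ge1: "1 \<le> \<tau>" "1 \<le> log1 x" for x by (auto simp: \<tau>_def log1_def)
      have "1 * 1 * 1 \<le> a"
        unfolding a_def using h ge1(2) by (intro mult_mono) (auto simp: log1_def)
      then have a: "1 \<le> a" by simp
      \<comment> \<open>The 4 extra rounds per step are absorbed by \<open>max 1 (T N)\<close>. With
        12 from the number of steps and the additional round in \<open>t\<close>, this yields
        \<open>12 * 5 + 1 = 61\<close>.\<close>
      have T: "real (T N) + 4 \<le> 5 * \<tau>" by (simp add: \<tau>_def)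
      have sb: "real full.step_bound \<le> 12 * a"
        using full.step_bound_le by (simp add: a_def)
      have "real full.step_bound * (real (T N) + 4) \<le> 12 * a * (5 * \<tau>)"
        using sb T a by (intro mult_mono) auto
      moreover have "1 * 1 \<le> a * \<tau>" using a ge1 by (intro mult_mono) auto
      ultimately have "real t \<le> 61 * (a * \<tau>)" by (simp add: t_def)
      also have "\<dots> \<le> 61 * (a * \<tau>) * log1 (1 / \<epsilon>)"
        using mult_left_mono[OF ge1(2)[of "1 / \<epsilon>"], of "61 * (a * \<tau>)"] a ge1(1) by simp
      finally show ?thesis unfolding a_def \<tau>_def by (simp add: mult_ac)
    qed
    ultimately show "let S = selected A (?net I); N = slots I * processors I * resources I
      in feasible I S \<and>
         (\<forall>Opt. optimal I Opt \<longrightarrow> total_profit I S \<ge> total_profit I Opt / (23 + \<epsilon>)) \<and>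
         (\<exists>t. terminates_within A (?net I) t \<and>
            real t \<le> 61 * (real (max 1 (T N)) / hmin * log1 (real (slots I)) *
              log1 (1 / \<epsilon>) * log1 (p_max I / p_min I)))"
      unfolding Let_def N_def by blast
  qed
qed

end
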